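(* There is an algorithm that, given positive integers $p,k,n$, a matrix $A\in\mathbb{R}^{k\times n}$, and an oracle presentation of a nonempty set $\Lambda$ of $p$-shapes of $n$, enumerates the set of vertices of the Shaped Partition Polytope $\mathcal{P}_A^\Lambda$ using $O\big(n^{k^2p^3}\big)$ real arithmetic operations and oracle queries, where the constant implied by $O(\cdot)$ depends only on $k$ and $p$. For rational $A$ and fixed $p$ and $k$ this is a strongly polynomial time oracle algorithm.
   Context: Write $[n]=\{1,\ldots,n\}$ and let $A^i$ denote the $i$th column of $A$. A $p$-partition of $[n]$ is an ordered tuple $\pi=(\pi_1,\ldots,\pi_p)$ of pairwise disjoint, possibly empty, sets whose union is $[n]$. A $p$-shape of $n$ is a tuple $\lambda=(\lambda_1,\ldots,\lambda_p)$ of nonnegative integers with $\sum_{i=1}^p\lambda_i=n$. The shape of $\pi$ is $|\pi|=(|\pi_1|,\ldots,|\pi_p|)$. The $A$-matrix of $\pi$ is the $k\times p$ matrix $A^\pi=\big[\sum_{i\in\pi_1}A^i,\ldots,\sum_{i\in\pi_p}A^i\big]$, where an empty sum is $0$. The Shaped Partition Polytope is $\mathcal{P}_A^\Lambda=\mathrm{conv}\{A^\pi:\ \pi \text{ a } p\text{-partition of } [n],\ |\pi|\in\Lambda\}\subset\mathbb{R}^{k\times p}$. Oracle presentation of $\Lambda$: an oracle which, queried on a $p$-shape $\lambda$ of $n$, answers whether or not $\lambda\in\Lambda$. In the real arithmetic model each arithmetic operation ($+,-,\times,\div$) or comparison of real numbers is a single step. A (oracle) algorithm is strongly polynomial time if,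 in the real arithmetic model, the number of arithmetic operations (and oracle queries) is polynomial in the number of input numbers (here, in $n$ for fixed $p,k$), and, on rational input, the bit sizes of all numbers occurring are polynomial in the bit size of the input. *)

theory Defs
  imports
    "HOL-Analysis.Analysis"
    "HOL-Library.Function_Algebras"
    "HOL-Library.Log_Nat"
    "HOL-Computational_Algebra.Polynomial"
begin

section \<open>Matrices of variable size\<close>

text \<open>One algorithm serves all dimensions, so the sizes cannot be types. A real \<open>k \<times> n\<close> matrix is a
  function of a row and a column index, both counted from \<open>0\<close>, that vanishes outside the index
  range. These functions form a subspace isomorphic to \<open>\<real>\<^bsup>k\<times>n\<^esup>\<close> of the real vector space of all
  functions; the instance below makes the library's \<open>convex hull\<close> and \<open>extreme_point_of\<close> apply.\<close>

instantiation "fun" :: (type, scaleR) scaleR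
begin
definition scaleR_fun_def: "c *\<^sub>R f = (\<lambda>x. c *\<^sub>R f x)"
instance ..
end

lemma scaleR_fun_apply [simp]: "(c *\<^sub>R f) x = c *\<^sub>R f x"
  by (simp add: scaleR_fun_def)

instance "fun" :: (type, real_vector) real_vector
  by standard (auto simp: fun_eq_iff scaleR_add_right scaleR_add_left)

type_synonym matrix = "nat \<Rightarrow> nat \<Rightarrow> real"

definition matrices :: "nat \<Rightarrow> nat \<Rightarrow> matrix set" where
  "matrices k n = {A. \<forall>i j. \<not> (i < k \<and> j < n) \<longrightarrow> A i j = 0}"

definition entries :: "nat \<Rightarrow> nat \<Rightarrow> matrix \<Rightarrow> real list" where
  "entries k p V = [V i j. i \<leftarrow> [0..<k], j \<leftarrow> [0..<p]]"


section \<open>Shaped partition polytopes\<close>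

text \<open>The ground set is \<open>{..<n}\<close>, matching the column indices; tuples are lists.\<close>

definition is_partition :: "nat \<Rightarrow> nat \<Rightarrow> nat set list \<Rightarrow> bool" where
  "is_partition p n \<pi> \<longleftrightarrow> length \<pi> = p
     \<and> (\<forall>i<p. \<forall>j<p. i \<noteq> j \<longrightarrow> \<pi> ! i \<inter> \<pi> ! j = {})
     \<and> (\<Union>i<p. \<pi> ! i) = {..<n}"

definition shapes :: "nat \<Rightarrow> nat \<Rightarrow> nat list set" where
  "shapes p n = {l. length l = p \<and> sum_list l = n}"

definition shape :: "nat set list \<Rightarrow> nat list" where
  "shape \<pi> = map card \<pi>"

definition partition_matrix :: "nat \<Rightarrow> matrix \<Rightarrow> nat set list \<Rightarrow> matrix" where
  "partition_matrix k A \<pi> = (\<lambda>i j. if i < k \<and> j < length \<pi> then \<Sum>l\<in>\<pi> ! j. A i l else 0)"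

definition shaped_partition_polytope ::
    "nat \<Rightarrow> nat \<Rightarrow> nat \<Rightarrow> matrix \<Rightarrow> nat list set \<Rightarrow> matrix set" where
  "shaped_partition_polytope p k n A \<Lambda> =
     convex hull {partition_matrix k A \<pi> | \<pi>. is_partition p n \<pi> \<and> shape \<pi> \<in> \<Lambda>}"

definition vertices :: "matrix set \<Rightarrow> matrix set" where
  "vertices P = {V. V extreme_point_of P}"

definition problem_instance :: "nat \<Rightarrow> nat \<Rightarrow> nat \<Rightarrow> matrix \<Rightarrow> nat list set \<Rightarrow> bool" where
  "problem_instance p k n A \<Lambda> \<longleftrightarrow>
     0 < p \<and> 0 < k \<and> 0 < n \<and> A \<in> matrices k n \<and> \<Lambda> \<subseteq> shapes p n \<and> \<Lambda> \<noteq> {}"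


section \<open>Oracle algorithms in the real arithmetic model\<close>

text \<open>An algorithm is a program for a random access machine over the reals with scalar registers
  and arrays, both numbered by naturals. The only data are real numbers, so counters and array
  indices are reals too and arithmetic on them is counted like all other arithmetic. Program
  constants are integers.\<close>

datatype arith = Plus | Minus | Times | Divide

datatype test = Less nat nat | LessEq nat nat | Equal nat nat

datatype program =
    Skip
  | Const nat int               \<comment> \<open>\<open>Const x c\<close>: \<open>x := c\<close>\<close>
  | Copy nat nat                \<comment> \<open>\<open>Copy x y\<close>: \<open>x := y\<close>\<close>
  | Arith arith nat nat nat     \<comment> \<open>\<open>Arith f x y z\<close>: \<open>x := y f z\<close>\<close>
  | Load nat nat nat            \<comment> \<open>\<open>Load x a y\<close>: \<open>x := a[y]\<close>\<close>
  | Store nat nat nat           \<comment> \<open>\<open>Store a y z\<close>: \<open>a[y] := z\<close>\<close>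
  | Query nat nat nat           \<comment> \<open>\<open>Query x a y\<close>: \<open>x :=\<close> oracle answer on \<open>(a[0], \<dots>, a[y - 1])\<close>\<close>
  | Output nat                  \<comment> \<open>append the content of a register to the output\<close>
  | Seq program program
  | If test program program
  | While test program

type_synonym state = "(nat \<Rightarrow> real) \<times> (nat \<Rightarrow> nat \<Rightarrow> real)"

text \<open>\<open>None\<close> marks words on which the oracle may not be queried.\<close>

type_synonym oracle_fun = "nat list \<Rightarrow> bool option"

text \<open>Execution records, step by step, what is done and which number is written.\<close>

datatype event = Calculated real | Compared | Queried real | Moved real | Printed real

fun arith_val :: "arith \<Rightarrow> real \<Rightarrow> real \<Rightarrow> real" where
  "arith_val Plus u v = u + v"
| "arith_val Minus u v = u - v"
| "arith_val Times u v = u * v"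
| "arith_val Divide u v = u / v"

fun holds :: "test \<Rightarrow> (nat \<Rightarrow> real) \<Rightarrow> bool" where
  "holds (Less x y) R \<longleftrightarrow> R x < R y"
| "holds (LessEq x y) R \<longleftrightarrow> R x \<le> R y"
| "holds (Equal x y) R \<longleftrightarrow> R x = R y"

text \<open>\<open>exec orc c s t s'\<close>: started in \<open>s\<close>, the program \<open>c\<close> terminates in \<open>s'\<close> with trace \<open>t\<close>. There is
  no such run if the program divides by zero, uses an index that is not a natural number, or asks
  an illegal query.\<close>

inductive exec :: "oracle_fun \<Rightarrow> program \<Rightarrow> state \<Rightarrow> event list \<Rightarrow> state \<Rightarrow> bool" for orc where
  Skip: "exec orc Skip s [] s"
| Const: "exec orc (Const x c) (R, M) [Moved (of_int c)] (R(x := of_int c), M)"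
| Copy: "exec orc (Copy x y) (R, M) [Moved (R y)] (R(x := R y), M)"
| Arith: "\<lbrakk>f = Divide \<longrightarrow> R z \<noteq> 0; v = arith_val f (R y) (R z)\<rbrakk>
    \<Longrightarrow> exec orc (Arith f x y z) (R, M) [Calculated v] (R(x := v), M)"
| Load: "R y = real i
    \<Longrightarrow> exec orc (Load x a y) (R, M) [Moved (M a i)] (R(x := M a i), M)"
| Store: "R y = real i
    \<Longrightarrow> exec orc (Store a y z) (R, M) [Moved (R z)] (R, M(a := (M a)(i := R z)))"
| Query: "\<lbrakk>R y = real m; map (M a) [0..<m] = map real l; orc l = Some b\<rbrakk>
    \<Longrightarrow> exec orc (Query x a y) (R, M) [Queried (of_bool b)] (R(x := of_bool b), M)"
| Output: "exec orc (Output x) (R, M) [Printed (R x)] (R, M)"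
| Seq: "\<lbrakk>exec orc c\<^sub>1 s t\<^sub>1 s'; exec orc c\<^sub>2 s' t\<^sub>2 s''\<rbrakk>
    \<Longrightarrow> exec orc (Seq c\<^sub>1 c\<^sub>2) s (t\<^sub>1 @ t\<^sub>2) s''"
| IfTrue: "\<lbrakk>holds b (fst s); exec orc c\<^sub>1 s t s'\<rbrakk>
    \<Longrightarrow> exec orc (If b c\<^sub>1 c\<^sub>2) s (Compared # t) s'"
| IfFalse: "\<lbrakk>\<not> holds b (fst s); exec orc c\<^sub>2 s t s'\<rbrakk>
    \<Longrightarrow> exec orc (If b c\<^sub>1 c\<^sub>2) s (Compared # t) s'"
| WhileFalse: "\<not> holds b (fst s) \<Longrightarrow> exec orc (While b c) s [Compared] s"
| WhileTrue: "\<lbrakk>holds b (fst s); exec orc c s t\<^sub>1 s'; exec orc (While b c) s' t\<^sub>2 s''\<rbrakk>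
    \<Longrightarrow> exec orc (While b c) s (Compared # t\<^sub>1 @ t\<^sub>2) s''"

inductive_cases exec_cases:
  "exec orc Skip s t s'" "exec orc (Const x c) s t s'" "exec orc (Copy x y) s t s'"
  "exec orc (Arith f x y z) s t s'" "exec orc (Load x a y) s t s'" "exec orc (Store a y z) s t s'"
  "exec orc (Query x a y) s t s'" "exec orc (Output x) s t s'" "exec orc (Seq c d) s t s'"
  "exec orc (If b c d) s t s'"
inductive_cases exec_While: "exec orc (While b c) s t s'"

theorem exec_deterministic:
  "exec orc c s t s' \<Longrightarrow> exec orc c s u s'' \<Longrightarrow> u = t \<and> s'' = s'"
proof (induction arbitrary: u s'' rule: exec.induct)
  case (Query R y m M a l b x)
  from Query.prems obtain m' l' b' where q: "R y = real m'" "map (M a) [0..<m'] = map real l'"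
      "orc l' = Some b'" "u = [Queried (of_bool b')]" "s'' = (R(x := of_bool b'), M)"
    by (auto elim: exec_cases)
  then have "map real l' = map real l" using Query.hyps by simp
  then have "l' = l" by (metis inj_map_eq_map inj_of_nat)
  then show ?case using q Query.hyps by simp
next
  case (Seq c1 s t1 s' c2 t2 s'')
  from Seq.prems show ?case
    by (rule exec_cases(9)) (use Seq.IH in blast)
next
  case (IfTrue b s c1 t s' c2)
  from IfTrue.prems show ?case
    by (rule exec_cases(10)) (use IfTrue.IH IfTrue.hyps in blast)+
next
  case (IfFalse b s c2 t s' c1)
  from IfFalse.prems show ?case
    by (rule exec_cases(10)) (use IfFalse.IH IfFalse.hyps in blast)+
next
  case (WhileFalse b s c)
  from WhileFalse.prems show ?case
    by (rule exec_While) (use WhileFalse.hyps in blast)+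
next
  case (WhileTrue b s c t1 s' t2 s'')
  from WhileTrue.prems show ?case
    by (rule exec_While) (use WhileTrue.IH WhileTrue.hyps in blast)+
qed (auto elim: exec_cases(1-8))

text \<open>The counted steps are arithmetic operations, comparisons and queries. As every loop iteration
  performs a comparison, the remaining instructions (data movement and output) exceed this count at
  most by a factor and a summand depending on the program only.\<close>

definition operations :: "event list \<Rightarrow> nat" where
  "operations t =
     length (filter (\<lambda>e. case e of Moved _ \<Rightarrow> False | Printed _ \<Rightarrow> False | _ \<Rightarrow> True) t)"

definition printed :: "event list \<Rightarrow> real list" where
  "printed t = concat (map (\<lambda>e. case e of Printed v \<Rightarrow> [v] | _ \<Rightarrow> []) t)"

fun numbers_of :: "event \<Rightarrow> real set" where
  "numbers_of (Calculated v) = {v}"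
| "numbers_of Compared = {}"
| "numbers_of (Queried v) = {v}"
| "numbers_of (Moved v) = {v}"
| "numbers_of (Printed v) = {v}"

definition numbers :: "event list \<Rightarrow> real set" where
  "numbers t = (\<Union>e\<in>set t. numbers_of e)"


section \<open>Algorithms for shaped partition problems\<close>

definition shape_oracle :: "nat \<Rightarrow> nat \<Rightarrow> nat list set \<Rightarrow> oracle_fun" where
  "shape_oracle p n \<Lambda> = (\<lambda>l. if l \<in> shapes p n then Some (l \<in> \<Lambda>) else None)"

text \<open>Registers 0, 1, 2 hold \<open>p\<close>, \<open>k\<close>, \<open>n\<close>, array 0 holds \<open>A\<close> row by row; all else is \<open>0\<close>.\<close>

definition input_state :: "nat \<Rightarrow> nat \<Rightarrow> nat \<Rightarrow> matrix \<Rightarrow> state" where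
  "input_state p k n A =
     ((\<lambda>x. 0)(0 := real p, 1 := real k, 2 := real n),
      (\<lambda>a i. 0)(0 := (\<lambda>m. if m < k * n then A (m div n) (m mod n) else 0)))"

definition run ::
    "program \<Rightarrow> nat \<Rightarrow> nat \<Rightarrow> nat \<Rightarrow> matrix \<Rightarrow> nat list set \<Rightarrow> event list \<Rightarrow> bool" where
  "run prog p k n A \<Lambda> t \<longleftrightarrow>
     (\<exists>s. exec (shape_oracle p n \<Lambda>) prog (input_state p k n A) t s)"

text \<open>The output is an enumeration of \<open>S\<close> without repetitions, each matrix written row by row.\<close>

definition enumerates :: "nat \<Rightarrow> nat \<Rightarrow> real list \<Rightarrow> matrix set \<Rightarrow> bool" where
  "enumerates k p out S \<longleftrightarrow>
     (\<exists>Vs. distinct Vs \<and> set Vs = S \<and> out = concat (map (entries k p) Vs))"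

text \<open>The size of a fraction \<open>a / b\<close> in lowest terms is \<open>1\<close> (for the sign) plus the lengths of the
  binary expansions of \<open>\<bar>a\<bar>\<close> and \<open>b\<close>. It is meaningful for rational arguments only.\<close>

definition bit_size :: "real \<Rightarrow> nat" where
  "bit_size x = (case quotient_of (THE r. x = of_rat r) of
     (a, b) \<Rightarrow> 1 + nat (bitlen \<bar>a\<bar>) + nat (bitlen b))"

definition input_size :: "nat \<Rightarrow> nat \<Rightarrow> nat \<Rightarrow> matrix \<Rightarrow> nat" where
  "input_size p k n A = bit_size (real p) + bit_size (real k) + bit_size (real n)
     + (\<Sum>i<k. \<Sum>j<n. bit_size (A i j))"

definition strongly_polynomial_time :: "program \<Rightarrow> nat \<Rightarrow> nat \<Rightarrow> bool" where
  "strongly_polynomial_time prog p k \<longleftrightarrow>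
     (\<exists>f g :: nat poly. \<forall>n A \<Lambda>. problem_instance p k n A \<Lambda> \<longrightarrow>
       (\<exists>t. run prog p k n A \<Lambda> t
          \<and> operations t \<le> poly f n
          \<and> ((\<forall>i<k. \<forall>j<n. A i j \<in> \<rat>) \<longrightarrow>
               (\<forall>x\<in>numbers t. x \<in> \<rat> \<and> bit_size x \<le> poly g (input_size p k n A)))))"

end

theory Submission
  imports Defs
begin

text \<open>
  A partition of the first \<open>m\<close> columns is represented by its record, the vector of its shape and of the
  entries of its matrix. The algorithm adds the columns one at a time and keeps, for every shape, an
  irredundant set of records whose convex hull contains all records of this shape. If the kept
  records generate those of \<open>m\<close> columns in this sense, then their extensions by all \<open>p\<close> placements of
  the next column generate those of \<open>m + 1\<close> columns, because a placement translates the hull of a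
  shape (\<open>generates_extend\<close>). Redundant extensions are discarded at once. After the last column the
  oracle selects the shapes in \<open>\<Lambda>\<close>, the shapes are erased from the records, and discarding redundant
  records once more leaves the vertices of the polytope (\<open>vertices_of_polytope\<close>).

  Only few records are kept (\<open>card_irredundant\<close>). A kept record is the unique minimum of a linear
  functional among the records of its shape. Since an exchange of two columns between classes \<open>i\<close> and
  \<open>j\<close> preserves the shape, the two classes are separated by a threshold of a linear functional on the
  columns, with ties broken by the column index. There are at most \<open>(m + 1) ^ (k + 1)\<close> sets of this
  kind (\<open>card_threshold_sets\<close>), and the sets for the \<open>p * (p - 1) div 2\<close> pairs of classes determine the
  partition.

  A record \<open>x\<close> is redundant just if no linear functional is positive on all differences \<open>t - x\<close> with
  other records \<open>t\<close> of the same shape (\<open>Gordan\<close>). By Helly's theorem (\<open>small_inseparable_subset\<close>) it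
  suffices to examine tuples of \<open>k * (p - 1) + 1\<close> differences, where \<open>k * (p - 1)\<close> is the dimension
  because the row sums of the matrices are constant. For a tuple the question is decided by
  Fourier--Motzkin elimination (\<open>elimination_empty_iff\<close>) in a number of steps that depends on \<open>k\<close> and
  \<open>p\<close> only. With \<open>N\<close> candidates a round consists of about \<open>N ^ (k * (p - 1) + 2)\<close> tests, and the
  exponents add up to at most \<open>k\<^sup>2 * p ^ 3\<close> (\<open>exponent_bound\<close>).

  The program does not divide. Besides counters and indices it only computes subset sums of the
  entries of a row of \<open>A\<close>, their differences, and from these a nest of operations \<open>a * b - c * d\<close> whose
  depth is bounded in terms of \<open>k\<close> and \<open>p\<close>. Therefore the bit sizes grow by a constant factor
  (\<open>rational_run\<close>).\<close>

section \<open>Strict separation and Fourier--Motzkin elimination\<close>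

text \<open>A linear functional is represented by its coefficients on the coordinates below \<open>w\<close>; the
  dimension varies with the input, so it is an argument of \<open>dot\<close> and not a type.\<close>

definition dot :: "nat \<Rightarrow> (nat \<Rightarrow> real) \<Rightarrow> (nat \<Rightarrow> real) \<Rightarrow> real" where
  "dot w y u = (\<Sum>c<w. y c * u c)"

definition separable :: "nat \<Rightarrow> (nat \<Rightarrow> real) set \<Rightarrow> bool" where
  "separable w U \<longleftrightarrow> (\<exists>y. \<forall>u\<in>U. 0 < dot w y u)"

text \<open>Eliminating the coordinate \<open>c\<close> from the inequalities \<open>0 < dot w y u\<close>, \<open>u \<in> U\<close>, in the unknown
  \<open>y\<close>: an inequality that bounds \<open>y c\<close> from below and one that bounds it from above are combined with
  the positive factors that cancel \<open>y c\<close>. Dually, \<open>eliminate c U\<close> collects positive combinations of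
  elements of \<open>U\<close> that lie on the hyperplane where the coordinate \<open>c\<close> is zero.\<close>

definition eliminate :: "nat \<Rightarrow> (nat \<Rightarrow> real) set \<Rightarrow> (nat \<Rightarrow> real) set" where
  "eliminate c U = {u \<in> U. u c = 0}
     \<union> {u c *\<^sub>R v - v c *\<^sub>R u |u v. u \<in> U \<and> v \<in> U \<and> 0 < u c \<and> v c < 0}"

lemma dot_simps:
  "dot w y (u + v) = dot w y u + dot w y v"
  "dot w y (u - v) = dot w y u - dot w y v"
  "dot w y (a *\<^sub>R u) = a * dot w y u"
  "dot w y 0 = 0"
  "dot w (a *\<^sub>R y) u = a * dot w y u"
  "dot w (y + y') u = dot w y u + dot w y' u"
  "dot w (- y) u = - dot w y u"
  by (simp_all add: dot_def algebra_simps sum.distrib sum_subtractf sum_distrib_left sum_negf)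

lemma sum_fun_apply: "(\<Sum>i\<in>I. f i) x = (\<Sum>i\<in>I. f i x)"
  by (induction I rule: infinite_finite_induct) simp_all

lemma dot_sum_left: "dot w (\<Sum>i\<in>I. f i) u = (\<Sum>i\<in>I. dot w (f i) u)"
  by (simp add: dot_def sum_fun_apply sum_distrib_right sum.swap[of _ I])

lemma dot_upd: "c < w \<Longrightarrow> dot w (y(c := y c + s)) u = dot w y u + s * u c"
proof -
  assume "c < w"
  have "dot w (y(c := y c + s)) u = (\<Sum>i<w. y i * u i + (if i = c then s * u c else 0))"
    unfolding dot_def by (intro sum.cong) (auto simp: algebra_simps)
  also have "\<dots> = dot w y u + s * u c" using \<open>c < w\<close> by (simp add: sum.distrib dot_def)
  finally show ?thesis .
qed

lemma between_finite_sets: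
  fixes A B :: "real set"
  assumes "finite A" "finite B" "\<And>a b. a \<in> A \<Longrightarrow> b \<in> B \<Longrightarrow> a < b"
  obtains t where "\<And>a. a \<in> A \<Longrightarrow> a < t" "\<And>b. b \<in> B \<Longrightarrow> t < b"
proof -
  consider "A = {}" "B = {}" | "A = {}" "B \<noteq> {}" | "A \<noteq> {}" "B = {}" | "A \<noteq> {}" "B \<noteq> {}" by blast
  then show ?thesis
  proof cases
    case 1
    then show ?thesis by (intro that[of 0]) auto
  next
    case 2
    then have "Min B - 1 < b" if "b \<in> B" for b using Min_le[OF assms(2) that] by simp
    then show ?thesis using 2 by (intro that[of "Min B - 1"]) auto
  next
    case 3
    then have "a < Max A + 1" if "a \<in> A" for a using Max_ge[OF assms(1) that] by simp
    then show ?thesis using 3 by (intro that[of "Max A + 1"]) auto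
  next
    case 4
    then have "Max A < Min B" using assms by simp
    then obtain t where "Max A < t" "t < Min B" using dense by blast
    then show ?thesis using assms 4 by (intro that[of t]) auto
  qed
qed

text \<open>The functional found after the elimination extends to one before it: it leaves an open interval of
  admissible values for the coefficient of the coordinate \<open>c\<close>, which is nonempty by the combined
  inequalities.\<close>

lemma separable_eliminate:
  assumes "finite U" "c < w"
  shows "separable w (eliminate c U) \<longleftrightarrow> separable w U"
proof
  assume "separable w U"
  then obtain y where y: "\<And>u. u \<in> U \<Longrightarrow> 0 < dot w y u" unfolding separable_def by auto
  have "0 < dot w y e" if "e \<in> eliminate c U" for e
  proof -
    have "0 < u c * dot w y v - v c * dot w y u" if "u \<in> U" "v \<in> U" "0 < u c" "v c < 0" for u v
      using that y[of u] y[of v] by (smt (verit) mult_pos_pos mult_neg_pos)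
    then show ?thesis using that y by (auto simp: eliminate_def dot_simps)
  qed
  then show "separable w (eliminate c U)" unfolding separable_def by auto
next
  assume "separable w (eliminate c U)"
  then obtain y where y: "\<And>u. u \<in> eliminate c U \<Longrightarrow> 0 < dot w y u" unfolding separable_def by auto
  let ?A = "(\<lambda>u. - dot w y u / u c) ` {u \<in> U. 0 < u c}"
  let ?B = "(\<lambda>v. - dot w y v / v c) ` {v \<in> U. v c < 0}"
  have "a < b" if ab: "a \<in> ?A" "b \<in> ?B" for a b
  proof -
    obtain u v where uv: "u \<in> U" "0 < u c" "a = - dot w y u / u c"
      "v \<in> U" "v c < 0" "b = - dot w y v / v c" using ab by auto
    have "u c *\<^sub>R v - v c *\<^sub>R u \<in> eliminate c U" using uv by (auto simp: eliminate_def)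
    from y[OF this] have "0 < u c * dot w y v - v c * dot w y u" by (simp add: dot_simps)
    moreover have "- dot w y u / u c * (u c * - v c) = dot w y u * v c" using uv(2) by simp
    moreover have "- dot w y v / v c * (u c * - v c) = dot w y v * u c" using uv(5) by simp
    ultimately have "- dot w y u / u c * (u c * - v c) < - dot w y v / v c * (u c * - v c)"
      by (simp only:) (simp add: mult.commute)
    moreover have "0 \<le> u c * - v c" using uv(2,5) by (simp add: mult_nonneg_nonpos)
    ultimately show ?thesis unfolding uv(3) uv(6) by (rule mult_right_less_imp_less)
  qed
  then obtain s where s: "\<And>a. a \<in> ?A \<Longrightarrow> a < s" "\<And>b. b \<in> ?B \<Longrightarrow> s < b"
    by (rule between_finite_sets[of ?A ?B, rotated 2]) (use assms in auto)
  have "0 < dot w (y(c := y c + s)) u" if "u \<in> U" for u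
  proof -
    consider "u c = 0" | "0 < u c" | "u c < 0" by linarith
    then show ?thesis
    proof cases
      case 1
      then have "u \<in> eliminate c U" using that by (simp add: eliminate_def)
      then show ?thesis using y 1 assms by (simp add: dot_upd)
    next
      case 2
      then have "- dot w y u / u c < s" using s(1) that by auto
      then show ?thesis unfolding dot_upd[OF assms(2)] using 2 by (simp add: field_simps)
    next
      case 3
      then have "s < - dot w y u / u c" using s(2) that by auto
      then show ?thesis unfolding dot_upd[OF assms(2)] using 3 by (simp add: field_simps)
    qed
  qed
  then show "separable w U" unfolding separable_def by blast
qed

lemma finite_eliminate: "finite U \<Longrightarrow> finite (eliminate c U)"
proof -
  assume "finite U"
  have "{u c *\<^sub>R v - v c *\<^sub>R u |u v. u \<in> U \<and> v \<in> U \<and> 0 < u c \<and> v c < 0}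
      \<subseteq> (\<lambda>(u, v). u c *\<^sub>R v - v c *\<^sub>R u) ` (U \<times> U)" by auto
  then have "finite {u c *\<^sub>R v - v c *\<^sub>R u |u v. u \<in> U \<and> v \<in> U \<and> 0 < u c \<and> v c < 0}"
    using \<open>finite U\<close> by (meson finite_SigmaI finite_imageI finite_subset)
  then show ?thesis using \<open>finite U\<close> unfolding eliminate_def by simp
qed

lemma eliminate_coord: "e \<in> eliminate c U \<Longrightarrow> e c = 0"
  by (auto simp: eliminate_def)

lemma eliminate_keeps_zero:
  assumes "e \<in> eliminate c U" "\<And>u. u \<in> U \<Longrightarrow> u i = 0"
  shows "e i = 0"
  using assms(1) unfolding eliminate_def by (auto simp: assms(2))

text \<open>The first \<open>p\<close> coordinates of a difference of two records compare their shapes. Only differences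
  of records of equal shape matter, so on these coordinates nonzero entries are dropped, not
  combined.\<close>

primrec elimination :: "nat \<Rightarrow> nat \<Rightarrow> (nat \<Rightarrow> real) set \<Rightarrow> (nat \<Rightarrow> real) set" where
  "elimination p 0 U = U"
| "elimination p (Suc c) U =
     (if c < p then {u \<in> elimination p c U. u c = 0} else eliminate c (elimination p c U))"

lemma finite_elimination: "finite U \<Longrightarrow> finite (elimination p c U)"
  by (induction c) (auto simp: finite_eliminate)

lemma elimination_low: "c \<le> p \<Longrightarrow> elimination p c U = {u \<in> U. \<forall>i<c. u i = 0}"
  by (induction c) (auto simp: less_Suc_eq)

lemma elimination_zero: "u \<in> elimination p c U \<Longrightarrow> i < c \<Longrightarrow> u i = 0"
proof (induction c arbitrary: u)
  case (Suc c)
  then show ?case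
    using eliminate_coord[of u c] eliminate_keeps_zero[of u c "elimination p c U" i]
    by (cases "i = c") (auto split: if_splits)
qed simp

lemma elimination_support:
  "(\<And>u. u \<in> U \<Longrightarrow> u i = 0) \<Longrightarrow> u \<in> elimination p c U \<Longrightarrow> u i = 0"
proof (induction c arbitrary: u)
  case (Suc c)
  then show ?case
    using eliminate_keeps_zero[of u c "elimination p c U" i] by (auto split: if_splits)
qed simp

text \<open>After all coordinates are eliminated only zero vectors can be left, and a set of zero vectors is
  separable just if it is empty.\<close>

lemma elimination_empty_iff:
  assumes "finite U" "p \<le> w"
  shows "elimination p w U = {} \<longleftrightarrow> separable w {u \<in> U. \<forall>c<p. u c = 0}"
proof -
  have "separable w (elimination p c U) \<longleftrightarrow> separable w {u \<in> U. \<forall>i<p. u i = 0}"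
    if "p \<le> c" "c \<le> w" for c
    using that
  proof (induction c rule: dec_induct)
    case base
    then show ?case by (simp add: elimination_low)
  next
    case (step c)
    then show ?case using assms by (simp add: separable_eliminate finite_elimination)
  qed
  then have "separable w (elimination p w U) \<longleftrightarrow> separable w {u \<in> U. \<forall>c<p. u c = 0}"
    using assms by blast
  moreover have "separable w (elimination p w U) \<longleftrightarrow> elimination p w U = {}"
    by (auto simp: separable_def dot_def elimination_zero)
  ultimately show ?thesis by blast
qed

lemma convex_multiples:
  assumes "convex S"
  shows "convex {a *\<^sub>R h |a h. 0 < (a::real) \<and> h \<in> S}" (is "convex ?K")
proof (rule convexI)
  fix x y and u v :: real
  assume xy: "x \<in> ?K" "y \<in> ?K" and uv: "0 \<le> u" "0 \<le> v" "u + v = 1"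
  obtain a g b h where ab: "x = a *\<^sub>R g" "0 < a" "g \<in> S" "y = b *\<^sub>R h" "0 < b" "h \<in> S"
    using xy by auto
  define s where "s = u * a + v * b"
  have "0 < s" using ab uv unfolding s_def
    by (smt (verit) mult_nonneg_nonneg mult_pos_pos)
  have "(u * a / s) *\<^sub>R g + (v * b / s) *\<^sub>R h \<in> S"
    using ab uv \<open>0 < s\<close> by (intro convexD[OF assms]) (auto simp: s_def add_divide_distrib[symmetric])
  moreover have "u *\<^sub>R x + v *\<^sub>R y = s *\<^sub>R ((u * a / s) *\<^sub>R g + (v * b / s) *\<^sub>R h)"
    using ab \<open>0 < s\<close> by (simp add: scaleR_add_right)
  ultimately show "u *\<^sub>R x + v *\<^sub>R y \<in> ?K" using \<open>0 < s\<close> by blast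
qed

text \<open>Every eliminated vector is a positive multiple of a point of the hull of \<open>U\<close>, and the positive
  multiples of the points of a convex set form a convex set.\<close>

lemma zero_in_hull_eliminate:
  assumes "0 \<in> convex hull (eliminate c U)"
  shows "0 \<in> convex hull U"
proof -
  let ?K = "{a *\<^sub>R h |a h. 0 < (a::real) \<and> h \<in> convex hull U}"
  have "e \<in> ?K" if "e \<in> eliminate c U" for e
    using that unfolding eliminate_def
  proof
    assume "e \<in> {u \<in> U. u c = 0}"
    then have "e = 1 *\<^sub>R e \<and> (0::real) < 1 \<and> e \<in> convex hull U" by (simp add: hull_inc)
    then show ?thesis by blast
  next
    assume "e \<in> {u c *\<^sub>R v - v c *\<^sub>R u |u v. u \<in> U \<and> v \<in> U \<and> 0 < u c \<and> v c < 0}"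
    then obtain u v where uv: "e = u c *\<^sub>R v - v c *\<^sub>R u" "u \<in> U" "v \<in> U" "0 < u c" "v c < 0" by auto
    let ?s = "u c - v c"
    have "0 < ?s" using uv by simp
    have "(u c / ?s) *\<^sub>R v + (- v c / ?s) *\<^sub>R u \<in> convex hull U"
      using uv by (intro convexD[OF convex_convex_hull])
        (auto simp: hull_inc divide_simps)
    moreover have "e = ?s *\<^sub>R ((u c / ?s) *\<^sub>R v + (- v c / ?s) *\<^sub>R u)"
    proof -
      have "s * (t / s) = t" if "0 < s" for s t :: real using that by simp
      from this[OF \<open>0 < ?s\<close>] have "?s * (u c / ?s) = u c" "?s * (- v c / ?s) = - v c" by blast+
      then show ?thesis unfolding uv(1) scaleR_add_right scaleR_scaleR by simp
    qed
    ultimately show ?thesis using \<open>0 < ?s\<close> by blast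
  qed
  then have "convex hull (eliminate c U) \<subseteq> ?K"
    by (intro hull_minimal convex_multiples) auto
  then show ?thesis using assms by auto
qed

text \<open>The theorem of the alternative. If no functional is positive on \<open>U\<close>, then complete elimination
  leaves the vector \<open>0\<close>, and this traces back to a convex representation of \<open>0\<close> by \<open>U\<close>.\<close>

theorem Gordan:
  assumes "finite U" and supp: "\<And>u c. u \<in> U \<Longrightarrow> w \<le> c \<Longrightarrow> u c = 0"
    and "\<not> separable w U"
  shows "0 \<in> convex hull U"
proof -
  obtain u where u: "u \<in> elimination 0 w U"
    using elimination_empty_iff[of U 0 w] assms by auto
  have "u = 0"
  proof
    fix c show "u c = 0 c"
      by (cases "c < w") (use elimination_zero[OF u] elimination_support[OF _ u] supp in auto)
  qed
  have "0 \<in> convex hull (elimination 0 c U) \<Longrightarrow> 0 \<in> convex hull U" for c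
    by (induction c) (auto dest: zero_in_hull_eliminate)
  then show ?thesis using u \<open>u = 0\<close> by (auto intro: hull_inc)
qed

section \<open>Small inseparable subsets\<close>

text \<open>More than \<open>card J + 1\<close> points in a space of dimension \<open>card J\<close> are affinely dependent. The points
  form a family, so that a repeated point counts as a dependency.\<close>

lemma affine_relation:
  fixes y :: "'a \<Rightarrow> nat \<Rightarrow> real"
  assumes "finite J" "finite T" "card J + 2 \<le> card T"
    and supp: "\<And>u c. u \<in> T \<Longrightarrow> c \<notin> J \<Longrightarrow> y u c = 0"
  obtains \<mu> where "(\<Sum>u\<in>T. \<mu> u) = 0" "(\<Sum>u\<in>T. \<mu> u *\<^sub>R y u) = 0" "\<exists>u\<in>T. \<mu> u \<noteq> (0::real)"
proof -
  obtain u0 where u0: "u0 \<in> T" using assms by fastforce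
  let ?T = "T - {u0}" and ?f = "\<lambda>u. y u - y u0"
  have cT: "card J < card ?T" using assms u0 by simp
  show ?thesis
  proof (cases "inj_on ?f ?T")
    case False
    then obtain a b where ab: "a \<in> ?T" "b \<in> ?T" "a \<noteq> b" "?f a = ?f b" by (auto simp: inj_on_def)
    let ?\<mu> = "\<lambda>u. (if u = a then 1 else 0) - (if u = b then 1 else (0::real))"
    have "(\<Sum>u\<in>T. ?\<mu> u) = 0" using ab assms(2) by (simp add: sum_subtractf)
    moreover have "(\<Sum>u\<in>T. ?\<mu> u *\<^sub>R y u) = y a - y b"
    proof -
      have "(\<Sum>u\<in>T. ?\<mu> u *\<^sub>R y u) = (\<Sum>u\<in>T. (if u = a then y u else 0) - (if u = b then y u else 0))"
        by (intro sum.cong) auto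
      then show ?thesis using ab assms(2) by (simp add: sum_subtractf)
    qed
    moreover have "y a - y b = 0" using ab(4) by simp
    moreover have "\<exists>u\<in>T. ?\<mu> u \<noteq> 0" using ab by auto
    ultimately show ?thesis by (intro that[of ?\<mu>]) simp_all
  next
    case True
    let ?e = "\<lambda>c. (\<lambda>i. if i = c then 1 else (0::real))"
    have "?f ` ?T \<subseteq> span (?e ` J)"
    proof
      fix v assume "v \<in> ?f ` ?T"
      then have v0: "v c = 0" if "c \<notin> J" for c using supp that u0 by auto
      have "v = (\<Sum>c\<in>J. v c *\<^sub>R ?e c)"
      proof
        fix i
        have "(\<Sum>c\<in>J. v c *\<^sub>R ?e c) i = (\<Sum>c\<in>J. if i = c then v c else 0)"
          unfolding sum_fun_apply by (intro sum.cong) auto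
        also have "\<dots> = v i" using v0 assms(1) by simp
        finally show "v i = (\<Sum>c\<in>J. v c *\<^sub>R ?e c) i" by simp
      qed
      moreover have "(\<Sum>c\<in>J. v c *\<^sub>R ?e c) \<in> span (?e ` J)"
        by (intro span_sum span_scale span_base imageI)
      ultimately show "v \<in> span (?e ` J)" by (rule ssubst[where P = "\<lambda>x. x \<in> span (?e ` J)"])
    qed
    moreover have "card (?e ` J) < card (?f ` ?T)"
      using cT card_image[OF True] card_image_le[OF assms(1), of ?e] by simp
    ultimately have "dependent (?f ` ?T)"
      using independent_span_bound[of "?e ` J" "?f ` ?T"] assms(1) by auto
    then obtain g where g: "(\<Sum>v\<in>?f ` ?T. g v *\<^sub>R v) = 0" "\<exists>v\<in>?f ` ?T. g v \<noteq> 0"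
      using dependent_finite[of "?f ` ?T"] assms(2) by auto
    define s where "s = (\<Sum>u\<in>?T. g (?f u))"
    \<comment> \<open>The relation between the differences from \<open>u0\<close> becomes affine by the choice of the coefficient of \<open>u0\<close>.\<close>
    let ?\<mu> = "\<lambda>u. if u = u0 then - s else g (?f u)"
    have "(\<Sum>u\<in>?T. g (?f u) *\<^sub>R ?f u) = 0" using g(1) True by (simp add: sum.reindex)
    then have "(\<Sum>u\<in>?T. g (?f u) *\<^sub>R y u) = s *\<^sub>R y u0"
      by (simp add: s_def scaleR_diff_right sum_subtractf scaleR_sum_left)
    moreover have "(\<Sum>u\<in>?T. ?\<mu> u *\<^sub>R y u) = (\<Sum>u\<in>?T. g (?f u) *\<^sub>R y u)" by (intro sum.cong) auto
    moreover have "(\<Sum>u\<in>?T. ?\<mu> u) = s" unfolding s_def by (intro sum.cong) auto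
    ultimately have "(\<Sum>u\<in>T. ?\<mu> u) = 0" "(\<Sum>u\<in>T. ?\<mu> u *\<^sub>R y u) = 0"
      by (simp_all add: sum.remove[OF assms(2) u0] del: sum.cong_simp)
    moreover have "\<exists>u\<in>T. ?\<mu> u \<noteq> 0"
    proof -
      obtain u where "u \<in> ?T" "g (?f u) \<noteq> 0" using g(2) by auto
      then show ?thesis by (intro bexI[of _ u]) auto
    qed
    ultimately show ?thesis by (rule that)
  qed
qed

text \<open>Helly's theorem for open half-spaces, by Radon's argument. A minimal inseparable set \<open>T\<close> provides
  for each \<open>u \<in> T\<close> a functional \<open>y u\<close> that is positive on all other elements. If \<open>T\<close> were larger than
  stated, the functionals \<open>y u\<close> would have an affine relation; the sum of its positive terms equals
  the negated sum of its negative terms. Each \<open>v \<in> T\<close> is missing on one of the two sides, so this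
  common value is positive on all of \<open>T\<close>. The set \<open>J\<close> contains the coordinates that suffice to
  represent all functionals on \<open>U\<close>.\<close>

theorem small_inseparable_subset:
  assumes "finite U" "finite J"
    and J: "\<And>y. \<exists>y'. (\<forall>c. c \<notin> J \<longrightarrow> y' c = 0) \<and> (\<forall>u\<in>U. dot w y' u = dot w y u)"
    and "\<not> separable w U"
  obtains T where "T \<subseteq> U" "card T \<le> card J + 1" "\<not> separable w T"
proof -
  obtain T where T: "T \<subseteq> U" "\<not> separable w T"
    and min: "\<And>T'. T' \<subseteq> U \<Longrightarrow> \<not> separable w T' \<Longrightarrow> card T \<le> card T'"
    using ex_has_least_nat[of "\<lambda>T. T \<subseteq> U \<and> \<not> separable w T" U card] assms(4) by auto
  have fT: "finite T" using T assms(1) finite_subset by blast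
  have "card T \<le> card J + 1"
  proof (rule ccontr)
    assume "\<not> card T \<le> card J + 1"
    have "\<exists>y. (\<forall>c. c \<notin> J \<longrightarrow> y c = 0) \<and> (\<forall>v\<in>T - {u}. 0 < dot w y v)" if "u \<in> T" for u
    proof -
      have "separable w (T - {u})"
        using min[of "T - {u}"] T that fT by (metis Diff_subset card_Diff1_less leD order.trans)
      then obtain y where "\<forall>v\<in>T - {u}. 0 < dot w y v" unfolding separable_def by auto
      moreover obtain y' where "\<forall>c. c \<notin> J \<longrightarrow> y' c = 0" "\<forall>u\<in>U. dot w y' u = dot w y u"
        using J by blast
      ultimately show ?thesis using T by (metis Diff_iff subsetD)
    qed
    then obtain y where y: "\<And>u c. u \<in> T \<Longrightarrow> c \<notin> J \<Longrightarrow> y u c = 0"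
      "\<And>u v. u \<in> T \<Longrightarrow> v \<in> T \<Longrightarrow> v \<noteq> u \<Longrightarrow> 0 < dot w (y u) v" by (metis DiffI singletonD)
    obtain \<mu> where \<mu>: "(\<Sum>u\<in>T. \<mu> u) = 0" "(\<Sum>u\<in>T. \<mu> u *\<^sub>R y u) = 0" "\<exists>u\<in>T. \<mu> u \<noteq> (0::real)"
      by (rule affine_relation[of J T y]) (use fT assms(2) y(1) \<open>\<not> card T \<le> card J + 1\<close> in auto)
    \<comment> \<open>Both parts are nonempty because the coefficients sum to zero and are not all zero.\<close>
    let ?P = "{u \<in> T. 0 < \<mu> u}" and ?N = "{u \<in> T. \<mu> u < 0}"
    define z where "z = (\<Sum>u\<in>?P. \<mu> u *\<^sub>R y u)"
    have split: "(\<Sum>u\<in>T. f u) = (\<Sum>u\<in>?P. f u) + (\<Sum>u\<in>?N. f u)" if "\<And>u. \<mu> u = 0 \<Longrightarrow> f u = 0"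
      for f :: "_ \<Rightarrow> 'b::real_vector"
    proof -
      have "(\<Sum>u\<in>T. f u) = (\<Sum>u\<in>?P \<union> ?N. f u)"
        using fT by (intro sum.mono_neutral_right) (auto intro!: that)
      also have "\<dots> = (\<Sum>u\<in>?P. f u) + (\<Sum>u\<in>?N. f u)"
        using fT by (intro sum.union_disjoint) auto
      finally show ?thesis .
    qed
    have z': "z = (\<Sum>u\<in>?N. (- \<mu> u) *\<^sub>R y u)"
      using \<mu>(2) split[of "\<lambda>u. \<mu> u *\<^sub>R y u"] by (simp add: z_def sum_negf eq_neg_iff_add_eq_0)
    have s0: "(\<Sum>u\<in>?P. \<mu> u) + (\<Sum>u\<in>?N. \<mu> u) = 0" using \<mu>(1) split[of \<mu>] by simp
    have ne: "?P \<noteq> {}" "?N \<noteq> {}"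
    proof -
      have "0 < (\<Sum>u\<in>?P. \<mu> u)" if "?P \<noteq> {}" using that fT by (intro sum_pos) auto
      moreover have "(\<Sum>u\<in>?N. \<mu> u) < 0" if "?N \<noteq> {}"
        using sum_pos[of ?N "\<lambda>u. - \<mu> u"] that fT by (simp add: sum_negf)
      moreover have "?P \<noteq> {} \<or> ?N \<noteq> {}" using \<mu>(3) by force
      ultimately show "?P \<noteq> {}" "?N \<noteq> {}" using s0 sum.empty[of \<mu>] by (smt (verit))+
    qed
    have "0 < dot w z v" if v: "v \<in> T" for v
    proof (cases "0 < \<mu> v")
      case True
      have "0 < - \<mu> u * dot w (y u) v" if "u \<in> ?N" for u
      proof -
        have "v \<noteq> u" using that True by auto
        then show ?thesis using that v y(2)[of u v] by (intro mult_pos_pos) auto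
      qed
      then have "0 < (\<Sum>u\<in>?N. - \<mu> u * dot w (y u) v)" using fT ne by (intro sum_pos) auto
      then show ?thesis unfolding z' by (simp add: dot_sum_left dot_simps)
    next
      case False
      have "0 < \<mu> u * dot w (y u) v" if "u \<in> ?P" for u
      proof -
        have "v \<noteq> u" using that False by auto
        then show ?thesis using that v y(2)[of u v] by (intro mult_pos_pos) auto
      qed
      then have "0 < (\<Sum>u\<in>?P. \<mu> u * dot w (y u) v)" using fT ne by (intro sum_pos) auto
      then show ?thesis unfolding z_def by (simp add: dot_sum_left dot_simps)
    qed
    then show False using T(2) unfolding separable_def by auto
  qed
  then show ?thesis using T that by blast
qed

section \<open>Counting threshold sets\<close>

definition threshold_sets :: "nat \<Rightarrow> nat set \<Rightarrow> (nat \<Rightarrow> nat \<Rightarrow> real) \<Rightarrow> (nat \<Rightarrow> real) \<Rightarrow> nat set set" where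
  "threshold_sets m I b s = range (\<lambda>\<theta>. {l. l < m \<and> s l < (\<Sum>i\<in>I. b l i * \<theta> i)})"

lemma finite_threshold_sets: "finite (threshold_sets m I b s)"
  by (rule finite_subset[of _ "Pow {..<m}"]) (auto simp: threshold_sets_def)

text \<open>Deletion and restriction for an arrangement of \<open>m\<close> hyperplanes in the space of the parameters
  \<open>\<theta>\<close>. Removing the last hyperplane merges two sets only if both its sides meet the corresponding
  cell. Then the hyperplane itself meets the cell, by convexity, so the number of merged pairs is at
  most the number of cells of the arrangement induced on the hyperplane, where one parameter can be
  eliminated.\<close>

theorem card_threshold_sets:
  "finite I \<Longrightarrow> card (threshold_sets m I b s) \<le> (m + 1) ^ card I"
proof (induction m arbitrary: I b s)
  case 0
  have "threshold_sets 0 I b s = {{}}" by (auto simp: threshold_sets_def)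
  then show ?case by simp
next
  case (Suc m)
  let ?S = "\<lambda>l \<theta>. \<Sum>i\<in>I. b l i * \<theta> i"
  let ?D = "\<lambda>\<theta>. {l. l < m \<and> s l < ?S l \<theta>}"
  let ?F = "threshold_sets (Suc m) I b s"
  define F0 where "F0 = ?D ` {\<theta>. ?S m \<theta> \<le> s m}"
  define F1 where "F1 = ?D ` {\<theta>. s m < ?S m \<theta>}"
  have sub: "F0 \<union> F1 \<subseteq> threshold_sets m I b s" by (auto simp: F0_def F1_def threshold_sets_def)
  then have fin: "finite F0" "finite F1" by (auto intro: finite_subset[OF _ finite_threshold_sets])
  have D: "{l. l < Suc m \<and> s l < ?S l \<theta>} = (if s m < ?S m \<theta> then insert m (?D \<theta>) else ?D \<theta>)" for \<theta>
    by (auto simp: less_Suc_eq)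
  have "?F \<subseteq> F0 \<union> insert m ` F1"
  proof
    fix X assume "X \<in> ?F"
    then obtain \<theta> where \<theta>: "X = {l. l < Suc m \<and> s l < ?S l \<theta>}" by (auto simp: threshold_sets_def)
    show "X \<in> F0 \<union> insert m ` F1" unfolding \<theta> D F0_def F1_def by auto
  qed
  then have "card ?F \<le> card (F0 \<union> insert m ` F1)" using fin by (intro card_mono) auto
  also have "\<dots> \<le> card F0 + card F1"
    using card_Un_le[of F0 "insert m ` F1"] card_image_le[OF fin(2), of "insert m"] by linarith
  also have "\<dots> = card (F0 \<union> F1) + card (F0 \<inter> F1)" using fin by (rule card_Un_Int)
  finally have c1: "card ?F \<le> card (F0 \<union> F1) + card (F0 \<inter> F1)" .
  have c2: "card (F0 \<union> F1) \<le> (m + 1) ^ card I"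
    using card_mono[OF finite_threshold_sets sub] Suc.IH[OF Suc.prems] by (meson order.trans)
  show ?case
  proof (cases "\<forall>i\<in>I. b m i = 0")
    case True
    then have "?S m \<theta> = 0" for \<theta> by (intro sum.neutral) auto
    then have "F0 = {} \<or> F1 = {}" unfolding F0_def F1_def by auto
    then have "card ?F \<le> (m + 1) ^ card I" using c1 c2 by auto
    also have "\<dots> \<le> (Suc m + 1) ^ card I" by (intro power_mono) auto
    finally show ?thesis .
  next
    case False
    then obtain i0 where i0: "i0 \<in> I" "b m i0 \<noteq> 0" by auto
    let ?I = "I - {i0}"
    define b' where "b' = (\<lambda>l i. b l i - b l i0 * b m i / b m i0)"
    define s' where "s' = (\<lambda>l. s l - b l i0 * s m / b m i0)"
    have "F0 \<inter> F1 \<subseteq> threshold_sets m ?I b' s'"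
    proof
      fix X assume "X \<in> F0 \<inter> F1"
      then obtain \<theta>0 \<theta>1 where \<theta>: "X = ?D \<theta>0" "?S m \<theta>0 \<le> s m" "X = ?D \<theta>1" "s m < ?S m \<theta>1"
        unfolding F0_def F1_def by auto
      \<comment> \<open>The point where the segment from \<open>\<theta>0\<close> to \<open>\<theta>1\<close> crosses the last hyperplane.\<close>
      define t where "t = (s m - ?S m \<theta>0) / (?S m \<theta>1 - ?S m \<theta>0)"
      have t: "0 \<le> t" "t \<le> 1" using \<theta> by (auto simp: t_def field_simps)
      define \<theta> where "\<theta> = (\<lambda>i. (1 - t) * \<theta>0 i + t * \<theta>1 i)"
      have S: "?S l \<theta> = (1 - t) * ?S l \<theta>0 + t * ?S l \<theta>1" for l
        by (simp add: \<theta>_def sum.distrib[symmetric] sum_distrib_left)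
          (intro sum.cong refl, simp add: algebra_simps)
      have "?S m \<theta> = ?S m \<theta>0 + t * (?S m \<theta>1 - ?S m \<theta>0)" unfolding S[of m] by (simp add: algebra_simps)
      also have "\<dots> = s m" using \<theta>(2,4) by (simp add: t_def)
      finally have Sm: "?S m \<theta> = s m" .
      have eq: "s l < ?S l \<theta> \<longleftrightarrow> s l < ?S l \<theta>0" if "l < m" for l
      proof -
        have iff: "s l < ?S l \<theta>0 \<longleftrightarrow> s l < ?S l \<theta>1" using \<theta>(1,3) that by auto
        show ?thesis
        proof (cases "s l < ?S l \<theta>0")
          case True
          then have "s l < (1 - t) * ?S l \<theta>0 + t * ?S l \<theta>1"
            using iff t convex_bound_lt[of "- ?S l \<theta>0" "- s l" "- ?S l \<theta>1" "1 - t" t] by simp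
          then show ?thesis using True S by simp
        next
          case f: False
          then have "(1 - t) * ?S l \<theta>0 + t * ?S l \<theta>1 \<le> s l"
            using iff t convex_bound_le[of "?S l \<theta>0" "s l" "?S l \<theta>1" "1 - t" t] by simp
          then show ?thesis using f S by simp
        qed
      qed
      \<comment> \<open>On the hyperplane the parameter \<open>\<theta> i0\<close> is a function of the others.\<close>
      have S0: "?S l \<theta> = b l i0 * \<theta> i0 + (\<Sum>i\<in>?I. b l i * \<theta> i)" for l
        using i0 Suc.prems by (simp add: sum.remove)
      have ti0: "\<theta> i0 = (s m - (\<Sum>i\<in>?I. b m i * \<theta> i)) / b m i0"
        using Sm S0[of m] i0 by (simp add: field_simps)
      have "(\<Sum>i\<in>?I. b' l i * \<theta> i)
          = (\<Sum>i\<in>?I. b l i * \<theta> i) - b l i0 / b m i0 * (\<Sum>i\<in>?I. b m i * \<theta> i)" for l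
        by (simp add: b'_def algebra_simps sum_subtractf sum_distrib_left)
      then have "s' l < (\<Sum>i\<in>?I. b' l i * \<theta> i) \<longleftrightarrow> s l < ?S l \<theta>" for l
        unfolding S0[of l] ti0 s'_def by (simp only:) (simp add: algebra_simps diff_divide_distrib)
      then have "X = {l. l < m \<and> s' l < (\<Sum>i\<in>?I. b' l i * \<theta> i)}" using eq \<theta>(1) by auto
      then show "X \<in> threshold_sets m ?I b' s'" unfolding threshold_sets_def by blast
    qed
    then have "card (F0 \<inter> F1) \<le> card (threshold_sets m ?I b' s')"
      by (intro card_mono finite_threshold_sets)
    also have "\<dots> \<le> (m + 1) ^ card ?I" using Suc by simp
    finally have c3: "card (F0 \<inter> F1) \<le> (m + 1) ^ card ?I" .
    have cI: "card I = Suc (card ?I)" using i0 Suc.prems by (metis card.remove)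
    have "card ?F \<le> (m + 1) ^ card I + (m + 1) ^ card ?I" using c1 c2 c3 by linarith
    also have "\<dots> = (m + 2) * (m + 1) ^ card ?I" unfolding cI by simp
    also have "\<dots> \<le> (m + 2) * (m + 2) ^ card ?I" by (intro mult_left_mono power_mono) auto
    also have "\<dots> = (Suc m + 1) ^ card I" unfolding cI by simp
    finally show ?thesis .
  qed
qed

section \<open>Records of partitions\<close>

definition ahat :: "matrix \<Rightarrow> nat \<Rightarrow> nat \<Rightarrow> real" where
  "ahat A r l = (if r = 0 then 1 else A (r - 1) l)"

text \<open>A record has the coordinates \<open>r * p + j\<close> for \<open>r \<le> k\<close> and \<open>j < p\<close>: the row \<open>r = 0\<close> is the shape of a
  partition, the other rows are its matrix. Prefixing the columns of \<open>A\<close> with a one makes the record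
  a sum with one summand, the increment below, for each column \<open>l\<close> and its class \<open>j\<close>.\<close>

definition inc :: "nat \<Rightarrow> nat \<Rightarrow> matrix \<Rightarrow> nat \<Rightarrow> nat \<Rightarrow> nat \<Rightarrow> real" where
  "inc p k A l j = (\<lambda>c. if c < (k + 1) * p \<and> c mod p = j then ahat A (c div p) l else 0)"

definition record_of :: "nat \<Rightarrow> nat \<Rightarrow> matrix \<Rightarrow> nat \<Rightarrow> (nat \<Rightarrow> nat) \<Rightarrow> nat \<Rightarrow> real" where
  "record_of p k A m \<sigma> = (\<Sum>l<m. inc p k A l (\<sigma> l))"

definition records :: "nat \<Rightarrow> nat \<Rightarrow> matrix \<Rightarrow> nat \<Rightarrow> (nat \<Rightarrow> real) set" where
  "records p k A m = {record_of p k A m \<sigma> | \<sigma>. \<forall>l<m. \<sigma> l < p}"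

definition same_shape :: "nat \<Rightarrow> (nat \<Rightarrow> real) \<Rightarrow> (nat \<Rightarrow> real) \<Rightarrow> bool" where
  "same_shape p x y \<longleftrightarrow> (\<forall>c<p. x c = y c)"

lemma grid_less: "r < q \<Longrightarrow> j < p \<Longrightarrow> r * p + j < q * (p::nat)"
proof -
  assume "r < q" "j < p"
  then have "r * p + j < Suc r * p" by simp
  also have "\<dots> \<le> q * p" using \<open>r < q\<close> by (intro mult_le_mono1) simp
  finally show ?thesis .
qed

lemma grid_div_mod: "j < p \<Longrightarrow> (r * p + j) div p = r" "j < p \<Longrightarrow> (r * p + j) mod p = (j::nat)"
  by simp_all

lemma grid_cases:
  assumes "c < q * (p::nat)"
  obtains r j where "r < q" "j < p" "c = r * p + j"
proof (rule that[of "c div p" "c mod p"])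
  show "c div p < q" using assms by (simp add: less_mult_imp_div_less)
  show "c mod p < p" using assms by (cases p) auto
qed simp

lemma sum_grid: "(\<Sum>c<q * p. f c) = (\<Sum>r<q. \<Sum>j<p. f (r * p + j))"
  for f :: "nat \<Rightarrow> 'a::comm_monoid_add"
proof -
  have "(\<Sum>c<q * p. f c) = (\<Sum>r<q. sum f {r * p..<r * p + p})" by (simp add: sum.nat_group)
  also have "\<dots> = (\<Sum>r<q. \<Sum>j<p. f (r * p + j))"
  proof (rule sum.cong[OF refl])
    fix r show "sum f {r * p..<r * p + p} = (\<Sum>j<p. f (r * p + j))"
      using sum.atLeastLessThan_shift_bounds[of f 0 "r * p" p]
      by (simp add: lessThan_atLeast0 add.commute comp_def)
  qed
  finally show ?thesis .
qed

lemma inc_grid: "j' < p \<Longrightarrow> r < k + 1 \<Longrightarrow> inc p k A l j (r * p + j') = (if j' = j then ahat A r l else 0)"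
  using grid_less[of r "k + 1" j' p] by (simp add: inc_def)

lemma dot_inc:
  assumes "j < p"
  shows "dot ((k + 1) * p) y (inc p k A l j) = (\<Sum>r<k + 1. y (r * p + j) * ahat A r l)"
  unfolding dot_def sum_grid
proof (intro sum.cong refl)
  fix r assume "r \<in> {..<k + 1}"
  then have "(\<Sum>j'<p. y (r * p + j') * inc p k A l j (r * p + j'))
      = (\<Sum>j'<p. if j' = j then y (r * p + j') * ahat A r l else 0)"
    by (intro sum.cong) (auto simp: inc_grid simp del: mult_Suc)
  then show "(\<Sum>j'<p. y (r * p + j') * inc p k A l j (r * p + j')) = y (r * p + j) * ahat A r l"
    using assms by simp
qed

lemma record_of_grid:
  assumes "j < p" "r < k + 1"
  shows "record_of p k A m \<sigma> (r * p + j) = (\<Sum>l | l < m \<and> \<sigma> l = j. ahat A r l)"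
proof -
  have "record_of p k A m \<sigma> (r * p + j) = (\<Sum>l<m. if \<sigma> l = j then ahat A r l else 0)"
    unfolding record_of_def sum_fun_apply using assms by (intro sum.cong) (auto simp: inc_grid)
  also have "\<dots> = (\<Sum>l\<in>{..<m} \<inter> {l. \<sigma> l = j}. ahat A r l)" by (simp add: sum.If_cases)
  also have "{..<m} \<inter> {l. \<sigma> l = j} = {l. l < m \<and> \<sigma> l = j}" by auto
  finally show ?thesis .
qed

lemma record_of_outside: "(k + 1) * p \<le> c \<Longrightarrow> record_of p k A m \<sigma> c = 0"
  by (simp add: record_of_def sum_fun_apply inc_def del: mult_Suc add_mult_distrib)

lemma record_of_cong: "(\<And>l. l < m \<Longrightarrow> \<sigma> l = \<tau> l) \<Longrightarrow> record_of p k A m \<sigma> = record_of p k A m \<tau>"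
  unfolding record_of_def by (intro sum.cong) auto

lemma record_row_sum:
  assumes "r < k + 1" "\<And>l. l < m \<Longrightarrow> \<sigma> l < p"
  shows "(\<Sum>j<p. record_of p k A m \<sigma> (r * p + j)) = (\<Sum>l<m. ahat A r l)"
proof -
  have "(\<Sum>j<p. record_of p k A m \<sigma> (r * p + j)) = (\<Sum>j<p. \<Sum>l<m. if \<sigma> l = j then ahat A r l else 0)"
    using assms by (intro sum.cong) (auto simp: record_of_grid sum.If_cases intro!: sum.cong)
  also have "\<dots> = (\<Sum>l<m. \<Sum>j<p. if \<sigma> l = j then ahat A r l else 0)" by (rule sum.swap)
  also have "\<dots> = (\<Sum>l<m. ahat A r l)" using assms by (intro sum.cong) auto
  finally show ?thesis .
qed

lemma records_0: "records p k A 0 = {0}"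
  by (auto simp: records_def record_of_def)

lemma records_Suc: "records p k A (Suc m) = {x + inc p k A m j |x j. x \<in> records p k A m \<and> j < p}"
proof (intro equalityI subsetI)
  fix z assume "z \<in> records p k A (Suc m)"
  then obtain \<sigma> where "z = record_of p k A m \<sigma> + inc p k A m (\<sigma> m)" "\<forall>l<Suc m. \<sigma> l < p"
    by (auto simp: records_def record_of_def)
  moreover from this have "record_of p k A m \<sigma> \<in> records p k A m"
    unfolding records_def by auto
  ultimately show "z \<in> {x + inc p k A m j |x j. x \<in> records p k A m \<and> j < p}" by blast
next
  fix z assume "z \<in> {x + inc p k A m j |x j. x \<in> records p k A m \<and> j < p}"
  then obtain \<sigma> j where z: "z = record_of p k A m \<sigma> + inc p k A m j" "\<forall>l<m. \<sigma> l < p" "j < p"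
    by (auto simp: records_def)
  have "record_of p k A m \<sigma> = record_of p k A m (\<sigma>(m := j))" by (intro record_of_cong) simp
  then have "z = record_of p k A (Suc m) (\<sigma>(m := j))" using z by (simp add: record_of_def)
  moreover have "\<forall>l<Suc m. (\<sigma>(m := j)) l < p" using z by (simp add: less_Suc_eq)
  ultimately show "z \<in> records p k A (Suc m)" unfolding records_def by blast
qed


section \<open>Irredundant generating sets\<close>

text \<open>The hulls are formed for each shape separately because only the oracle, at the end, decides which
  shapes count.\<close>

definition generates :: "nat \<Rightarrow> (nat \<Rightarrow> real) set \<Rightarrow> (nat \<Rightarrow> real) set \<Rightarrow> bool" where
  "generates p S R \<longleftrightarrow> S \<subseteq> R \<and> (\<forall>z\<in>R. z \<in> convex hull {t \<in> S. same_shape p t z})"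

definition irredundant :: "nat \<Rightarrow> nat \<Rightarrow> (nat \<Rightarrow> real) set \<Rightarrow> bool" where
  "irredundant p w S \<longleftrightarrow> (\<forall>x\<in>S. separable w {t - x |t. t \<in> S \<and> same_shape p t x \<and> t \<noteq> x})"

text \<open>A strict minimum over a generating set is strict over its hull: the points that are \<open>x\<close> or have a
  larger value form a convex set.\<close>

lemma strict_minimum_on_hull:
  fixes \<phi> :: "'a::real_vector \<Rightarrow> real"
  assumes "linear \<phi>" and min: "\<And>t. t \<in> S \<Longrightarrow> t = x \<or> \<phi> x < \<phi> t" and "h \<in> convex hull S"
  shows "h = x \<or> \<phi> x < \<phi> h"
proof -
  have "convex {h. h = x \<or> \<phi> x < \<phi> h}"
  proof (rule convexI)
    fix a b and u v :: real
    assume "a \<in> {h. h = x \<or> \<phi> x < \<phi> h}" "b \<in> {h. h = x \<or> \<phi> x < \<phi> h}"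
      and uv: "0 \<le> u" "0 \<le> v" "u + v = 1"
    then have a: "a = x \<or> \<phi> x < \<phi> a" and b: "b = x \<or> \<phi> x < \<phi> b" by auto
    have x: "u *\<^sub>R x + v *\<^sub>R x = x" using uv by (metis scaleR_add_left scaleR_one)
    have phi: "\<phi> (u *\<^sub>R a + v *\<^sub>R b) = \<phi> x + u * (\<phi> a - \<phi> x) + v * (\<phi> b - \<phi> x)"
    proof -
      have "\<phi> x = u * \<phi> x + v * \<phi> x" using uv by (metis distrib_right mult_1)
      then show ?thesis using assms(1) by (simp add: linear_add linear_scale algebra_simps)
    qed
    have "\<phi> x < \<phi> (u *\<^sub>R a + v *\<^sub>R b)" if ne: "u *\<^sub>R a + v *\<^sub>R b \<noteq> x"
    proof -
      have "(u \<noteq> 0 \<and> a \<noteq> x) \<or> (v \<noteq> 0 \<and> b \<noteq> x)" using ne x by (cases "u = 0"; cases "v = 0") auto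
      then show ?thesis
      proof
        assume "u \<noteq> 0 \<and> a \<noteq> x"
        then have "0 < u * (\<phi> a - \<phi> x)" using a uv by (intro mult_pos_pos) auto
        moreover have "0 \<le> v * (\<phi> b - \<phi> x)" using b uv by (intro mult_nonneg_nonneg) auto
        ultimately show ?thesis unfolding phi by linarith
      next
        assume "v \<noteq> 0 \<and> b \<noteq> x"
        then have "0 < v * (\<phi> b - \<phi> x)" using b uv by (intro mult_pos_pos) auto
        moreover have "0 \<le> u * (\<phi> a - \<phi> x)" using a uv by (intro mult_nonneg_nonneg) auto
        ultimately show ?thesis unfolding phi by linarith
      qed
    qed
    then show "u *\<^sub>R a + v *\<^sub>R b \<in> {h. h = x \<or> \<phi> x < \<phi> h}" by blast
  qed
  then have "convex hull S \<subseteq> {h. h = x \<or> \<phi> x < \<phi> h}" using min by (intro hull_minimal) auto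
  then show ?thesis using assms by auto
qed

lemma linear_dot: "linear (dot w y)"
  by (rule linearI) (simp_all add: dot_simps)

lemma exposed_in_generated:
  assumes "generates p S R" "irredundant p w S" "x \<in> S"
  obtains y where "\<And>z. z \<in> R \<Longrightarrow> same_shape p z x \<Longrightarrow> z \<noteq> x \<Longrightarrow> dot w y x < dot w y z"
proof -
  obtain y where y: "\<And>t. t \<in> S \<Longrightarrow> same_shape p t x \<Longrightarrow> t \<noteq> x \<Longrightarrow> 0 < dot w y (t - x)"
    using assms(2,3) unfolding irredundant_def separable_def by blast
  have "dot w y x < dot w y z" if z: "z \<in> R" "same_shape p z x" "z \<noteq> x" for z
  proof -
    have "z \<in> convex hull {t \<in> S. same_shape p t z}" using assms(1) z unfolding generates_def by blast
    then have "z = x \<or> dot w y x < dot w y z"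
      by (rule strict_minimum_on_hull[OF linear_dot, rotated])
        (use z y in \<open>auto simp: same_shape_def dot_simps\<close>)
    then show ?thesis using z by simp
  qed
  then show ?thesis by (rule that)
qed

text \<open>The reason why the columns can be treated one after the other: adding the same increment to all
  records of a shape translates their hull and leads to a single new shape.\<close>

lemma generates_extend:
  assumes "generates p S (records p k A m)"
  shows "generates p {x + inc p k A m j |x j. x \<in> S \<and> j < p} (records p k A (Suc m))"
    (is "generates p ?S' _")
  unfolding generates_def
proof (intro conjI ballI)
  show "?S' \<subseteq> records p k A (Suc m)" using assms unfolding generates_def records_Suc by blast
next
  fix z' assume "z' \<in> records p k A (Suc m)"
  then obtain z j where z: "z' = z + inc p k A m j" "z \<in> records p k A m" "j < p"
    unfolding records_Suc by blast
  let ?a = "inc p k A m j"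
  have "z \<in> convex hull {t \<in> S. same_shape p t z}" using assms z unfolding generates_def by blast
  then have "?a + z \<in> (\<lambda>x. ?a + x) ` (convex hull {t \<in> S. same_shape p t z})" by blast
  then have "?a + z \<in> convex hull ((\<lambda>x. ?a + x) ` {t \<in> S. same_shape p t z})"
    by (simp only: convex_hull_translation)
  moreover have "(\<lambda>x. ?a + x) ` {t \<in> S. same_shape p t z} \<subseteq> {t \<in> ?S'. same_shape p t z'}"
    using z by (auto simp: same_shape_def add.commute)
  ultimately show "z' \<in> convex hull {t \<in> ?S'. same_shape p t z'}"
    using hull_mono z(1) by (metis (no_types, lifting) add.commute subsetD)
qed

section \<open>Few records are irredundant\<close>

lemma sum_swap_two:
  fixes f :: "nat \<Rightarrow> nat \<Rightarrow> 'a::ab_group_add"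
  assumes "l < m" "l' < m" "l \<noteq> l'"
  shows "(\<Sum>t<m. f t ((\<sigma>(l := i, l' := j)) t))
    = (\<Sum>t<m. f t (\<sigma> t)) + (f l i - f l (\<sigma> l)) + (f l' j - f l' (\<sigma> l'))"
proof -
  have "(\<Sum>t<m. f t ((\<sigma>(l := i, l' := j)) t))
    = (\<Sum>t<m. f t (\<sigma> t) + (if t = l then f l i - f l (\<sigma> l) else 0)
         + (if t = l' then f l' j - f l' (\<sigma> l') else 0))"
    using assms by (intro sum.cong) auto
  then show ?thesis using assms by (simp add: sum.distrib)
qed

text \<open>For a large factor \<open>K\<close> the value \<open>K * g l + l\<close> orders the indices lexicographically by \<open>g\<close> and by
  the index itself, so ties of \<open>g\<close> do not need a separate parameter.\<close>

lemma lexicographic_threshold: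
  fixes g :: "nat \<Rightarrow> real"
  assumes "finite X" "finite Y"
    and lt: "\<And>l l'. l \<in> X \<Longrightarrow> l' \<in> Y \<Longrightarrow> g l < g l' \<or> g l = g l' \<and> l < l'"
  obtains K t where "\<And>l. l \<in> X \<Longrightarrow> K * g l + real l < t" "\<And>l. l \<in> Y \<Longrightarrow> t < K * g l + real l"
proof -
  have "eventually (\<lambda>K. K * g l + real l < K * g l' + real l') at_top" if l: "l \<in> X" "l' \<in> Y" for l l'
  proof (cases "g l < g l'")
    case True
    show ?thesis
      using eventually_gt_at_top[of "(real l - real l') / (g l' - g l)"]
    proof eventually_elim
      case (elim K)
      then have "real l - real l' < K * (g l' - g l)" using True by (simp add: pos_divide_less_eq)
      then show ?case by (simp add: algebra_simps)
    qed
  next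
    case False
    then show ?thesis using lt[OF l] by simp
  qed
  then have "\<forall>l\<in>X. eventually (\<lambda>K. \<forall>l'\<in>Y. K * g l + real l < K * g l' + real l') at_top"
    by (intro ballI eventually_ball_finite[OF assms(2)]) blast
  from eventually_ball_finite[OF assms(1) this]
  have "\<exists>K. \<forall>l\<in>X. \<forall>l'\<in>Y. K * g l + real l < K * g l' + real l'"
    by (rule eventually_happens'[OF trivial_limit_at_top_linorder])
  then obtain K where K: "\<And>l l'. l \<in> X \<Longrightarrow> l' \<in> Y \<Longrightarrow> K * g l + real l < K * g l' + real l'"
    by blast
  obtain t where "\<And>a. a \<in> (\<lambda>l. K * g l + real l) ` X \<Longrightarrow> a < t"
    "\<And>b. b \<in> (\<lambda>l. K * g l + real l) ` Y \<Longrightarrow> t < b"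
    by (rule between_finite_sets[of "(\<lambda>l. K * g l + real l) ` X" "(\<lambda>l. K * g l + real l) ` Y"])
      (use assms(1,2) K in auto)
  then show ?thesis by (intro that[of K t]) auto
qed

text \<open>Two classes of the partition of an exposed record are separated by a threshold. Exchanging a column
  \<open>l\<close> of class \<open>i\<close> with a column \<open>l'\<close> of class \<open>j\<close> does not change the shape, so it increases the value
  of the exposing functional, or it does not change the record at all. In the second case the choice
  of the partition among those with the same record, with \<open>\<Sum>l<m. l * \<sigma> l\<close> as large as possible,
  forces \<open>l < l'\<close>.\<close>

lemma class_threshold:
  fixes p k m :: nat and A :: matrix
  defines "w \<equiv> (k + 1) * p"
  assumes \<sigma>: "\<And>l. l < m \<Longrightarrow> \<sigma> l < p" "x = record_of p k A m \<sigma>"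
    and top: "\<And>\<tau>. (\<forall>l<m. \<tau> l < p) \<Longrightarrow> x = record_of p k A m \<tau> \<Longrightarrow> (\<Sum>l<m. l * \<tau> l) \<le> (\<Sum>l<m. l * \<sigma> l)"
    and y: "\<And>z. z \<in> records p k A m \<Longrightarrow> same_shape p z x \<Longrightarrow> z \<noteq> x \<Longrightarrow> dot w y x < dot w y z"
    and ij: "i < j" "j < p"
  shows "\<exists>D\<in>threshold_sets m {..<k + 1} (\<lambda>l r. ahat A r l) real.
    \<forall>l<m. (\<sigma> l = i \<longrightarrow> l \<in> D) \<and> (\<sigma> l = j \<longrightarrow> l \<notin> D)"
proof -
  define g where "g = (\<lambda>l. dot w y (inc p k A l i) - dot w y (inc p k A l j))"
  have g: "g l = (\<Sum>r<k + 1. (y (r * p + i) - y (r * p + j)) * ahat A r l)" for l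
    unfolding g_def w_def left_diff_distrib sum_subtractf
    using dot_inc[of i p k y A l] dot_inc[of j p k y A l] ij by (simp only:)
  have lex: "g l < g l' \<or> g l = g l' \<and> l < l'"
    if l: "l < m" "\<sigma> l = i" and l': "l' < m" "\<sigma> l' = j" for l l'
  proof -
    have "l \<noteq> l'" using l l' ij by auto
    define \<tau> where "\<tau> = \<sigma>(l := j, l' := i)"
    define z where "z = record_of p k A m \<tau>"
    have \<tau>: "\<forall>l<m. \<tau> l < p" using \<sigma>(1) ij unfolding \<tau>_def by auto
    have z: "z = x + (inc p k A l j - inc p k A l i) + (inc p k A l' i - inc p k A l' j)"
      unfolding z_def \<tau>_def \<sigma>(2) record_of_def
      using sum_swap_two[OF l(1) l'(1) \<open>l \<noteq> l'\<close>, of "inc p k A" \<sigma> j i] l l' by simp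
    have "inc p k A a b c = (if c = b then 1 else 0)" if "c < p" for a b c
      using inc_grid[of c p 0 k A a b] that by (simp add: ahat_def)
    then have "same_shape p z x" unfolding z same_shape_def by simp
    moreover have "z \<in> records p k A m" using \<tau> unfolding z_def records_def by blast
    moreover have "dot w y z = dot w y x + (g l' - g l)" unfolding z g_def by (simp add: dot_simps)
    ultimately have *: "g l < g l'" if "z \<noteq> x" using y that by fastforce
    show ?thesis
    proof (cases "z = x")
      case True
      then have eq: "g l = g l'" using \<open>dot w y z = _\<close> by simp
      have "int (\<Sum>t<m. t * \<tau> t) \<le> int (\<Sum>t<m. t * \<sigma> t)"
        using top[OF \<tau>] True unfolding z_def by (simp only: of_nat_le_iff)
      moreover have "int (\<Sum>t<m. t * \<tau> t) = int (\<Sum>t<m. t * \<sigma> t)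
          + (int l * int j - int l * int i) + (int l' * int i - int l' * int j)"
        using sum_swap_two[OF l(1) l'(1) \<open>l \<noteq> l'\<close>, of "\<lambda>t a. int t * int a" \<sigma> j i] l l'
        unfolding \<tau>_def by simp
      ultimately have "(int j - int i) * (int l - int l') \<le> 0" by (simp add: algebra_simps)
      then have "l \<le> l'" using ij by (simp add: mult_le_0_iff)
      then show ?thesis using eq \<open>l \<noteq> l'\<close> by simp
    qed (use * in simp)
  qed
  obtain K t where K: "\<And>l. l \<in> {l. l < m \<and> \<sigma> l = i} \<Longrightarrow> K * g l + real l < t"
    "\<And>l. l \<in> {l. l < m \<and> \<sigma> l = j} \<Longrightarrow> t < K * g l + real l"
    by (rule lexicographic_threshold[of "{l. l < m \<and> \<sigma> l = i}" "{l. l < m \<and> \<sigma> l = j}" g])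
      (use lex in auto)
  \<comment> \<open>The row of ones in the extended columns absorbs the threshold \<open>t\<close>.\<close>
  define \<theta> where "\<theta> = (\<lambda>r. (if r = 0 then t else 0) - K * (y (r * p + i) - y (r * p + j)))"
  have th: "(\<Sum>r<k + 1. ahat A r l * \<theta> r) = t - K * g l" for l
  proof -
    have "(\<Sum>r<k + 1. ahat A r l * \<theta> r)
      = (\<Sum>r<k + 1. (if r = 0 then t else 0) - K * ((y (r * p + i) - y (r * p + j)) * ahat A r l))"
      by (intro sum.cong) (auto simp: \<theta>_def ahat_def algebra_simps)
    also have "\<dots> = t - K * g l" unfolding g sum_distrib_left sum_subtractf by simp
    finally show ?thesis .
  qed
  let ?D = "{l. l < m \<and> real l < (\<Sum>r<k + 1. ahat A r l * \<theta> r)}"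
  have "?D \<in> threshold_sets m {..<k + 1} (\<lambda>l r. ahat A r l) real"
    unfolding threshold_sets_def by blast
  moreover have "\<forall>l<m. (\<sigma> l = i \<longrightarrow> l \<in> ?D) \<and> (\<sigma> l = j \<longrightarrow> l \<notin> ?D)"
    unfolding th using K by fastforce
  ultimately show ?thesis by blast
qed

text \<open>A record is determined by the threshold sets that separate the pairs of classes of its partition:
  class \<open>i\<close> consists of the columns that lie on its side for all pairs. Each of the
  \<open>p * (p - 1) div 2\<close> pairs leaves at most \<open>(m + 1) ^ (k + 1)\<close> choices. The bound covers all shapes
  together.\<close>

theorem card_irredundant:
  assumes "generates p S (records p k A m)" "irredundant p ((k + 1) * p) S"
  shows "card S \<le> ((m + 1) ^ (k + 1)) ^ (p * (p - 1) div 2)"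
proof -
  let ?w = "(k + 1) * p" and ?TH = "threshold_sets m {..<k + 1} (\<lambda>l r. ahat A r l) real"
  let ?pot = "\<lambda>\<sigma>. \<Sum>l<m. l * \<sigma> l :: nat"
  let ?rep = "\<lambda>x \<sigma>. (\<forall>l<m. \<sigma> l < p) \<and> x = record_of p k A m \<sigma>"
  have SR: "S \<subseteq> records p k A m" using assms(1) by (simp add: generates_def)
  have "\<exists>\<sigma>. ?rep x \<sigma> \<and> (\<forall>\<tau>. ?rep x \<tau> \<longrightarrow> ?pot \<tau> \<le> ?pot \<sigma>)" if x: "x \<in> S" for x
  proof -
    obtain \<sigma> where "?rep x \<sigma>" using SR x unfolding records_def by blast
    moreover have "\<forall>\<tau>. ?rep x \<tau> \<longrightarrow> ?pot \<tau> < Suc (\<Sum>l<m. l * p)"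
      by (intro allI impI le_imp_less_Suc sum_mono mult_left_mono) (auto intro: less_imp_le)
    ultimately show ?thesis by (rule ex_has_greatest_nat)
  qed
  then have "\<forall>x\<in>S. \<exists>\<sigma>. ?rep x \<sigma> \<and> (\<forall>\<tau>. ?rep x \<tau> \<longrightarrow> ?pot \<tau> \<le> ?pot \<sigma>)" by blast
  from bchoice[OF this] obtain \<sigma> where \<sigma>: "\<And>x. x \<in> S \<Longrightarrow> ?rep x (\<sigma> x)"
    "\<And>x \<tau>. x \<in> S \<Longrightarrow> ?rep x \<tau> \<Longrightarrow> ?pot \<tau> \<le> ?pot (\<sigma> x)" by blast
  let ?cuts = "\<lambda>x i j D. D \<in> ?TH \<and> (\<forall>l<m. (\<sigma> x l = i \<longrightarrow> l \<in> D) \<and> (\<sigma> x l = j \<longrightarrow> l \<notin> D))"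
  define D where "D = (\<lambda>x i j. SOME D. ?cuts x i j D)"
  have "?cuts x i j (D x i j)"
    if x: "x \<in> S" and ij: "i < j" "j < p" for x i j
  proof -
    obtain y where "\<And>z. z \<in> records p k A m \<Longrightarrow> same_shape p z x \<Longrightarrow> z \<noteq> x \<Longrightarrow> dot ?w y x < dot ?w y z"
      using exposed_in_generated[OF assms x] by blast
    then have "\<exists>D\<in>?TH. \<forall>l<m. (\<sigma> x l = i \<longrightarrow> l \<in> D) \<and> (\<sigma> x l = j \<longrightarrow> l \<notin> D)"
      by (intro class_threshold[of m "\<sigma> x" p x k A y i j]) (use \<sigma> x ij in blast)+
    then have "\<exists>D. ?cuts x i j D" by blast
    then show ?thesis unfolding D_def by (rule someI_ex)
  qed
  then have D: "\<And>x i j. x \<in> S \<Longrightarrow> i < j \<Longrightarrow> j < p \<Longrightarrow> D x i j \<in> ?TH"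
    "\<And>x i j l. x \<in> S \<Longrightarrow> i < j \<Longrightarrow> j < p \<Longrightarrow> l < m \<Longrightarrow> \<sigma> x l = i \<Longrightarrow> l \<in> D x i j"
    "\<And>x i j l. x \<in> S \<Longrightarrow> i < j \<Longrightarrow> j < p \<Longrightarrow> l < m \<Longrightarrow> \<sigma> x l = j \<Longrightarrow> l \<notin> D x i j" by blast+
  let ?P = "SIGMA j:{..<p}. {..<j}"
  define F where "F = (\<lambda>x. restrict (\<lambda>(j, i). D x i j) ?P)"
  have "F ` S \<subseteq> ?P \<rightarrow>\<^sub>E ?TH"
  proof (rule image_subsetI)
    fix x assume "x \<in> S"
    then have "(\<lambda>(j, i). D x i j) c \<in> ?TH" if "c \<in> ?P" for c using D(1) that by (cases c) auto
    then show "F x \<in> ?P \<rightarrow>\<^sub>E ?TH" unfolding F_def by (rule restrict_PiE_iff[THEN iffD2, rule_format])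
  qed
  moreover have "inj_on F S"
  proof
    fix x x' assume x: "x \<in> S" "x' \<in> S" "F x = F x'"
    have DD: "D x i j = D x' i j" if "i < j" "j < p" for i j
      using fun_cong[OF x(3), of "(j, i)"] that by (simp add: F_def)
    have "\<sigma> x l = \<sigma> x' l" if l: "l < m" for l
    proof (rule ccontr)
      assume "\<sigma> x l \<noteq> \<sigma> x' l"
      then consider "\<sigma> x l < \<sigma> x' l" | "\<sigma> x' l < \<sigma> x l" by linarith
      then show False
      proof cases
        case 1
        have "\<sigma> x' l < p" using \<sigma>(1)[OF x(2)] l by blast
        then show False
          using D(2)[OF x(1) 1 _ l refl] D(3)[OF x(2) 1 _ l refl] DD[OF 1] by blast
      next
        case 2
        have "\<sigma> x l < p" using \<sigma>(1)[OF x(1)] l by blast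
        then show False
          using D(2)[OF x(2) 2 _ l refl] D(3)[OF x(1) 2 _ l refl] DD[OF 2] by blast
      qed
    qed
    then show "x = x'" using \<sigma>(1)[OF x(1)] \<sigma>(1)[OF x(2)] record_of_cong[of m "\<sigma> x" "\<sigma> x'" p k A] by simp
  qed
  moreover have "finite (?P \<rightarrow>\<^sub>E ?TH)" by (intro finite_PiE finite_threshold_sets) auto
  ultimately have "card S \<le> card (?P \<rightarrow>\<^sub>E ?TH)" by (meson card_inj_on_le)
  also have "\<dots> = card ?TH ^ card ?P" by (simp add: card_PiE)
  also have "card ?P = p * (p - 1) div 2"
  proof -
    have "2 * (\<Sum>j<p. j) = p * (p - 1)"
    proof (induction p)
      case (Suc p)
      then show ?case by (cases p) auto
    qed simp
    then show ?thesis by simp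
  qed
  also have "card ?TH ^ (p * (p - 1) div 2) \<le> ((m + 1) ^ (k + 1)) ^ (p * (p - 1) div 2)"
    using card_threshold_sets[of "{..<k + 1}" m "\<lambda>l r. ahat A r l" real]
    by (intro power_mono) auto
  finally show ?thesis .
qed

section \<open>Detecting redundant records\<close>

text \<open>The row sums of a record depend on the columns of \<open>A\<close> and not on the partition, so the last class
  is determined by the others. This lowers the dimension from \<open>k * p\<close> to \<open>k * (p - 1)\<close>, and with it
  the number of records that have to be tested together.\<close>

definition balanced :: "nat \<Rightarrow> nat \<Rightarrow> (nat \<Rightarrow> real) set \<Rightarrow> bool" where
  "balanced p k R \<longleftrightarrow> (\<forall>x\<in>R. \<forall>c\<ge>(k + 1) * p. x c = 0)
     \<and> (\<exists>s. \<forall>x\<in>R. \<forall>r\<in>{1..k}. (\<Sum>j<p. x (r * p + j)) = s r)"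

definition free_coords :: "nat \<Rightarrow> nat \<Rightarrow> nat set" where
  "free_coords p k = (\<lambda>(r, j). (r + 1) * p + j) ` ({..<k} \<times> {..<p - 1})"

lemma card_free_coords: "finite (free_coords p k)" "card (free_coords p k) \<le> k * (p - 1)"
proof -
  show "finite (free_coords p k)" by (simp add: free_coords_def)
  show "card (free_coords p k) \<le> k * (p - 1)"
    unfolding free_coords_def by (rule card_image_le[THEN order.trans]) (auto simp: card_cartesian_product)
qed

lemma free_coords_grid:
  assumes "j < p" "r < k + 1"
  shows "r * p + j \<in> free_coords p k \<longleftrightarrow> 0 < r \<and> j \<noteq> p - 1"
proof
  assume "r * p + j \<in> free_coords p k"
  then obtain r' j' where *: "r' < k" "j' < p - 1" "r * p + j = (r' + 1) * p + j'"
    unfolding free_coords_def by auto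
  then have "j' < p" by simp
  from *(3) have "(r * p + j) div p = ((r' + 1) * p + j') div p" "(r * p + j) mod p = ((r' + 1) * p + j') mod p"
    by simp_all
  then have "r = r' + 1" "j = j'"
    using grid_div_mod[OF assms(1), of r] grid_div_mod[OF \<open>j' < p\<close>, of "r' + 1"] by simp_all
  then show "0 < r \<and> j \<noteq> p - 1" using * by simp
next
  assume *: "0 < r \<and> j \<noteq> p - 1"
  then obtain r' where "r = r' + 1" by (cases r) auto
  then have "r * p + j = (\<lambda>(r, j). (r + 1) * p + j) (r', j)" "(r', j) \<in> {..<k} \<times> {..<p - 1}"
    using assms * by auto
  then show "r * p + j \<in> free_coords p k" unfolding free_coords_def by blast
qed

text \<open>On vectors with row sums zero a functional does not change if a constant is subtracted from its
  coefficients in a row; the constant is chosen so that the last coefficient vanishes.\<close>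

lemma functional_on_free_coords:
  assumes "0 < p" and U: "\<And>u c. u \<in> U \<Longrightarrow> c < p \<Longrightarrow> u c = 0"
    and bal: "\<And>u r. u \<in> U \<Longrightarrow> r \<in> {1..k} \<Longrightarrow> (\<Sum>j<p. u (r * p + j)) = 0"
  shows "\<exists>y'. (\<forall>c. c \<notin> free_coords p k \<longrightarrow> y' c = 0)
    \<and> (\<forall>u\<in>U. dot ((k + 1) * p) y' u = dot ((k + 1) * p) y u)"
proof -
  define y' where "y' = (\<lambda>c. if c \<in> free_coords p k then y c - y (c div p * p + (p - 1)) else 0)"
  have "(\<Sum>j<p. y' (r * p + j) * u (r * p + j)) = (\<Sum>j<p. y (r * p + j) * u (r * p + j))"
    if u: "u \<in> U" and r: "r < k + 1" for u r
  proof (cases "r = 0")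
    case True
    then show ?thesis by (intro sum.cong) (simp_all add: U[OF u])
  next
    case False
    then have r1: "r \<in> {1..k}" using r by simp
    have "y' (r * p + j) = y (r * p + j) - y (r * p + (p - 1))" if "j < p" for j
      using free_coords_grid[OF that r] False grid_div_mod[OF that, of r] unfolding y'_def by auto
    then have "(\<Sum>j<p. y' (r * p + j) * u (r * p + j))
      = (\<Sum>j<p. y (r * p + j) * u (r * p + j)) - y (r * p + (p - 1)) * (\<Sum>j<p. u (r * p + j))"
      by (simp add: left_diff_distrib sum_subtractf sum_distrib_left)
    then show ?thesis using bal[OF u r1] by simp
  qed
  then have "dot ((k + 1) * p) y' u = dot ((k + 1) * p) y u" if "u \<in> U" for u
    unfolding dot_def sum_grid using that by (intro sum.cong[OF refl, of "{..<k + 1}"]) simp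
  then show ?thesis by (intro exI[of _ y']) (auto simp: y'_def)
qed

lemma separable_subset: "separable w U \<Longrightarrow> T \<subseteq> U \<Longrightarrow> separable w T"
  unfolding separable_def by blast

lemma separable_empty: "separable w {}"
  unfolding separable_def by blast

text \<open>The test performed by the algorithm: \<open>x\<close> is redundant just if elimination leaves a
  vector of the differences for some tuple of \<open>T\<close> rows. Repetitions are harmless, so tuples of fixed length stand for
  all sets of at most \<open>T\<close> rows.\<close>

theorem redundancy_test:
  fixes p k N :: nat and Y :: "nat \<Rightarrow> nat \<Rightarrow> real"
  defines "w \<equiv> (k + 1) * p" and "T \<equiv> k * (p - 1) + 1"
  assumes "0 < p" "balanced p k R" "x \<in> R"
    and R: "\<And>r. r < N \<Longrightarrow> same_shape p (Y r) x \<Longrightarrow> Y r \<in> R"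
  shows "(\<exists>f. (\<forall>j<T. f j < N) \<and> elimination p w ((\<lambda>j. Y (f j) - x) ` {..<T}) \<noteq> {})
    \<longleftrightarrow> \<not> separable w {Y r - x |r. r < N \<and> same_shape p (Y r) x}" (is "?L \<longleftrightarrow> \<not> separable w ?U")
proof -
  have pw: "p \<le> w" unfolding w_def by simp
  have iff: "elimination p w ((\<lambda>j. Y (f j) - x) ` {..<T}) = {}
      \<longleftrightarrow> separable w {u \<in> (\<lambda>j. Y (f j) - x) ` {..<T}. \<forall>c<p. u c = 0}" for f
    by (rule elimination_empty_iff[OF _ pw]) simp
  have shape: "(\<forall>c<p. (Y r - x) c = 0) \<longleftrightarrow> same_shape p (Y r) x" for r
    by (auto simp: same_shape_def)
  show ?thesis
  proof
    assume ?L
    then obtain f where f: "\<forall>j<T. f j < N" "\<not> separable w {u \<in> (\<lambda>j. Y (f j) - x) ` {..<T}. \<forall>c<p. u c = 0}"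
      unfolding iff by blast
    have "{u \<in> (\<lambda>j. Y (f j) - x) ` {..<T}. \<forall>c<p. u c = 0} \<subseteq> ?U" using f(1) shape by auto
    then show "\<not> separable w ?U" using f(2) separable_subset by blast
  next
    assume *: "\<not> separable w ?U"
    have "finite ?U" by simp
    obtain s where s: "\<And>x r. x \<in> R \<Longrightarrow> r \<in> {1..k} \<Longrightarrow> (\<Sum>j<p. x (r * p + j)) = s r"
      using assms(4) unfolding balanced_def by auto
    have U: "(\<Sum>j<p. u (r * p + j)) = 0" if "u \<in> ?U" "r \<in> {1..k}" for u r
      using that s R assms(5) by (auto simp: sum_subtractf)
    have J: "\<exists>y'. (\<forall>c. c \<notin> free_coords p k \<longrightarrow> y' c = 0) \<and> (\<forall>u\<in>?U. dot w y' u = dot w y u)" for y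
      unfolding w_def by (rule functional_on_free_coords[OF assms(3) _ U]) (auto simp: same_shape_def)
    obtain Q where Q: "Q \<subseteq> ?U" "card Q \<le> card (free_coords p k) + 1" "\<not> separable w Q"
      using small_inseparable_subset[OF \<open>finite ?U\<close> card_free_coords(1) J *] by blast
    have "finite Q" by (rule finite_subset[OF Q(1) \<open>finite ?U\<close>])
    obtain h where h: "bij_betw h {0..<card Q} Q" using ex_bij_betw_nat_finite[OF \<open>finite Q\<close>] by blast
    have "Q \<noteq> {}" using Q(3) separable_empty by blast
    then have c0: "0 < card Q" using \<open>finite Q\<close> by (simp add: card_gt_0_iff)
    have cT: "card Q \<le> T" using Q(2) card_free_coords(2)[of p k] unfolding T_def by linarith
    \<comment> \<open>Repeating \<open>h 0\<close> pads the enumeration of \<open>Q\<close> to the length \<open>T\<close>.\<close>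
    define g where "g = (\<lambda>j. h (if j < card Q then j else 0))"
    have "g ` {..<T} = Q"
    proof
      show "g ` {..<T} \<subseteq> Q" using h c0 unfolding g_def bij_betw_def by auto
      show "Q \<subseteq> g ` {..<T}"
      proof
        fix u assume "u \<in> Q"
        then have "u \<in> h ` {0..<card Q}" using bij_betw_imp_surj_on[OF h] by simp
        then obtain j where "j < card Q" "u = h j" by auto
        then show "u \<in> g ` {..<T}" using cT unfolding g_def by (intro image_eqI[of _ _ j]) auto
      qed
    qed
    then have "\<forall>j\<in>{..<T}. \<exists>r. r < N \<and> same_shape p (Y r) x \<and> g j = Y r - x" using Q(1) by blast
    from bchoice[OF this] obtain f where f: "\<forall>j\<in>{..<T}. f j < N \<and> same_shape p (Y (f j)) x \<and> g j = Y (f j) - x"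
      by blast
    have "{u \<in> (\<lambda>j. Y (f j) - x) ` {..<T}. \<forall>c<p. u c = 0} = Q"
      using f shape \<open>g ` {..<T} = Q\<close> by (auto simp: image_iff) (metis lessThan_iff)+
    then have "elimination p w ((\<lambda>j. Y (f j) - x) ` {..<T}) \<noteq> {}" using iff Q(3) by simp
    then show ?L using f by blast
  qed
qed

section \<open>Discarding redundant records one at a time\<close>

text \<open>The state when the rows below \<open>q\<close> have been tested and the rows in \<open>L\<close> are left. Discarding later
  rows keeps the tested ones irredundant. The condition concerns indices and not vectors: of
  several equal rows all but the last are discarded, as they are redundant because of each other.\<close>

definition filter_inv :: "nat \<Rightarrow> nat \<Rightarrow> nat \<Rightarrow> (nat \<Rightarrow> nat \<Rightarrow> real) \<Rightarrow> nat \<Rightarrow> nat set \<Rightarrow> bool" where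
  "filter_inv p w N Y q L \<longleftrightarrow> L \<subseteq> {..<N} \<and> {q..<N} \<subseteq> L
     \<and> (\<forall>r<N. Y r \<in> convex hull {Y s |s. s \<in> L \<and> same_shape p (Y s) (Y r)})
     \<and> (\<forall>r\<in>L. r < q \<longrightarrow> separable w {Y s - Y r |s. s \<in> L \<and> s \<noteq> r \<and> same_shape p (Y s) (Y r)})"

lemma filter_inv_start: "filter_inv p w N Y 0 {..<N}"
  unfolding filter_inv_def by (auto intro!: hull_inc simp: same_shape_def)

text \<open>If the differences from row \<open>q\<close> are inseparable, Gordan's theorem puts this row into the hull of the
  others, and it can be replaced in all convex representations.\<close>

lemma filter_inv_step:
  assumes inv: "filter_inv p w N Y q L" and "q < N"
    and supp: "\<And>r c. r < N \<Longrightarrow> w \<le> c \<Longrightarrow> Y r c = 0"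
    and L': "L' = (if separable w {Y s - Y q |s. s \<in> L \<and> s \<noteq> q \<and> same_shape p (Y s) (Y q)}
      then L else L - {q})"
  shows "filter_inv p w N Y (Suc q) L'"
proof (cases "separable w {Y s - Y q |s. s \<in> L \<and> s \<noteq> q \<and> same_shape p (Y s) (Y q)}")
  case True
  then show ?thesis using inv L' by (auto simp: filter_inv_def less_Suc_eq)
next
  case False
  let ?V = "{Y s |s. s \<in> L \<and> s \<noteq> q \<and> same_shape p (Y s) (Y q)}"
  have L: "L \<subseteq> {..<N}" "{q..<N} \<subseteq> L" using inv by (auto simp: filter_inv_def)
  have finL: "finite L" using L(1) finite_subset by blast
  have L'_eq: "L' = L - {q}" using False L' by simp
  have U: "{Y s - Y q |s. s \<in> L \<and> s \<noteq> q \<and> same_shape p (Y s) (Y q)} = (\<lambda>v. - Y q + v) ` ?V" by auto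
  have "finite ?V" using finL by simp
  have "0 \<in> convex hull ((\<lambda>v. - Y q + v) ` ?V)"
  proof (rule Gordan[of _ w])
    show "finite ((\<lambda>v. - Y q + v) ` ?V)" using \<open>finite ?V\<close> by simp
    show "\<not> separable w ((\<lambda>v. - Y q + v) ` ?V)" using False unfolding U .
    show "u c = 0" if "u \<in> (\<lambda>v. - Y q + v) ` ?V" "w \<le> c" for u c
      using that supp L(1) \<open>q < N\<close> by auto
  qed
  then have "0 \<in> (\<lambda>v. - Y q + v) ` (convex hull ?V)" by (simp only: convex_hull_translation)
  then have Yq: "Y q \<in> convex hull ?V"
    by (auto simp: image_iff)
  have hull: "Y r \<in> convex hull {Y s |s. s \<in> L' \<and> same_shape p (Y s) (Y r)}" if r: "r < N" for r
  proof -
    have "Y s \<in> convex hull {Y s |s. s \<in> L' \<and> same_shape p (Y s) (Y r)}"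
      if s: "s \<in> L" "same_shape p (Y s) (Y r)" for s
    proof (cases "s = q")
      case True
      have "?V \<subseteq> {Y s |s. s \<in> L' \<and> same_shape p (Y s) (Y r)}"
        using s True L'_eq by (auto simp: same_shape_def)
      then show ?thesis using Yq True hull_mono by blast
    next
      case False
      then show ?thesis using s L'_eq by (auto intro: hull_inc)
    qed
    then have "convex hull {Y s |s. s \<in> L \<and> same_shape p (Y s) (Y r)}
        \<subseteq> convex hull {Y s |s. s \<in> L' \<and> same_shape p (Y s) (Y r)}"
      by (intro hull_minimal) auto
    then show ?thesis using inv r unfolding filter_inv_def by blast
  qed
  have "separable w {Y s - Y r |s. s \<in> L' \<and> s \<noteq> r \<and> same_shape p (Y s) (Y r)}"
    if r: "r \<in> L'" "r < Suc q" for r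
  proof -
    have "r \<in> L" "r < q" using r L'_eq by (auto simp: less_Suc_eq)
    then have "separable w {Y s - Y r |s. s \<in> L \<and> s \<noteq> r \<and> same_shape p (Y s) (Y r)}"
      using inv unfolding filter_inv_def by blast
    then show ?thesis by (rule separable_subset) (auto simp: L'_eq)
  qed
  then show ?thesis unfolding filter_inv_def using hull L L'_eq by auto
qed

lemma filter_inv_end:
  assumes "filter_inv p w N Y N L"
  shows "inj_on Y L" "irredundant p w (Y ` L)" "generates p (Y ` L) (Y ` {..<N})"
proof -
  have L: "L \<subseteq> {..<N}"
    and hull: "\<And>r. r < N \<Longrightarrow> Y r \<in> convex hull {Y s |s. s \<in> L \<and> same_shape p (Y s) (Y r)}"
    and sep: "\<And>r. r \<in> L \<Longrightarrow> separable w {Y s - Y r |s. s \<in> L \<and> s \<noteq> r \<and> same_shape p (Y s) (Y r)}"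
    using assms unfolding filter_inv_def by auto
  show "inj_on Y L"
  proof (rule inj_onI, rule ccontr)
    fix r s assume rs: "r \<in> L" "s \<in> L" "Y r = Y s" "r \<noteq> s"
    then have "Y s - Y r \<in> {Y s - Y r |s. s \<in> L \<and> s \<noteq> r \<and> same_shape p (Y s) (Y r)}"
      by (auto simp: same_shape_def)
    then obtain y where "0 < dot w y (Y s - Y r)" using sep[OF rs(1)] unfolding separable_def by blast
    then show False using rs by (simp add: dot_simps)
  qed
  show "irredundant p w (Y ` L)"
    unfolding irredundant_def
  proof
    fix x assume "x \<in> Y ` L"
    then obtain r where r: "r \<in> L" "x = Y r" by blast
    show "separable w {t - x |t. t \<in> Y ` L \<and> same_shape p t x \<and> t \<noteq> x}"
      by (rule separable_subset[OF sep[OF r(1)]]) (auto simp: r)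
  qed
  have "{Y s |s. s \<in> L \<and> same_shape p (Y s) z} = {t \<in> Y ` L. same_shape p t z}" for z by auto
  then show "generates p (Y ` L) (Y ` {..<N})"
    unfolding generates_def using hull L by (auto simp del: Collect_conj_eq)
qed

lemma generates_trans:
  assumes "generates p S Z" "generates p Z R"
  shows "generates p S R"
  unfolding generates_def
proof (intro conjI ballI)
  show "S \<subseteq> R" using assms unfolding generates_def by blast
  fix z assume "z \<in> R"
  then have z: "z \<in> convex hull {t \<in> Z. same_shape p t z}" using assms unfolding generates_def by blast
  have "t \<in> convex hull {t \<in> S. same_shape p t z}" if "t \<in> Z" "same_shape p t z" for t
  proof -
    have "{s \<in> S. same_shape p s t} = {s \<in> S. same_shape p s z}" using that by (auto simp: same_shape_def)
    then show ?thesis using assms(1) that unfolding generates_def by metis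
  qed
  then have "convex hull {t \<in> Z. same_shape p t z} \<subseteq> convex hull {t \<in> S. same_shape p t z}"
    by (intro hull_minimal) auto
  then show "z \<in> convex hull {t \<in> S. same_shape p t z}" using z by blast
qed

lemma balanced_records: "balanced p k (records p k A m)"
  unfolding balanced_def
proof (intro conjI exI[of _ "\<lambda>r. \<Sum>l<m. ahat A r l"] ballI allI impI)
  show "x c = 0" if "x \<in> records p k A m" "(k + 1) * p \<le> c" for x c
    using that record_of_outside unfolding records_def by blast
  show "(\<Sum>j<p. x (r * p + j)) = (\<Sum>l<m. ahat A r l)" if x: "x \<in> records p k A m" and r: "r \<in> {1..k}" for x r
  proof -
    obtain \<sigma> where "x = record_of p k A m \<sigma>" "\<forall>l<m. \<sigma> l < p" using x unfolding records_def by blast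
    then show ?thesis using record_row_sum[of r k m \<sigma> p A] r by simp
  qed
qed


section \<open>The vertices of the polytope\<close>

definition shape_of :: "nat \<Rightarrow> (nat \<Rightarrow> real) \<Rightarrow> nat list" where
  "shape_of p x = map (\<lambda>j. nat \<lfloor>x j\<rfloor>) [0..<p]"

definition erase :: "nat \<Rightarrow> (nat \<Rightarrow> real) \<Rightarrow> nat \<Rightarrow> real" where
  "erase p x = (\<lambda>c. if c < p then 0 else x c)"

definition to_matrix :: "nat \<Rightarrow> nat \<Rightarrow> (nat \<Rightarrow> real) \<Rightarrow> matrix" where
  "to_matrix k p x = (\<lambda>i j. if i < k \<and> j < p then x ((i + 1) * p + j) else 0)"

lemma record_shape:
  assumes "j < p"
  shows "record_of p k A m \<sigma> j = real (card {l. l < m \<and> \<sigma> l = j})"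
  using record_of_grid[OF assms, of 0 k A m \<sigma>] by (simp add: ahat_def)

lemma shape_of_record:
  assumes "x \<in> records p k A m"
  shows "map x [0..<p] = map real (shape_of p x)" "shape_of p x \<in> shapes p m"
proof -
  obtain \<sigma> where \<sigma>: "x = record_of p k A m \<sigma>" "\<forall>l<m. \<sigma> l < p" using assms unfolding records_def by blast
  have x: "x j = real (card {l. l < m \<and> \<sigma> l = j})" if "j < p" for j
    using record_shape[OF that] \<sigma> by simp
  then show "map x [0..<p] = map real (shape_of p x)" by (simp add: shape_of_def)
  have "sum_list (shape_of p x) = (\<Sum>j<p. card {l. l < m \<and> \<sigma> l = j})"
    using x by (simp add: shape_of_def interv_sum_list_conv_sum_set_nat lessThan_atLeast0)
  also have "\<dots> = card (\<Union>j<p. {l. l < m \<and> \<sigma> l = j})" by (subst card_UN_disjoint) auto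
  also have "(\<Union>j<p. {l. l < m \<and> \<sigma> l = j}) = {..<m}" using \<sigma>(2) by auto
  finally show "shape_of p x \<in> shapes p m" by (simp add: shapes_def shape_of_def)
qed

lemma to_matrix_record:
  "to_matrix k p (record_of p k A n \<sigma>)
    = partition_matrix k A (map (\<lambda>j. {l. l < n \<and> \<sigma> l = j}) [0..<p])"
  unfolding to_matrix_def partition_matrix_def
proof (intro ext)
  fix i j
  show "(if i < k \<and> j < p then record_of p k A n \<sigma> ((i + 1) * p + j) else 0)
    = (if i < k \<and> j < length (map (\<lambda>j. {l. l < n \<and> \<sigma> l = j}) [0..<p])
       then sum (A i) (map (\<lambda>j. {l. l < n \<and> \<sigma> l = j}) [0..<p] ! j) else 0)"
    using record_of_grid[of j p "i + 1" k A n \<sigma>] by (simp add: ahat_def)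
qed

lemma shape_of_record_of:
  "shape_of p (record_of p k A n \<sigma>) = shape (map (\<lambda>j. {l. l < n \<and> \<sigma> l = j}) [0..<p])"
  by (auto simp: shape_of_def shape_def record_shape)

text \<open>An ordered partition into \<open>p\<close> possibly empty sets is the same as a function that assigns to each
  column its class.\<close>

lemma partition_points:
  "{partition_matrix k A \<pi> | \<pi>. is_partition p n \<pi> \<and> shape \<pi> \<in> \<Lambda>}
    = to_matrix k p ` {x \<in> records p k A n. shape_of p x \<in> \<Lambda>}" (is "?L = ?R")
proof
  show "?L \<subseteq> ?R"
  proof
    fix V assume "V \<in> ?L"
    then obtain \<pi> where \<pi>: "V = partition_matrix k A \<pi>" "is_partition p n \<pi>" "shape \<pi> \<in> \<Lambda>" by blast
    have len: "length \<pi> = p" and dis: "\<And>i j. i < p \<Longrightarrow> j < p \<Longrightarrow> i \<noteq> j \<Longrightarrow> \<pi> ! i \<inter> \<pi> ! j = {}"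
      and un: "(\<Union>i<p. \<pi> ! i) = {..<n}" using \<pi>(2) unfolding is_partition_def by blast+
    have "\<forall>l\<in>{..<n}. \<exists>j. j < p \<and> l \<in> \<pi> ! j" using un by blast
    from bchoice[OF this] obtain \<sigma> where \<sigma>: "\<And>l. l < n \<Longrightarrow> \<sigma> l < p" "\<And>l. l < n \<Longrightarrow> l \<in> \<pi> ! \<sigma> l"
      by blast
    have "\<pi> ! j = {l. l < n \<and> \<sigma> l = j}" if "j < p" for j
    proof (intro set_eqI iffI)
      fix l assume l: "l \<in> \<pi> ! j"
      then have "l < n" using un that by blast
      then show "l \<in> {l. l < n \<and> \<sigma> l = j}" using dis[OF \<sigma>(1) that] \<sigma>(2) l by blast
    qed (use \<sigma> in auto)
    then have "\<pi> = map (\<lambda>j. {l. l < n \<and> \<sigma> l = j}) [0..<p]" using len by (intro nth_equalityI) auto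
    then have "V = to_matrix k p (record_of p k A n \<sigma>)" "shape_of p (record_of p k A n \<sigma>) \<in> \<Lambda>"
      using \<pi> by (simp_all add: to_matrix_record shape_of_record_of)
    moreover have "record_of p k A n \<sigma> \<in> records p k A n" using \<sigma> unfolding records_def by blast
    ultimately show "V \<in> ?R" by blast
  qed
  show "?R \<subseteq> ?L"
  proof
    fix V assume "V \<in> ?R"
    then obtain \<sigma> where \<sigma>: "V = to_matrix k p (record_of p k A n \<sigma>)" "\<forall>l<n. \<sigma> l < p"
      "shape_of p (record_of p k A n \<sigma>) \<in> \<Lambda>" unfolding records_def by blast
    let ?\<pi> = "map (\<lambda>j. {l. l < n \<and> \<sigma> l = j}) [0..<p]"
    have "is_partition p n ?\<pi>" using \<sigma>(2) unfolding is_partition_def by auto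
    then show "V \<in> ?L" using \<sigma> unfolding to_matrix_record shape_of_record_of by blast
  qed
qed

text \<open>Each element of \<open>S\<close> is the unique minimum of a functional over the hull, hence extreme; conversely
  an extreme point of the hull of \<open>S\<close> belongs to \<open>S\<close>.\<close>

lemma extreme_points_of_generated:
  fixes \<phi> :: "'a \<Rightarrow> 'a::real_vector \<Rightarrow> real"
  assumes "S \<subseteq> R" "R \<subseteq> convex hull S" "\<And>x. x \<in> S \<Longrightarrow> linear (\<phi> x)"
    and min: "\<And>x t. x \<in> S \<Longrightarrow> t \<in> S \<Longrightarrow> t \<noteq> x \<Longrightarrow> \<phi> x x < \<phi> x t"
  shows "{V. V extreme_point_of (convex hull R)} = S"
proof -
  have eq: "convex hull R = convex hull S"
    using assms(1,2) by (metis hull_hull hull_mono subset_antisym)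
  have "x extreme_point_of (convex hull S)" if x: "x \<in> S" for x
    unfolding extreme_point_of_def
  proof (intro conjI ballI notI)
    show "x \<in> convex hull S" using x by (rule hull_inc)
    fix a b assume ab: "a \<in> convex hull S" "b \<in> convex hull S" "x \<in> open_segment a b"
    then obtain u where u: "a \<noteq> b" "0 < u" "u < 1" "x = (1 - u) *\<^sub>R a + u *\<^sub>R b"
      unfolding in_segment by auto
    have lin: "linear (\<phi> x)" using assms(3) x by blast
    have h: "h = x \<or> \<phi> x x < \<phi> x h" if "h \<in> convex hull S" for h
      by (rule strict_minimum_on_hull[OF lin _ that]) (use min x in blast)
    have eqn: "\<phi> x x = (1 - u) * \<phi> x a + u * \<phi> x b"
      using arg_cong[OF u(4), of "\<phi> x"] lin by (simp add: linear_add linear_scale)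
    have ne: "a \<noteq> x" "b \<noteq> x"
    proof -
      have "a = b" if "a = x"
      proof -
        have "u *\<^sub>R (b - a) = 0" using u(4) that by (auto simp: algebra_simps)
        then show ?thesis using u(2,3) by simp
      qed
      moreover have "a = b" if "b = x"
      proof -
        have "(1 - u) *\<^sub>R (a - b) = 0" using u(4) that by (auto simp: algebra_simps)
        then show ?thesis using u(2,3) by simp
      qed
      ultimately show "a \<noteq> x" "b \<noteq> x" using u(1) by blast+
    qed
    then have "0 < (1 - u) * (\<phi> x a - \<phi> x x)" "0 < u * (\<phi> x b - \<phi> x x)"
      using h[OF ab(1)] h[OF ab(2)] u by auto
    then show False using eqn by (simp add: algebra_simps)
  qed
  then show ?thesis unfolding eq using extreme_point_of_convex_hull[of _ S] by auto
qed

definition from_matrix :: "nat \<Rightarrow> nat \<Rightarrow> matrix \<Rightarrow> nat \<Rightarrow> real" where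
  "from_matrix k p V = (\<lambda>c. if p \<le> c \<and> c < (k + 1) * p then V (c div p - 1) (c mod p) else 0)"

lemma from_to_matrix:
  assumes "0 < p" "\<And>c. c < p \<Longrightarrow> x c = 0" "\<And>c. (k + 1) * p \<le> c \<Longrightarrow> x c = 0"
  shows "from_matrix k p (to_matrix k p x) = x"
proof
  fix c
  show "from_matrix k p (to_matrix k p x) c = x c"
  proof (cases "p \<le> c \<and> c < (k + 1) * p")
    case True
    then obtain r j where c: "r < k + 1" "j < p" "c = r * p + j" using grid_cases by blast
    have "0 < r" using True c by (cases r) auto
    then show ?thesis using True c by (simp add: from_matrix_def to_matrix_def del: mult_Suc add_mult_distrib)
  next
    case False
    then show ?thesis using assms by (auto simp: from_matrix_def not_le not_less)
  qed
qed

text \<open>Once the shapes have served to select the records they are erased, so that records of different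
  shapes with the same matrix, or with one matrix in the hull of others, compete.\<close>

lemma vertices_of_polytope:
  assumes p: "0 < p" and gen: "generates p S (erase p ` {x \<in> records p k A n. shape_of p x \<in> \<Lambda>})"
    and irr: "irredundant p ((k + 1) * p) S"
  shows "vertices (shaped_partition_polytope p k n A \<Lambda>) = to_matrix k p ` S" "inj_on (to_matrix k p) S"
proof -
  let ?w = "(k + 1) * p" and ?R = "{x \<in> records p k A n. shape_of p x \<in> \<Lambda>}"
  let ?M = "to_matrix k p"
  have lin: "linear ?M" by (rule linearI) (auto simp: to_matrix_def fun_eq_iff)
  have lin': "linear (from_matrix k p)" by (rule linearI) (auto simp: from_matrix_def fun_eq_iff)
  have S: "S \<subseteq> erase p ` ?R" using gen unfolding generates_def by blast
  have zero: "x c = 0" if "x \<in> S" "c < p" for x c using S that by (auto simp: erase_def)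
  have outside: "x c = 0" if "x \<in> S" "?w \<le> c" for x c
  proof -
    have "x \<in> erase p ` ?R" using S that(1) by (rule subsetD)
    then obtain x' where x': "x' \<in> records p k A n" "x = erase p x'" by (elim imageE CollectE conjE) simp
    have "x' c = 0" using balanced_records[of p k A n] x' that(2) unfolding balanced_def by blast
    then show ?thesis by (simp add: x' erase_def)
  qed
  have ft: "from_matrix k p (?M x) = x" if "x \<in> S" for x
    using from_to_matrix[OF p] zero[OF that] outside[OF that] by blast
  then show inj: "inj_on ?M S" by (intro inj_on_inverseI[where g = "from_matrix k p"]) blast
  have erase_M: "?M (erase p x) = ?M x" for x
    by (auto simp: to_matrix_def erase_def fun_eq_iff)
  have img: "?M ` erase p ` ?R = ?M ` ?R" unfolding image_image erase_M ..
  have "?M ` ?R \<subseteq> convex hull (?M ` S)"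
  proof -
    have "erase p ` ?R \<subseteq> convex hull S"
    proof
      fix z assume "z \<in> erase p ` ?R"
      then have "z \<in> convex hull {t \<in> S. same_shape p t z}" using gen unfolding generates_def by blast
      then show "z \<in> convex hull S" using hull_mono[of "{t \<in> S. same_shape p t z}" S] by blast
    qed
    then show ?thesis using convex_hull_linear_image[OF lin, of S] img by blast
  qed
  moreover have "?M ` S \<subseteq> ?M ` ?R" using S img by blast
  moreover have "\<exists>\<phi>. linear \<phi> \<and> (\<forall>T\<in>?M ` S. T \<noteq> X \<longrightarrow> \<phi> X < (\<phi> T::real))" if "X \<in> ?M ` S" for X
  proof -
    from that obtain x where x: "X = ?M x" "x \<in> S" by (rule imageE)
    obtain y where y: "\<And>t. t \<in> S \<Longrightarrow> same_shape p t x \<Longrightarrow> t \<noteq> x \<Longrightarrow> 0 < dot ?w y (t - x)"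
      using irr x(2) unfolding irredundant_def separable_def by blast
    have "dot ?w y x < dot ?w y t" if "t \<in> S" "t \<noteq> x" for t
    proof -
      have "same_shape p t x" using zero[OF that(1)] zero[OF x(2)] by (simp add: same_shape_def)
      then show ?thesis using y[OF that(1) _ that(2)] by (simp add: dot_simps)
    qed
    then have "\<forall>T\<in>?M ` S. T \<noteq> X \<longrightarrow> (dot ?w y \<circ> from_matrix k p) X < (dot ?w y \<circ> from_matrix k p) T"
      using x ft by auto
    then show ?thesis using linear_compose[OF lin' linear_dot] by blast
  qed
  then have "\<forall>X\<in>?M ` S. \<exists>\<phi>. linear \<phi> \<and> (\<forall>T\<in>?M ` S. T \<noteq> X \<longrightarrow> \<phi> X < (\<phi> T::real))" by blast
  from bchoice[OF this] obtain \<phi> where "\<And>X. X \<in> ?M ` S \<Longrightarrow> linear (\<phi> X)"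
    "\<And>X T. X \<in> ?M ` S \<Longrightarrow> T \<in> ?M ` S \<Longrightarrow> T \<noteq> X \<Longrightarrow> \<phi> X X < (\<phi> X T::real)" by blast
  ultimately have "{V. V extreme_point_of (convex hull (?M ` ?R))} = ?M ` S"
    by (intro extreme_points_of_generated[of _ _ \<phi>]) auto
  then show "vertices (shaped_partition_polytope p k n A \<Lambda>) = ?M ` S"
    unfolding vertices_def shaped_partition_polytope_def partition_points .
qed

lemma generates_selected:
  assumes "generates p S (records p k A n)"
  shows "generates p (erase p ` {x \<in> S. shape_of p x \<in> \<Lambda>})
    (erase p ` {x \<in> records p k A n. shape_of p x \<in> \<Lambda>})"
  unfolding generates_def
proof (intro conjI ballI)
  show "erase p ` {x \<in> S. shape_of p x \<in> \<Lambda>} \<subseteq> erase p ` {x \<in> records p k A n. shape_of p x \<in> \<Lambda>}"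
    using assms unfolding generates_def by blast
  fix z assume "z \<in> erase p ` {x \<in> records p k A n. shape_of p x \<in> \<Lambda>}"
  then obtain x where x: "x \<in> records p k A n" "shape_of p x \<in> \<Lambda>" "z = erase p x" by blast
  have lin: "linear (erase p)" by (rule linearI) (auto simp: erase_def fun_eq_iff)
  have "x \<in> convex hull {t \<in> S. same_shape p t x}" using assms x(1) unfolding generates_def by blast
  then have "z \<in> convex hull (erase p ` {t \<in> S. same_shape p t x})"
    using convex_hull_linear_image[OF lin] x(3) by blast
  moreover have "erase p ` {t \<in> S. same_shape p t x} \<subseteq> {t \<in> erase p ` {x \<in> S. shape_of p x \<in> \<Lambda>}. same_shape p t z}"
  proof -
    have "shape_of p t = shape_of p x" if "same_shape p t x" for t
      using that by (simp add: shape_of_def same_shape_def)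
    then have "t \<in> {x \<in> S. shape_of p x \<in> \<Lambda>}" if "t \<in> S" "same_shape p t x" for t
      using that x(2) by (metis (mono_tags, lifting) mem_Collect_eq)
    moreover have "same_shape p (erase p t) z" for t unfolding x(3) same_shape_def erase_def by simp
    ultimately show ?thesis by blast
  qed
  ultimately show "z \<in> convex hull {t \<in> erase p ` {x \<in> S. shape_of p x \<in> \<Lambda>}. same_shape p t z}"
    using hull_mono by blast
qed

lemma balanced_erased:
  assumes "balanced p k R"
  shows "balanced p k (erase p ` R)"
proof -
  obtain s where s: "\<And>x r. x \<in> R \<Longrightarrow> r \<in> {1..k} \<Longrightarrow> (\<Sum>j<p. x (r * p + j)) = s r"
    using assms unfolding balanced_def by blast
  have "(\<Sum>j<p. erase p x (r * p + j)) = s r" if "x \<in> R" "r \<in> {1..k}" for x r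
  proof -
    have "1 * p \<le> r * p" using that(2) by (intro mult_le_mono1) simp
    then have "\<not> r * p + j < p" for j by linarith
    then have "erase p x (r * p + j) = x (r * p + j)" for j unfolding erase_def by (simp only: if_False)
    then show ?thesis using s[OF that] by simp
  qed
  moreover have "x c = 0" if "x \<in> R" "(k + 1) * p \<le> c" for x c
    using assms that unfolding balanced_def by blast
  ultimately show ?thesis unfolding balanced_def by (auto simp: erase_def)
qed

section \<open>Weakest preconditions\<close>

type_synonym regs = "nat \<Rightarrow> real"
type_synonym arrs = "nat \<Rightarrow> nat \<Rightarrow> real"

text \<open>The postcondition speaks of the counted steps, of the output and of the final state. The set \<open>G\<close>
  contains the numbers that may be written. With \<open>G = UNIV\<close> this is plain correctness; a set of
  fractions of bounded size turns the same proofs into a bound for the bit sizes.\<close>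

definition wp :: "oracle_fun \<Rightarrow> real set \<Rightarrow> program
    \<Rightarrow> (nat \<Rightarrow> real list \<Rightarrow> regs \<Rightarrow> arrs \<Rightarrow> bool) \<Rightarrow> regs \<Rightarrow> arrs \<Rightarrow> bool" where
  "wp orc G c Q R M \<longleftrightarrow> (\<exists>t R' M'. exec orc c (R, M) t (R', M') \<and> numbers t \<subseteq> G
     \<and> Q (operations t) (printed t) R' M')"

lemma trace_simps [simp]:
  "operations [] = 0" "operations (t @ u) = operations t + operations u"
  "operations (Calculated v # t) = Suc (operations t)" "operations (Compared # t) = Suc (operations t)"
  "operations (Queried v # t) = Suc (operations t)" "operations (Moved v # t) = operations t"
  "operations (Printed v # t) = operations t"
  "printed [] = []" "printed (t @ u) = printed t @ printed u"
  "printed (Calculated v # t) = printed t" "printed (Compared # t) = printed t"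
  "printed (Queried v # t) = printed t" "printed (Moved v # t) = printed t"
  "printed (Printed v # t) = v # printed t"
  "numbers [] = {}" "numbers (t @ u) = numbers t \<union> numbers u"
  "numbers (e # t) = numbers_of e \<union> numbers t"
  by (simp_all add: operations_def printed_def numbers_def)

lemma wp_basic:
  "wp orc G Skip Q R M \<longleftrightarrow> Q 0 [] R M"
  "wp orc G (Const x c) Q R M \<longleftrightarrow> of_int c \<in> G \<and> Q 0 [] (R(x := of_int c)) M"
  "wp orc G (Copy x y) Q R M \<longleftrightarrow> R y \<in> G \<and> Q 0 [] (R(x := R y)) M"
  "wp orc G (Load x a y) Q R M \<longleftrightarrow> (\<exists>i. R y = real i \<and> M a i \<in> G \<and> Q 0 [] (R(x := M a i)) M)"
  "wp orc G (Store a y z) Q R M \<longleftrightarrow> (\<exists>i. R y = real i \<and> R z \<in> G \<and> Q 0 [] R (M(a := (M a)(i := R z))))"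
  "wp orc G (Output x) Q R M \<longleftrightarrow> R x \<in> G \<and> Q 0 [R x] R M"
  unfolding wp_def by (fastforce elim: exec_cases intro: exec.intros)+

lemma wp_Arith:
  "wp orc G (Arith f x y z) Q R M \<longleftrightarrow> (f = Divide \<longrightarrow> R z \<noteq> 0) \<and> arith_val f (R y) (R z) \<in> G
     \<and> Q 1 [] (R(x := arith_val f (R y) (R z))) M"
  unfolding wp_def by (fastforce elim: exec_cases intro: exec.intros)

lemma wp_Query:
  assumes "R y = real m" "map (M a) [0..<m] = map real l" "orc l = Some b" "of_bool b \<in> G"
    "Q 1 [] (R(x := of_bool b)) M"
  shows "wp orc G (Query x a y) Q R M"
  unfolding wp_def using exec.Query[of R y m M a l orc b x] assms by fastforce

lemma wp_Seq:
  "wp orc G (Seq c d) Q R M \<longleftrightarrow>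
     wp orc G c (\<lambda>k o1 R' M'. wp orc G d (\<lambda>l o2. Q (k + l) (o1 @ o2)) R' M') R M"
proof
  assume "wp orc G (Seq c d) Q R M"
  then obtain t R' M' where t: "exec orc (Seq c d) (R, M) t (R', M')" "numbers t \<subseteq> G"
    "Q (operations t) (printed t) R' M'" unfolding wp_def by blast
  from t(1) show "wp orc G c (\<lambda>k o1 R' M'. wp orc G d (\<lambda>l o2. Q (k + l) (o1 @ o2)) R' M') R M"
  proof (rule exec_cases(9))
    fix t1 s t2 assume "t = t1 @ t2" "exec orc c (R, M) t1 s" "exec orc d s t2 (R', M')"
    then show ?thesis using t(2,3) unfolding wp_def by (cases s) fastforce
  qed
next
  assume "wp orc G c (\<lambda>k o1 R' M'. wp orc G d (\<lambda>l o2. Q (k + l) (o1 @ o2)) R' M') R M"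
  then obtain t R' M' u R'' M'' where "exec orc c (R, M) t (R', M')" "numbers t \<subseteq> G"
    "exec orc d (R', M') u (R'', M'')" "numbers u \<subseteq> G"
    "Q (operations t + operations u) (printed t @ printed u) R'' M''" unfolding wp_def by blast
  then show "wp orc G (Seq c d) Q R M"
    unfolding wp_def by (intro exI[of _ "t @ u"] exI[of _ R''] exI[of _ M'']) (auto intro: exec.Seq)
qed

lemma wp_If:
  "wp orc G (If b c d) Q R M \<longleftrightarrow>
     (if holds b R then wp orc G c (\<lambda>k. Q (Suc k)) R M else wp orc G d (\<lambda>k. Q (Suc k)) R M)"
proof (cases "holds b R")
  case True
  then have "exec orc (If b c d) (R, M) t s \<longleftrightarrow> (\<exists>u. t = Compared # u \<and> exec orc c (R, M) u s)" for t s
    by (auto elim: exec_cases(10) intro: exec.IfTrue)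
  then show ?thesis using True unfolding wp_def by fastforce
next
  case False
  then have "exec orc (If b c d) (R, M) t s \<longleftrightarrow> (\<exists>u. t = Compared # u \<and> exec orc d (R, M) u s)" for t s
    by (auto elim: exec_cases(10) intro: exec.IfFalse)
  then show ?thesis using False unfolding wp_def by fastforce
qed

lemmas wp_simps = wp_basic wp_Arith wp_Seq wp_If

lemma wp_mono:
  "wp orc G c P R M \<Longrightarrow> (\<And>k out R' M'. P k out R' M' \<Longrightarrow> Q k out R' M') \<Longrightarrow> wp orc G c Q R M"
  unfolding wp_def by blast

primrec written_regs :: "program \<Rightarrow> nat set" where
  "written_regs Skip = {}"
| "written_regs (Const x c) = {x}"
| "written_regs (Copy x y) = {x}"
| "written_regs (Arith f x y z) = {x}"
| "written_regs (Load x a y) = {x}"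
| "written_regs (Store a y z) = {}"
| "written_regs (Query x a y) = {x}"
| "written_regs (Output x) = {}"
| "written_regs (Seq c d) = written_regs c \<union> written_regs d"
| "written_regs (If b c d) = written_regs c \<union> written_regs d"
| "written_regs (While b c) = written_regs c"

primrec written_arrs :: "program \<Rightarrow> nat set" where
  "written_arrs Skip = {}"
| "written_arrs (Const x c) = {}"
| "written_arrs (Copy x y) = {}"
| "written_arrs (Arith f x y z) = {}"
| "written_arrs (Load x a y) = {}"
| "written_arrs (Store a y z) = {a}"
| "written_arrs (Query x a y) = {}"
| "written_arrs (Output x) = {}"
| "written_arrs (Seq c d) = written_arrs c \<union> written_arrs d"
| "written_arrs (If b c d) = written_arrs c \<union> written_arrs d"
| "written_arrs (While b c) = written_arrs c"

text \<open>Frame conditions are read off from the program text, so invariants of loops only mention what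
  changes.\<close>

lemma exec_frame:
  "exec orc c s t s' \<Longrightarrow> (\<forall>x. x \<notin> written_regs c \<longrightarrow> fst s' x = fst s x)
     \<and> (\<forall>a. a \<notin> written_arrs c \<longrightarrow> snd s' a = snd s a)"
  by (induction rule: exec.induct) auto

lemma wp_frame:
  assumes "wp orc G c P R M"
    and "\<And>k out R' M'. P k out R' M' \<Longrightarrow> (\<And>x. x \<notin> written_regs c \<Longrightarrow> R' x = R x)
      \<Longrightarrow> (\<And>a. a \<notin> written_arrs c \<Longrightarrow> M' a = M a) \<Longrightarrow> Q k out R' M'"
  shows "wp orc G c Q R M"
proof -
  obtain t R' M' where t: "exec orc c (R, M) t (R', M')" "numbers t \<subseteq> G"
    "P (operations t) (printed t) R' M'" using assms(1) unfolding wp_def by blast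
  have "Q (operations t) (printed t) R' M'"
    using assms(2)[OF t(3)] exec_frame[OF t(1)] by simp
  then show ?thesis using t unfolding wp_def by blast
qed

abbreviation seq :: "program \<Rightarrow> program \<Rightarrow> program" (infixr ";;" 55) where
  "c ;; d \<equiv> Seq c d"

text \<open>Register 3 always contains \<open>1\<close>.\<close>

definition For :: "nat \<Rightarrow> nat \<Rightarrow> program \<Rightarrow> program" where
  "For x b c = Seq (Const x 0) (While (Less x b) (Seq c (Arith Plus x x 3)))"

lemma written_For [simp]:
  "written_regs (For x b c) = insert x (written_regs c)" "written_arrs (For x b c) = written_arrs c"
  by (auto simp: For_def)

lemma wp_While_step:
  assumes "holds b R" "wp orc G c (\<lambda>k o1 R' M'. wp orc G (While b c) (\<lambda>l o2. Q (Suc (k + l)) (o1 @ o2)) R' M') R M"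
  shows "wp orc G (While b c) Q R M"
proof -
  obtain t R' M' u R'' M'' where *: "exec orc c (R, M) t (R', M')" "numbers t \<subseteq> G"
    "exec orc (While b c) (R', M') u (R'', M'')" "numbers u \<subseteq> G"
    "Q (Suc (operations t + operations u)) (printed t @ printed u) R'' M''"
    using assms(2) unfolding wp_def by blast
  have "exec orc (While b c) (R, M) (Compared # t @ u) (R'', M'')"
    using assms(1) * by (intro exec.WhileTrue) auto
  then show ?thesis using * unfolding wp_def
    by (intro exI[of _ "Compared # t @ u"] exI[of _ R''] exI[of _ M'']) auto
qed

lemma wp_While_end:
  assumes "\<not> holds b R" "Q 1 [] R M"
  shows "wp orc G (While b c) Q R M"
  using assms exec.WhileFalse[of b "(R, M)" orc c] unfolding wp_def
  by (intro exI[of _ "[Compared]"] exI[of _ R] exI[of _ M]) auto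

text \<open>Each round costs at most \<open>K\<close> steps for the body and two for the comparison and the increment of the
  counter.\<close>

lemma wp_For:
  assumes b: "R b = real m" and one: "R 3 = 1"
    and dist: "x \<noteq> b" "x \<noteq> 3" "x \<notin> written_regs c" "b \<notin> written_regs c" "3 \<notin> written_regs c"
    and G: "\<And>i. i \<le> m \<Longrightarrow> real i \<in> G"
    and init: "I 0 (R(x := 0)) M"
    and step: "\<And>i R' M'. i < m \<Longrightarrow> R' x = real i
      \<Longrightarrow> (\<And>y. y \<noteq> x \<Longrightarrow> y \<notin> written_regs c \<Longrightarrow> R' y = R y)
      \<Longrightarrow> (\<And>a. a \<notin> written_arrs c \<Longrightarrow> M' a = M a) \<Longrightarrow> I i R' M'
      \<Longrightarrow> wp orc G c (\<lambda>k out R'' M''. k \<le> K \<and> out = f i \<and> I (Suc i) (R''(x := real (Suc i))) M'') R' M'"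
    and Q: "\<And>k out R' M'. k \<le> m * (K + 2) + 1 \<Longrightarrow> out = concat (map f [0..<m])
      \<Longrightarrow> (\<And>y. y \<noteq> x \<Longrightarrow> y \<notin> written_regs c \<Longrightarrow> R' y = R y)
      \<Longrightarrow> (\<And>a. a \<notin> written_arrs c \<Longrightarrow> M' a = M a) \<Longrightarrow> I m R' M' \<Longrightarrow> Q k out R' M'"
  shows "wp orc G (For x b c) Q R M"
proof -
  let ?W = "While (Less x b) (Seq c (Arith Plus x x 3))"
  let ?fr = "\<lambda>R' M'. (\<forall>y. y \<noteq> x \<longrightarrow> y \<notin> written_regs c \<longrightarrow> R' y = R y)
    \<and> (\<forall>a. a \<notin> written_arrs c \<longrightarrow> M' a = M a)"
  have loop: "wp orc G ?W (\<lambda>k out R'' M''. k \<le> (m - i) * (K + 2) + 1 \<and> out = concat (map f [i..<m])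
      \<and> ?fr R'' M'' \<and> I m R'' M'') R' M'"
    if "i \<le> m" "R' x = real i" "?fr R' M'" "I i R' M'" for i R' M'
    using that
  proof (induction "m - i" arbitrary: i R' M')
    case 0
    then have "i = m" by simp
    moreover have "R' b = real m" using 0 b dist by simp
    ultimately show ?case using 0 by (intro wp_While_end) auto
  next
    case (Suc d)
    then have i: "i < m" by simp
    have R'b: "R' b = real m" "R' 3 = 1" using Suc.prems b one dist by simp_all
    have "wp orc G c (\<lambda>k out R'' M''. k \<le> K \<and> out = f i \<and> I (Suc i) (R''(x := real (Suc i))) M'') R' M'"
      by (rule step) (use i Suc.prems in auto)
    then have body: "wp orc G (Seq c (Arith Plus x x 3)) (\<lambda>k out R'' M''. k \<le> Suc K \<and> out = f i
        \<and> I (Suc i) R'' M'' \<and> R'' x = real (Suc i) \<and> ?fr R'' M'') R' M'"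
      unfolding wp_Seq
    proof (rule wp_frame)
      fix k out R'' M''
      assume *: "k \<le> K \<and> out = f i \<and> I (Suc i) (R''(x := real (Suc i))) M''"
        and fr: "\<And>x. x \<notin> written_regs c \<Longrightarrow> R'' x = R' x" "\<And>a. a \<notin> written_arrs c \<Longrightarrow> M'' a = M' a"
      have "R'' x = real i" "R'' 3 = 1" using fr dist Suc.prems R'b by simp_all
      then have eq: "R'' x + R'' 3 = real (Suc i)" by simp
      have "real (Suc i) \<in> G" using G[of "Suc i"] i by simp
      then show "wp orc G (Arith Plus x x 3) (\<lambda>l o2 R''a M''a. k + l \<le> Suc K \<and> out @ o2 = f i
          \<and> I (Suc i) R''a M''a \<and> R''a x = real (Suc i) \<and> ?fr R''a M''a) R'' M''"
        unfolding wp_Arith arith_val.simps eq using * fr Suc.prems(3) by simp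
    qed
    show ?case
    proof (rule wp_While_step)
      show "holds (Less x b) R'" using Suc.prems R'b i by simp
      show "wp orc G (Seq c (Arith Plus x x 3)) (\<lambda>k o1 R' M'. wp orc G ?W (\<lambda>l o2 R'' M''.
          Suc (k + l) \<le> (m - i) * (K + 2) + 1 \<and> o1 @ o2 = concat (map f [i..<m]) \<and> ?fr R'' M'' \<and> I m R'' M'') R' M') R' M'"
      proof (rule wp_mono[OF body])
        fix k out R'' M''
        assume *: "k \<le> Suc K \<and> out = f i \<and> I (Suc i) R'' M'' \<and> R'' x = real (Suc i) \<and> ?fr R'' M''"
        have "wp orc G ?W (\<lambda>k out R'' M''. k \<le> (m - Suc i) * (K + 2) + 1
            \<and> out = concat (map f [Suc i..<m]) \<and> ?fr R'' M'' \<and> I m R'' M'') R'' M''"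
          by (rule Suc.hyps(1)) (use Suc.hyps(2) i * in auto)
        then show "wp orc G ?W (\<lambda>l o2 R'' M''.
          Suc (k + l) \<le> (m - i) * (K + 2) + 1 \<and> out @ o2 = concat (map f [i..<m]) \<and> ?fr R'' M'' \<and> I m R'' M'') R'' M''"
        proof (rule wp_mono)
          fix l o2 Ra Ma
          assume **: "l \<le> (m - Suc i) * (K + 2) + 1 \<and> o2 = concat (map f [Suc i..<m]) \<and> ?fr Ra Ma \<and> I m Ra Ma"
          have "m - i = Suc (m - Suc i)" using i by simp
          define X where "X = (m - Suc i) * (K + 2)"
          have "(m - i) * (K + 2) = K + 2 + X" unfolding X_def \<open>m - i = _\<close> by simp
          moreover have "l \<le> X + 1" using ** unfolding X_def by (elim conjE)
          ultimately have "Suc (k + l) \<le> (m - i) * (K + 2) + 1" using * by linarith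
          then show "Suc (k + l) \<le> (m - i) * (K + 2) + 1 \<and> out @ o2 = concat (map f [i..<m]) \<and> ?fr Ra Ma \<and> I m Ra Ma"
            using * ** i by (simp add: upt_conv_Cons del: add_2_eq_Suc')
        qed
      qed
    qed
  qed
  have "wp orc G ?W (\<lambda>k out R'' M''. k \<le> (m - 0) * (K + 2) + 1 \<and> out = concat (map f [0..<m])
      \<and> ?fr R'' M'' \<and> I m R'' M'') (R(x := 0)) M"
    by (rule loop) (use init in auto)
  then have "wp orc G ?W Q (R(x := 0)) M" by (rule wp_mono) (use Q in auto)
  moreover have "(0::real) \<in> G" using G[of 0] by simp
  ultimately show ?thesis unfolding For_def wp_Seq wp_basic by simp
qed

lemma concat_map_Nil [simp]: "concat (map (\<lambda>_. []) xs) = []"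
  by (induction xs) simp_all

lemma wp_For_silent:
  assumes "R b = real m" "R 3 = 1"
    and "x \<noteq> b" "x \<noteq> 3" "x \<notin> written_regs c" "b \<notin> written_regs c" "3 \<notin> written_regs c"
    and "\<And>i. i \<le> m \<Longrightarrow> real i \<in> G"
    and "I 0 (R(x := 0)) M"
    and "\<And>i R' M'. i < m \<Longrightarrow> R' x = real i
      \<Longrightarrow> (\<And>y. y \<noteq> x \<Longrightarrow> y \<notin> written_regs c \<Longrightarrow> R' y = R y)
      \<Longrightarrow> (\<And>a. a \<notin> written_arrs c \<Longrightarrow> M' a = M a) \<Longrightarrow> I i R' M'
      \<Longrightarrow> wp orc G c (\<lambda>k out R'' M''. k \<le> K \<and> out = [] \<and> I (Suc i) (R''(x := real (Suc i))) M'') R' M'"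
    and "\<And>k R' M'. k \<le> m * (K + 2) + 1
      \<Longrightarrow> (\<And>y. y \<noteq> x \<Longrightarrow> y \<notin> written_regs c \<Longrightarrow> R' y = R y)
      \<Longrightarrow> (\<And>a. a \<notin> written_arrs c \<Longrightarrow> M' a = M a) \<Longrightarrow> I m R' M' \<Longrightarrow> Q k [] R' M'"
  shows "wp orc G (For x b c) Q R M"
  by (rule wp_For[where f = "\<lambda>_. []" and I = I and K = K and m = m, OF assms(1-10)])
    (simp_all add: assms(11))

section \<open>Rows of vectors in memory\<close>

text \<open>Arrays are one-dimensional; row \<open>r\<close> of the array \<open>f\<close> is stored from position \<open>r * w\<close> on.\<close>

definition mrow :: "nat \<Rightarrow> (nat \<Rightarrow> real) \<Rightarrow> nat \<Rightarrow> nat \<Rightarrow> real" where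
  "mrow w f r = (\<lambda>c. if c < w then f (r * w + c) else 0)"

lemma mrow_apply: "c < w \<Longrightarrow> mrow w f r c = f (r * w + c)"
  by (simp add: mrow_def)

lemma index_unique: "c < w \<Longrightarrow> c' < w \<Longrightarrow> r * w + c = r' * w + c' \<longleftrightarrow> r = r' \<and> c = (c'::nat)"
  by (metis div_mult_self3 mod_mult_self3 add.commute div_less mod_less add_0 less_nat_zero_code)

lemma mrow_store:
  "c < w \<Longrightarrow> mrow w (f(t * w + c := v)) r = (if r = t then (mrow w f r)(c := v) else mrow w f r)"
  by (auto simp: mrow_def fun_eq_iff index_unique)

text \<open>The only vector operation of the algorithm: row \<open>t\<close> of array \<open>dst\<close> becomes the combination of
  row \<open>a\<close> of \<open>s1\<close> with factor \<open>al\<close> and of row \<open>b\<close> of \<open>s2\<close> with factor \<open>- be\<close>. The indices and factors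
  are given by registers. Copies and differences of rows are the cases with factors \<open>0\<close> and \<open>1\<close>.

  The programs below share the following allocation. Registers: 0, 1, 2 contain \<open>p\<close>, \<open>k\<close>, \<open>n\<close>; 3, 4, 5
  contain \<open>1\<close>, \<open>0\<close>, \<open>- 1\<close>; 6 contains the length \<open>w\<close> of a record; 7 contains the length of the tuples
  in the redundancy test; 8 and 9 contain the numbers of rows in the arrays 1 and 2; 10 contains the
  number of the current column. Arrays: 0 contains the matrix, 1 the records that were kept, 2 the
  candidates, 3 the increments of the current column, 4 the record under test, 5 the indices of the
  current tuple, 6 and 7 the vectors before and after an elimination step, 8 the shape submitted to
  the oracle.\<close>

definition comb :: "nat \<Rightarrow> nat \<Rightarrow> nat \<Rightarrow> nat \<Rightarrow> nat \<Rightarrow> nat \<Rightarrow> nat \<Rightarrow> nat \<Rightarrow> program" where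
  "comb dst t al s1 a be s2 b = For 40 6 (
     Arith Times 41 a 6 ;; Arith Plus 41 41 40 ;; Load 42 s1 41 ;; Arith Times 42 al 42 ;;
     Arith Times 43 b 6 ;; Arith Plus 43 43 40 ;; Load 44 s2 43 ;; Arith Times 44 be 44 ;;
     Arith Minus 42 42 44 ;; Arith Times 41 t 6 ;; Arith Plus 41 41 40 ;; Store dst 41 42)"

lemma written_comb [simp]:
  "written_regs (comb dst t al s1 a be s2 b) = {40, 41, 42, 43, 44}"
  "written_arrs (comb dst t al s1 a be s2 b) = {dst}"
  by (auto simp: comb_def)

lemma wp_comb:
  assumes regs: "R 3 = 1" "R 6 = real w" "R t = real tn" "R a = real an" "R b = real bn"
    and dist: "{t, a, b, al, be} \<inter> {40, 41, 42, 43, 44} = {}" "dst \<noteq> s1" "dst \<noteq> s2"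
    and G: "\<And>i. i \<le> tn * w + w \<Longrightarrow> real i \<in> G" "\<And>i. i \<le> an * w + w \<Longrightarrow> real i \<in> G"
      "\<And>i. i \<le> bn * w + w \<Longrightarrow> real i \<in> G"
    and val: "\<And>c. c < w \<Longrightarrow> mrow w (M s1) an c \<in> G" "\<And>c. c < w \<Longrightarrow> mrow w (M s2) bn c \<in> G"
      "\<And>c. c < w \<Longrightarrow> R al * mrow w (M s1) an c \<in> G" "\<And>c. c < w \<Longrightarrow> R be * mrow w (M s2) bn c \<in> G"
      "\<And>c. c < w \<Longrightarrow> R al * mrow w (M s1) an c - R be * mrow w (M s2) bn c \<in> G"
    and Q: "\<And>k R' M'. k \<le> 12 * w + 1 \<Longrightarrow> (\<And>x. x \<notin> {40, 41, 42, 43, 44} \<Longrightarrow> R' x = R x)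
      \<Longrightarrow> (\<And>d. d \<noteq> dst \<Longrightarrow> M' d = M d)
      \<Longrightarrow> (\<And>r. mrow w (M' dst) r = (if r = tn then R al *\<^sub>R mrow w (M s1) an - R be *\<^sub>R mrow w (M s2) bn
            else mrow w (M dst) r)) \<Longrightarrow> Q k [] R' M'"
  shows "wp orc G (comb dst t al s1 a be s2 b) Q R M"
  unfolding comb_def
proof (rule wp_For[where m = w and K = 10 and f = "\<lambda>_. []" and
    I = "\<lambda>i R' M'. \<forall>r c. c < w \<longrightarrow> M' dst (r * w + c) = (if r = tn \<and> c < i
      then R al * M s1 (an * w + c) - R be * M s2 (bn * w + c) else M dst (r * w + c))"], goal_cases)
  case (10 i R' M')
  have e: "R' 40 = real i" "R' 6 = real w" "R' t = real tn" "R' a = real an" "R' b = real bn" "R' al = R al" "R' be = R be"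
    using 10(2) 10(3)[of 6] 10(3)[of t] 10(3)[of a] 10(3)[of b] 10(3)[of al] 10(3)[of be] dist regs by auto
  have m: "M' s1 = M s1" "M' s2 = M s2" using 10(4) dist by auto
  have i: "i < w" using 10(1) .
  have "real (an * w) \<in> G" "real (an * w + i) \<in> G" by (rule G(2), use i in simp)+
  moreover have "real (bn * w) \<in> G" "real (bn * w + i) \<in> G" by (rule G(3), use i in simp)+
  moreover have "real (tn * w) \<in> G" "real (tn * w + i) \<in> G" by (rule G(1), use i in simp)+
  ultimately have g: "real an * real w \<in> G" "real an * real w + real i \<in> G" "real bn * real w \<in> G"
    "real bn * real w + real i \<in> G" "real tn * real w \<in> G" "real tn * real w + real i \<in> G" by simp_all
  have ix: "real x * real w + real i = real y \<longleftrightarrow> y = x * w + i" for x y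
    by (metis of_nat_add of_nat_mult of_nat_eq_iff)
  have v: "M s1 (an * w + i) \<in> G" "M s2 (bn * w + i) \<in> G" "R al * M s1 (an * w + i) \<in> G"
    "R be * M s2 (bn * w + i) \<in> G" "R al * M s1 (an * w + i) - R be * M s2 (bn * w + i) \<in> G"
    using val[OF i] i by (simp_all add: mrow_apply)
  have ne: "t \<noteq> 40" "t \<noteq> 41" "t \<noteq> 42" "t \<noteq> 43" "t \<noteq> 44" "a \<noteq> 40" "a \<noteq> 41" "a \<noteq> 42" "a \<noteq> 43" "a \<noteq> 44"
    "b \<noteq> 40" "b \<noteq> 41" "b \<noteq> 42" "b \<noteq> 43" "b \<noteq> 44" "al \<noteq> 40" "al \<noteq> 41" "al \<noteq> 42" "al \<noteq> 43" "al \<noteq> 44"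
    "be \<noteq> 40" "be \<noteq> 41" "be \<noteq> 42" "be \<noteq> 43" "be \<noteq> 44" using dist(1) by auto
  show ?case
    unfolding wp_simps by (simp add: ne e m g v ix)
      (use 10(5) i in \<open>auto simp: index_unique less_Suc_eq\<close>)
next
  case (11 k out R' M')
  have "mrow w (M' dst) r = (if r = tn then R al *\<^sub>R mrow w (M s1) an - R be *\<^sub>R mrow w (M s2) bn
            else mrow w (M dst) r)" for r
    using 11(5) by (auto simp: mrow_def fun_eq_iff)
  then show ?case using 11 Q[of k R' M'] by (auto simp: insert_commute)
qed (use regs G(1) in auto)

section \<open>Programming the elimination\<close>

definition append_row :: "nat \<Rightarrow> nat \<Rightarrow> program" where
  "append_row al be = comb 7 22 al 6 24 be 6 23 ;; Arith Plus 22 22 3"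

text \<open>Register 21 contains the coordinate to be eliminated, registers 23 and 24 contain the indices of two
  rows. A row that is zero at the coordinate is kept when it is paired with itself.\<close>

definition pair_step :: program where
  "pair_step =
     Arith Times 25 23 6 ;; Arith Plus 25 25 21 ;; Load 25 6 25 ;;
     Arith Times 26 24 6 ;; Arith Plus 26 26 21 ;; Load 26 6 26 ;;
     If (Equal 23 24) (If (Equal 25 4) (append_row 3 4) Skip)
       (If (LessEq 0 21) (If (Less 4 25) (If (Less 26 4) (append_row 25 26) Skip) Skip) Skip)"

definition elim_step :: program where
  "elim_step = Const 22 0 ;; For 23 20 (For 24 20 pair_step) ;;
     For 23 22 (comb 6 23 3 7 23 4 7 23) ;; Copy 20 22"

definition elim_all :: program where
  "elim_all = For 21 6 elim_step"

lemma written_elim [simp]: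
  "written_regs (append_row al be) = {22, 40, 41, 42, 43, 44}"
  "written_arrs (append_row al be) = {7}"
  "written_regs pair_step = {22, 25, 26, 40, 41, 42, 43, 44}"
  "written_arrs pair_step = {7}"
  "written_regs elim_step = {20, 22, 23, 24, 25, 26, 40, 41, 42, 43, 44}"
  "written_arrs elim_step = {6, 7}"
  "written_regs elim_all = {20, 21, 22, 23, 24, 25, 26, 40, 41, 42, 43, 44}"
  "written_arrs elim_all = {6, 7}"
  by (auto simp: append_row_def pair_step_def elim_step_def elim_all_def)

definition contribution ::
    "nat \<Rightarrow> nat \<Rightarrow> (nat \<Rightarrow> nat \<Rightarrow> real) \<Rightarrow> nat \<Rightarrow> nat \<Rightarrow> (nat \<Rightarrow> real) set" where
  "contribution p c Y a b =
     (if a = b then (if Y a c = 0 then {Y b} else {})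
      else if p \<le> c \<and> 0 < Y a c \<and> Y b c < 0 then {Y a c *\<^sub>R Y b - Y b c *\<^sub>R Y a} else {})"

lemma contributions:
  "(\<Union>a<N. \<Union>b<N. contribution p c Y a b)
    = (if c < p then {u \<in> Y ` {..<N}. u c = 0} else eliminate c (Y ` {..<N}))" (is "?L = ?R")
proof
  show "?L \<subseteq> ?R"
    by (fastforce simp: contribution_def eliminate_def split: if_splits)
  show "?R \<subseteq> ?L"
  proof
    fix u assume u: "u \<in> ?R"
    have zero: "u \<in> ?L" if "u \<in> Y ` {..<N}" "u c = 0"
      using that by (auto simp: contribution_def intro!: bexI)
    show "u \<in> ?L"
    proof (cases "c < p")
      case True
      then show ?thesis using u zero by auto
    next
      case False
      then consider "u \<in> Y ` {..<N}" "u c = 0" |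
        a b where "a < N" "b < N" "u = Y a c *\<^sub>R Y b - Y b c *\<^sub>R Y a" "0 < Y a c" "Y b c < 0"
        using u by (auto simp: eliminate_def)
      then show ?thesis
      proof cases
        case 2
        then have "u \<in> contribution p c Y a b" using False by (auto simp: contribution_def)
        then show ?thesis using 2(1,2) by blast
      qed (rule zero)
    qed
  qed
qed

text \<open>The numbers in the vectors are organised in levels: an operation \<open>a * b - c * d\<close> on level \<open>i\<close> leads to
  level \<open>i + 1\<close>. Records have level \<open>0\<close>, their differences level \<open>1\<close>, and each elimination step adds one
  level. All indices and counters are at most \<open>B\<close>.\<close>

locale machine =
  fixes orc :: oracle_fun and G :: "real set" and B :: nat and D :: "nat \<Rightarrow> real set" and w p :: nat
  assumes p_pos: "0 < p" and p_w: "p \<le> w"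
    and nat_G: "i \<le> B \<Longrightarrow> real i \<in> G"
    and D_G: "i \<le> w + 2 \<Longrightarrow> D i \<subseteq> G"
    and D_comb: "\<lbrakk>a \<in> D i; b \<in> D i; c \<in> D i; d \<in> D i\<rbrakk> \<Longrightarrow> a * b - c * d \<in> D (Suc i)"
    and D_consts: "0 \<in> D i" "1 \<in> D i" "- 1 \<in> D i"
begin

lemma D_Suc: "a \<in> D i \<Longrightarrow> a \<in> D (Suc i)"
  using D_comb[of a i 1 0 0] D_consts by simp

lemma D_times: "a \<in> D i \<Longrightarrow> b \<in> D i \<Longrightarrow> a * b \<in> D (Suc i)"
  using D_comb[of a i b 0 0] D_consts by simp

lemma in_G: "a \<in> D i \<Longrightarrow> i \<le> w + 2 \<Longrightarrow> a \<in> G"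
  using D_G by blast

definition over :: "nat \<Rightarrow> (nat \<Rightarrow> real) \<Rightarrow> bool" where
  "over i x \<longleftrightarrow> (\<forall>c<w. x c \<in> D i)"

lemma wp_comb_over:
  assumes regs: "R 3 = 1" "R 6 = real w" "R t = real tn" "R a = real an" "R b = real bn"
    and dist: "{t, a, b, al, be} \<inter> {40, 41, 42, 43, 44} = {}" "dst \<noteq> s1" "dst \<noteq> s2"
    and B: "tn * w + w \<le> B" "an * w + w \<le> B" "bn * w + w \<le> B"
    and val: "over i (mrow w (M s1) an)" "over i (mrow w (M s2) bn)" "R al \<in> D i" "R be \<in> D i" "i \<le> Suc w"
    and Q: "\<And>k R' M'. k \<le> 12 * w + 1 \<Longrightarrow> (\<And>x. x \<notin> {40, 41, 42, 43, 44} \<Longrightarrow> R' x = R x)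
      \<Longrightarrow> (\<And>d. d \<noteq> dst \<Longrightarrow> M' d = M d)
      \<Longrightarrow> (\<And>r. mrow w (M' dst) r = (if r = tn then R al *\<^sub>R mrow w (M s1) an - R be *\<^sub>R mrow w (M s2) bn
            else mrow w (M dst) r)) \<Longrightarrow> Q k [] R' M'"
  shows "wp orc G (comb dst t al s1 a be s2 b) Q R M"
proof (rule wp_comb[where R = R, OF regs dist])
  have v: "mrow w (M s1) an c \<in> D i" "mrow w (M s2) bn c \<in> D i" if "c < w" for c
    using val that by (auto simp: over_def)
  show "real j \<in> G" if "j \<le> tn * w + w" for j using that B nat_G by simp
  show "real j \<in> G" if "j \<le> an * w + w" for j using that B nat_G by simp
  show "real j \<in> G" if "j \<le> bn * w + w" for j using that B nat_G by simp
  show "mrow w (M s1) an c \<in> G" "mrow w (M s2) bn c \<in> G" if "c < w" for c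
    using v[OF that] val(5) in_G by auto
  show "R al * mrow w (M s1) an c \<in> G" "R be * mrow w (M s2) bn c \<in> G"
    "R al * mrow w (M s1) an c - R be * mrow w (M s2) bn c \<in> G" if "c < w" for c
    using v[OF that] val(3-5) D_times D_comb in_G[of _ "Suc i"] by auto
qed (fact Q)

lemma wp_append_row:
  assumes "R 3 = 1" "R 6 = real w" "R 22 = real N" "R 23 = real a" "R 24 = real b"
    "{al, be} \<inter> {22, 40, 41, 42, 43, 44} = {}"
    "N * w + w \<le> B" "a * w + w \<le> B" "b * w + w \<le> B"
    "over i (mrow w (M 6) a)" "over i (mrow w (M 6) b)" "R al \<in> D i" "R be \<in> D i" "i \<le> w"
  shows "wp orc G (append_row al be) (\<lambda>k out R' M'. k \<le> 12 * w + 2 \<and> out = [] \<and> R' 22 = real (Suc N)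
      \<and> mrow w (M' 7) ` {..<Suc N} = mrow w (M 7) ` {..<N}
          \<union> {R al *\<^sub>R mrow w (M 6) b - R be *\<^sub>R mrow w (M 6) a}) R M"
  unfolding append_row_def wp_Seq
proof (rule wp_comb_over[where tn = N and an = b and bn = a and i = i], goal_cases)
  case (17 k R' M')
  have "N + 1 \<le> N * w + w" using p_pos p_w by (cases w) auto
  then have "real (Suc N) \<in> G" using assms(7) by (intro nat_G) linarith
  moreover have "R' 22 = real N" "R' 3 = 1" using 17 assms by auto
  moreover have "mrow w (M' 7) ` {..<Suc N} = mrow w (M 7) ` {..<N}
          \<union> {R al *\<^sub>R mrow w (M 6) b - R be *\<^sub>R mrow w (M 6) a}"
    unfolding lessThan_Suc image_insert 17(4) by auto
  ultimately show ?case using 17 by (auto simp: wp_simps add.commute)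
qed (use assms in auto)

lemma wp_pair_step:
  assumes regs: "R 0 = real p" "R 3 = 1" "R 4 = 0" "R 6 = real w" "R 21 = real c" "R 22 = real N"
      "R 23 = real a" "R 24 = real b"
    and B: "N * w + w \<le> B" "a * w + w \<le> B" "b * w + w \<le> B" and c: "c < w"
    and val: "over i (mrow w (M 6) a)" "over i (mrow w (M 6) b)" "i \<le> w"
  shows "wp orc G pair_step (\<lambda>k out R' M'. k \<le> 12 * w + 11 \<and> out = [] \<and>
      (\<exists>N'. R' 22 = real N' \<and> N' \<le> Suc N \<and> mrow w (M' 7) ` {..<N'}
         = mrow w (M 7) ` {..<N} \<union> contribution p c (mrow w (M 6)) a b)) R M"
proof -
  let ?u = "mrow w (M 6) a c" and ?v = "mrow w (M 6) b c"
  have uv: "M 6 (a * w + c) = ?u" "M 6 (b * w + c) = ?v" using c by (simp_all add: mrow_apply)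
  have D: "?u \<in> D i" "?v \<in> D i" using val c by (auto simp: over_def)
  then have G: "?u \<in> G" "?v \<in> G" using in_G val(3) by auto
  have "real (a * w) \<in> G" "real (a * w + c) \<in> G" "real (b * w) \<in> G" "real (b * w + c) \<in> G"
    by (rule nat_G, use B c in simp)+
  then have g: "real a * real w \<in> G" "real a * real w + real c \<in> G" "real b * real w \<in> G"
    "real b * real w + real c \<in> G" by simp_all
  have ix: "real x * real w + real c = real y \<longleftrightarrow> y = x * w + c" for x y
    by (metis of_nat_add of_nat_mult of_nat_eq_iff)
  have app2: "wp orc G (append_row 25 26) (\<lambda>k out R' M'. k \<le> 12 * w + 2 \<and> out = [] \<and> R' 22 = real (Suc N)
      \<and> mrow w (M' 7) ` {..<Suc N} = insert (?u *\<^sub>R mrow w (M 6) b - ?v *\<^sub>R mrow w (M 6) a)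
          (mrow w (M 7) ` {..<N})) (R(26 := ?v, 25 := ?u)) M"
    by (rule wp_mono[OF wp_append_row[where i = i]]) (use regs B val D in auto)
  have app1: "wp orc G (append_row 3 4) (\<lambda>k out R' M'. k \<le> 12 * w + 2 \<and> out = [] \<and> R' 22 = real (Suc N)
      \<and> mrow w (M' 7) ` {..<Suc N} = insert (mrow w (M 6) b) (mrow w (M 7) ` {..<N})) (R(26 := y, 25 := x)) M" for x y
    by (rule wp_mono[OF wp_append_row[where i = i]]) (use regs B val D_consts in auto)
  show ?thesis
    unfolding pair_step_def
    by (simp add: wp_simps regs ix uv g G fun_upd_twist)
      (auto simp: contribution_def intro!: wp_mono[OF app1] wp_mono[OF app2] exI[of _ "Suc N"] simp del: fun_upd_apply lessThan_Suc image_insert)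
qed

lemma over_elimination_step:
  assumes "\<And>x. x \<in> X \<Longrightarrow> over i x" "c < w"
  shows "x \<in> (if c < p then {u \<in> X. u c = 0} else eliminate c X) \<Longrightarrow> over (Suc i) x"
  using assms D_Suc D_comb by (auto simp: over_def eliminate_def split: if_splits)

definition "cost_elim_step N = 24 * w * (N * N) + 19 * (N * N) + 2" for N :: nat

lemma wp_elim_step:
  assumes regs: "R 0 = real p" "R 3 = 1" "R 4 = 0" "R 6 = real w" "R 20 = real N" "R 21 = real c"
    and B: "N * N * w + w \<le> B" and c: "c < w"
    and val: "\<And>x. x \<in> mrow w (M 6) ` {..<N} \<Longrightarrow> over i x" "i \<le> w"
  shows "wp orc G elim_step (\<lambda>k out R' M'. k \<le> cost_elim_step N \<and> out = [] \<and>
      (\<exists>N'. R' 20 = real N' \<and> N' \<le> N * N \<and> mrow w (M' 6) ` {..<N'}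
         = (if c < p then {u \<in> mrow w (M 6) ` {..<N}. u c = 0} else eliminate c (mrow w (M 6) ` {..<N})))) R M"
proof -
  let ?Y = "mrow w (M 6)" and ?C = "contribution p c (mrow w (M 6))"
  let ?Z = "if c < p then {u \<in> mrow w (M 6) ` {..<N}. u c = 0} else eliminate c (mrow w (M 6) ` {..<N})"
  have w1: "1 \<le> w" using p_pos p_w by simp
  have NN: "N * N * w \<ge> N * N" "N * N \<ge> N" using w1 by (auto simp: le_square)
  have rowB: "a * w + w \<le> B" if "a < N * N" for a
  proof -
    have "(a + 1) * w \<le> N * N * w" using that by (intro mult_le_mono1) simp
    then show ?thesis using B by simp
  qed
  have rowB': "a * w + w \<le> B" if "a < N" for a using rowB[of a] that NN by simp
  have natB: "real a \<in> G" if "a \<le> N * N" for a using that NN(1) B by (intro nat_G) linarith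
  have natN: "real a \<in> G" if "a \<le> N" for a using that NN(2) by (intro natB) linarith
  have zero: "(0::real) \<in> G" using nat_G[of 0] by simp
  have copy: "wp orc G (For 23 22 (comb 6 23 3 7 23 4 7 23) ;; Copy 20 22)
      (\<lambda>k out R' M'. k \<le> N * N * (12 * w + 3) + 1 \<and> out = [] \<and>
        (\<exists>N'. R' 20 = real N' \<and> N' \<le> N * N \<and> mrow w (M' 6) ` {..<N'} = ?Z)) R' M'"
    if R': "R' 3 = 1" "R' 4 = 0" "R' 6 = real w" "R' 22 = real N'" "N' \<le> N * N"
      and Z: "mrow w (M' 7) ` {..<N'} = ?Z" for R' M' N'
    unfolding wp_Seq
  proof (rule wp_For_silent[where m = N' and K = "12 * w + 1" and
      I = "\<lambda>j R'' M''. \<forall>r<j. mrow w (M'' 6) r = mrow w (M' 7) r"], goal_cases)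
    case (10 j R'' M'')
    have "mrow w (M' 7) j \<in> ?Z" unfolding Z[symmetric] using 10(1) by blast
    from over_elimination_step[OF val(1) c this]
    have ov: "over (Suc i) (mrow w (M' 7) j)" .
    have jB: "j * w + w \<le> B" using rowB[of j] 10(1) R'(5) by simp
    have "M'' 7 = M' 7" using 10(4) by simp
    then show ?case
      by (intro wp_comb_over[where tn = j and an = j and bn = j and i = "Suc i"])
        (use 10 R' ov jB val D_consts in \<open>auto simp: less_Suc_eq\<close>)
  next
    case (11 k R'' M'')
    then have e: "R'' 22 = real N'" "mrow w (M'' 6) ` {..<N'} = ?Z" using R' Z by auto
    have "N' * (12 * w + 3) \<le> N * N * (12 * w + 3)" using R'(5) by (rule mult_le_mono1)
    then have "k \<le> N * N * (12 * w + 3) + 1" using 11(1) by (simp add: algebra_simps)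
    then show ?case using R'(5) natB[OF R'(5)] e by (auto simp: wp_simps)
  qed (use R' natB in auto)
  have Z: "?Z = (\<Union>a<N. \<Union>b<N. ?C a b)" by (simp add: contributions)
  have zero7: "mrow w (M 7) ` {..<0} = {}" by simp
  have cost: "N * (N * (12 * w + 13) + 3) + 1 + (N * N * (12 * w + 3) + 1) \<le> cost_elim_step N"
  proof -
    have "N * (N * (12 * w + 13) + 3) + 1 + (N * N * (12 * w + 3) + 1) = 24 * w * (N * N) + 16 * (N * N) + 3 * N + 2"
      by (simp add: algebra_simps)
    also have "\<dots> \<le> 24 * w * (N * N) + 16 * (N * N) + 3 * (N * N) + 2" using NN(2) by simp
    finally show ?thesis unfolding cost_elim_step_def by (simp add: algebra_simps)
  qed
  show ?thesis
    unfolding elim_step_def wp_Seq[of _ _ "Const 22 0"] wp_basic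
  proof (intro conjI, simp add: zero, subst wp_Seq, rule wp_For_silent[where m = N and K = "N * (12 * w + 13) + 1" and
      I = "\<lambda>a R' M'. \<exists>N'. R' 22 = real N' \<and> N' \<le> a * N \<and> mrow w (M' 7) ` {..<N'} = (\<Union>a'<a. \<Union>b<N. ?C a' b)"], goal_cases)
    case (10 a R' M')
    then obtain N1 where N1: "R' 22 = real N1" "N1 \<le> a * N" "mrow w (M' 7) ` {..<N1} = (\<Union>a'<a. \<Union>b<N. ?C a' b)" by blast
    have M6: "M' 6 = M 6" using 10(4) by simp
    have aN: "a * N + N \<le> N * N" using mult_le_mono1[of "a + 1" N N] 10(1) by simp
    show ?case
    proof (rule wp_For_silent[where m = N and K = "12 * w + 11" and
        I = "\<lambda>b R' M'. \<exists>N'. R' 22 = real N' \<and> N' \<le> a * N + b \<and> mrow w (M' 7) ` {..<N'}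
           = (\<Union>a'<a. \<Union>b<N. ?C a' b) \<union> (\<Union>b'<b. ?C a b')"], goal_cases)
      case (10 b R'' M'')
      then obtain N2 where N2: "R'' 22 = real N2" "N2 \<le> a * N + b"
        "mrow w (M'' 7) ` {..<N2} = (\<Union>a'<a. \<Union>b<N. ?C a' b) \<union> (\<Union>b'<b. ?C a b')" by blast
      have M6': "M'' 6 = M 6" using 10(4) M6 by simp
      have N2B: "N2 * w + w \<le> B" using rowB[of N2] N2(2) 10(1) aN by simp
      have "wp orc G pair_step (\<lambda>k out R' M'. k \<le> 12 * w + 11 \<and> out = [] \<and>
        (\<exists>N'. R' 22 = real N' \<and> N' \<le> Suc N2 \<and> mrow w (M' 7) ` {..<N'}
         = mrow w (M'' 7) ` {..<N2} \<union> contribution p c (mrow w (M'' 6)) a b)) R'' M''"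
        by (rule wp_pair_step[where i = i])
          (use 10(1,2) 10(3)[of 0] 10(3)[of 3] 10(3)[of 4] 10(3)[of 6] 10(3)[of 21] 10(3)[of 23]
            \<open>a < N\<close> \<open>R' 23 = real a\<close> \<open>\<And>y. y \<noteq> 23 \<Longrightarrow> _ \<Longrightarrow> R' y = _\<close> regs N2 N2B rowB' c val M6' in auto)
      then show ?case
      proof (rule wp_mono, goal_cases)
        case (1 k out Ra Ma)
        then obtain N' where "Ra 22 = real N'" "N' \<le> Suc N2" "mrow w (Ma 7) ` {..<N'}
         = mrow w (M'' 7) ` {..<N2} \<union> contribution p c (mrow w (M'' 6)) a b" by blast
        then show ?case using 1 N2 unfolding M6'
          by (auto simp: lessThan_Suc intro!: exI[of _ N'])
      qed
    next
      case (11 k Ra Ma)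
      then obtain N' where "Ra 22 = real N'" "N' \<le> a * N + N" "mrow w (Ma 7) ` {..<N'}
           = (\<Union>a'<a. \<Union>b<N. ?C a' b) \<union> (\<Union>b'<N. ?C a b')" by blast
      moreover have "k \<le> N * (12 * w + 13) + 1" using 11(1) by (simp add: algebra_simps)
      ultimately show ?case by (auto simp: lessThan_Suc intro!: exI[of _ N'])
    qed (use 10 regs N1 natN in auto)
  next
    case (11 k R' M')
    then obtain N' where N': "R' 22 = real N'" "N' \<le> N * N" "mrow w (M' 7) ` {..<N'} = ?Z"
      unfolding Z by blast
    have k: "k \<le> N * (N * (12 * w + 13) + 3) + 1" using 11(1) by (simp add: algebra_simps)
    have R': "R' 3 = 1" "R' 4 = 0" "R' 6 = real w" using 11(2) regs by simp_all
    show ?case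
    proof (rule wp_mono, rule copy[where R' = R' and M' = M' and N' = N', OF R' N'], elim conjE, intro conjI)
      fix l out
      assume "l \<le> N * N * (12 * w + 3) + 1"
      then show "0 + (k + l) \<le> cost_elim_step N" using k cost by linarith
    qed simp_all
  qed (use regs natN in auto)
qed

definition "cost_elim U = w * (cost_elim_step U + 2) + 1" for U :: nat

lemma cost_elim_step_mono: "N \<le> U \<Longrightarrow> cost_elim_step N \<le> cost_elim_step U"
  unfolding cost_elim_step_def by (intro add_mono mult_le_mono) auto

text \<open>Each step at most squares the number of rows, so \<open>N\<close> rows become at most \<open>N ^ 2 ^ w\<close>. In the
  application \<open>N\<close> is the length of a tuple, which makes this a constant for fixed \<open>k\<close> and \<open>p\<close>.\<close>

lemma wp_elim_all:
  assumes regs: "R 0 = real p" "R 3 = 1" "R 4 = 0" "R 6 = real w" "R 20 = real N"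
    and N: "0 < N" and B: "N ^ (2 ^ w) * w + w \<le> B"
    and val: "\<And>x. x \<in> mrow w (M 6) ` {..<N} \<Longrightarrow> over 1 x"
  shows "wp orc G elim_all (\<lambda>k out R' M'. k \<le> cost_elim (N ^ 2 ^ w) \<and> out = [] \<and>
      (\<exists>N'. R' 20 = real N' \<and> (0 < N' \<longleftrightarrow> elimination p w (mrow w (M 6) ` {..<N}) \<noteq> {}))) R M"
  unfolding elim_all_def
proof (rule wp_For_silent[where m = w and K = "cost_elim_step (N ^ 2 ^ w)" and
    I = "\<lambda>c R' M'. \<exists>N'. R' 20 = real N' \<and> N' \<le> N ^ 2 ^ c
      \<and> mrow w (M' 6) ` {..<N'} = elimination p c (mrow w (M 6) ` {..<N})"], goal_cases)
  case (10 c R' M')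
  let ?X = "elimination p c (mrow w (M 6) ` {..<N})"
  obtain N' where N': "R' 20 = real N'" "N' \<le> N ^ 2 ^ c" "mrow w (M' 6) ` {..<N'} = ?X" using 10(5) by blast
  have sq: "N' * N' \<le> N ^ 2 ^ Suc c"
  proof -
    have "N' * N' \<le> N ^ 2 ^ c * N ^ 2 ^ c" using N'(2) by (intro mult_le_mono)
    also have "\<dots> = N ^ 2 ^ Suc c" by (simp add: power_add[symmetric] mult_2)
    finally show ?thesis .
  qed
  have pow: "N ^ 2 ^ d \<le> N ^ 2 ^ w" if "d \<le> w" for d
    using N that by (intro power_increasing) auto
  have NB: "N' * N' * w + w \<le> B"
  proof -
    have "N' * N' * w \<le> N ^ 2 ^ w * w" using sq pow[of "Suc c"] 10(1) by (intro mult_le_mono1) linarith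
    then show ?thesis using B by linarith
  qed
  have "N' \<le> N ^ 2 ^ w" using N'(2) pow[of c] 10(1) by linarith
  then have cost: "cost_elim_step N' \<le> cost_elim_step (N ^ 2 ^ w)" by (rule cost_elim_step_mono)
  have ov: "over (Suc c) x" if "x \<in> elimination p c (mrow w (M 6) ` {..<N})" "c \<le> w" for x c
    using that
  proof (induction c arbitrary: x)
    case 0
    then show ?case using val by simp
  next
    case (Suc c)
    show ?case
      by (rule over_elimination_step[of "elimination p c (mrow w (M 6) ` {..<N})" "Suc c" c])
        (use Suc in auto)
  qed
  show ?case
  proof (rule wp_mono, rule wp_elim_step[where N = N' and c = c and i = "Suc c"], goal_cases)
    case (9 x)
    then show ?case using ov[of x c] 10(1) N'(3) by simp
  next
    case (11 k out R'' M'')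
    then obtain N'' where "R'' 20 = real N''" "N'' \<le> N' * N'" "mrow w (M'' 6) ` {..<N''}
        = elimination p (Suc c) (mrow w (M 6) ` {..<N})" unfolding N'(3) by auto
    then show ?case using 11 cost sq by (auto intro!: exI[of _ N''])
  qed (use 10(1,2) 10(3)[of 0] 10(3)[of 3] 10(3)[of 4] 10(3)[of 6] regs N' NB in auto)
next
  case (11 k R' M')
  then show ?case unfolding cost_elim_def by (force simp: card_gt_0_iff)
qed (use regs B in \<open>auto intro: nat_G\<close>)

end

section \<open>Programming the removal of redundant records\<close>

text \<open>Array 5 contains the digits of the number of the current tuple to the base of the number of rows;
  register 29 contains the carry.\<close>

definition odometer :: program where
  "odometer = Const 29 1 ;; For 30 7 (Load 31 5 30 ;; Arith Plus 31 31 29 ;;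
     If (Equal 31 9) (Const 31 0) (Const 29 0) ;; Store 5 30 31)"

definition build_tuple :: program where
  "build_tuple = For 18 7 (Load 19 5 18 ;; comb 6 18 3 2 19 3 4 4)"

definition tuple_step :: program where
  "tuple_step = build_tuple ;; Copy 20 7 ;; elim_all ;; If (Less 4 20) (Const 15 1) Skip ;; odometer"

definition test_row :: program where
  "test_row = Const 15 0 ;; For 16 7 (Store 5 16 4) ;; For 17 11 tuple_step"

text \<open>A discarded row is marked by the impossible first shape coordinate \<open>- 1\<close>. The row under test is
  copied to array 4 and marked in the same way during its test: its shape then differs from that of
  the copy, which excludes it, like all rows discarded before, from the comparison.\<close>

definition mark_step :: program where
  "mark_step = comb 4 4 3 2 13 4 2 13 ;; Arith Times 14 13 6 ;; Store 2 14 5 ;; test_row ;;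
     If (Equal 15 4) (Load 32 4 4 ;; Store 2 14 32) Skip"

definition compress_step :: program where
  "compress_step = Arith Times 34 33 6 ;; Load 35 2 34 ;;
     If (Equal 35 5) Skip (comb 1 8 3 2 33 4 2 33 ;; Arith Plus 8 8 3)"

definition filter_rows :: program where
  "filter_rows = Const 11 1 ;; For 12 7 (Arith Times 11 11 9) ;; For 13 9 mark_step ;;
     Const 8 0 ;; For 33 9 compress_step"

lemma written_filter [simp]:
  "written_regs odometer = {29, 30, 31}" "written_arrs odometer = {5}"
  "written_regs build_tuple = {18, 19, 40, 41, 42, 43, 44}" "written_arrs build_tuple = {6}"
  "written_regs tuple_step = {15, 18, 19, 20, 21, 22, 23, 24, 25, 26, 29, 30, 31, 40, 41, 42, 43, 44}"
  "written_arrs tuple_step = {5, 6, 7}"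
  "written_regs test_row = {15, 16, 17, 18, 19, 20, 21, 22, 23, 24, 25, 26, 29, 30, 31, 40, 41, 42, 43, 44}"
  "written_arrs test_row = {5, 6, 7}"
  "written_regs mark_step
     = {14, 15, 16, 17, 18, 19, 20, 21, 22, 23, 24, 25, 26, 29, 30, 31, 32, 40, 41, 42, 43, 44}"
  "written_arrs mark_step = {2, 4, 5, 6, 7}"
  "written_regs compress_step = {8, 34, 35, 40, 41, 42, 43, 44}"
  "written_arrs compress_step = {1}"
  "written_regs filter_rows = {8, 11, 12, 13, 14, 15, 16, 17, 18, 19, 20, 21, 22, 23, 24, 25, 26, 29, 30, 31,
     32, 33, 34, 35, 40, 41, 42, 43, 44}"
  "written_arrs filter_rows = {1, 2, 4, 5, 6, 7}"
  by (auto simp: odometer_def build_tuple_def tuple_step_def test_row_def mark_step_def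
      compress_step_def filter_rows_def)

definition digit :: "nat \<Rightarrow> nat \<Rightarrow> nat \<Rightarrow> nat" where
  "digit N z j = z div N ^ j mod N"

text \<open>The second equation describes the carry: it passes position \<open>j\<close> just if it reached this position
  and the digit there is the last one.\<close>

lemma digit_Suc:
  assumes "0 < N"
  shows "digit N (Suc z) j = (if N ^ j dvd Suc z then Suc (digit N z j) mod N else digit N z j)"
    "N ^ Suc j dvd Suc z \<longleftrightarrow> N ^ j dvd Suc z \<and> Suc (digit N z j) = N"
proof -
  have div: "Suc z div N ^ j = (if N ^ j dvd Suc z then Suc (z div N ^ j) else z div N ^ j)"
    by (simp add: div_Suc dvd_eq_mod_eq_0)
  then show "digit N (Suc z) j = (if N ^ j dvd Suc z then Suc (digit N z j) mod N else digit N z j)"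
    by (simp add: digit_def mod_Suc_eq)
  have "N ^ Suc j dvd Suc z \<longleftrightarrow> N dvd Suc z div N ^ j" if "N ^ j dvd Suc z"
    using that assms by (metis div_dvd_iff_mult dvd_div_iff_mult mult.commute power_Suc power_not_zero less_not_refl2)
  moreover have "N dvd Suc d \<longleftrightarrow> Suc (d mod N) = N" for d
    using assms by (auto simp: dvd_eq_mod_eq_0 mod_Suc)
  moreover have "N ^ j dvd Suc z" if "N ^ Suc j dvd Suc z"
    using that by (metis dvd_trans le_imp_power_dvd lessI less_imp_le)
  ultimately show "N ^ Suc j dvd Suc z \<longleftrightarrow> N ^ j dvd Suc z \<and> Suc (digit N z j) = N"
    using div by (auto simp: digit_def)
qed

lemma digit_less: "0 < N \<Longrightarrow> digit N z j < N"
  by (simp add: digit_def)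

lemma tuple_digits:
  assumes "\<forall>j<T. f j < N"
  obtains z where "z < N ^ T" "\<forall>j<T. digit N z j = f j"
proof -
  have "\<exists>z<N ^ T. \<forall>j<T. digit N z j = f j" using assms
  proof (induction T arbitrary: f)
    case (Suc T)
    obtain z where z: "z < N ^ T" "\<forall>j<T. digit N z j = f (Suc j)" using Suc.IH[of "f \<circ> Suc"] Suc.prems by auto
    have f0: "f 0 < N" using Suc.prems by simp
    have "f 0 + N * z < N * N ^ T"
    proof -
      have "f 0 + N * z < N * Suc z" using f0 by simp
      also have "\<dots> \<le> N * N ^ T" using z(1) by (intro mult_le_mono2) simp
      finally show ?thesis .
    qed
    moreover have "digit N (f 0 + N * z) j = f j" if "j < Suc T" for j
    proof (cases j)
      case (Suc i)
      have "(f 0 + N * z) div (N * N ^ i) = z div N ^ i" using f0 by (simp add: div_mult2_eq)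
      then show ?thesis using Suc z that by (auto simp: digit_def)
    qed (use f0 in \<open>simp add: digit_def\<close>)
    ultimately show ?case by (intro exI[of _ "f 0 + N * z"]) simp
  qed simp
  then show ?thesis using that by blast
qed

locale filter_machine = machine +
  fixes k :: nat
  assumes w_eq: "w = (k + 1) * p"
begin

definition T :: nat where "T = k * (p - 1) + 1"

definition const_regs :: "regs \<Rightarrow> bool" where
  "const_regs R \<longleftrightarrow> R 0 = real p \<and> R 3 = 1 \<and> R 4 = 0 \<and> R 5 = - 1 \<and> R 6 = real w \<and> R 7 = real T"

lemma const_regs_frame:
  "const_regs R \<Longrightarrow> (\<And>x. x \<in> {0, 3, 4, 5, 6, 7} \<Longrightarrow> R' x = R x) \<Longrightarrow> const_regs R'"
  by (simp add: const_regs_def)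

lemma wp_odometer:
  assumes R: "const_regs R" "R 9 = real N" "0 < N" and B: "T \<le> B" "N \<le> B"
    and M: "\<And>j. j < T \<Longrightarrow> M 5 j = real (digit N z j)"
  shows "wp orc G odometer (\<lambda>k out R' M'. k \<le> T * 4 + 1 \<and> out = []
      \<and> (\<forall>j<T. M' 5 j = real (digit N (Suc z) j))) R M"
  unfolding odometer_def wp_Seq[of _ _ "Const 29 1"] wp_basic
proof (intro conjI, goal_cases)
  case 1
  then show ?case using nat_G[of 1] R B by simp
next
  case 2
  show ?case
  proof (rule wp_For_silent[where m = T and K = 2 and
      I = "\<lambda>i R' M'. R' 29 = of_bool (N ^ i dvd Suc z)
        \<and> (\<forall>j<T. M' 5 j = real (if j < i then digit N (Suc z) j else digit N z j))"], goal_cases)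
    case (10 i R' M')
    have e: "R' 9 = real N" "R' 30 = real i" using 10(2) 10(3)[of 9] R by simp_all
    have d: "M' 5 i = real (digit N z i)" "R' 29 = of_bool (N ^ i dvd Suc z)" using 10(1,5) by simp_all
    have g: "real (digit N z i) \<in> G" "real (Suc (digit N z i)) \<in> G" "real 0 \<in> G"
      by (rule nat_G, use digit_less[OF R(3), of z i] B in simp)+
    then have g': "real (digit N z i) \<in> G" "real (digit N z i) + 1 \<in> G" "(0::real) \<in> G"
      by (simp_all add: add.commute)
    have eq: "real (digit N z i) + 1 = real N \<longleftrightarrow> Suc (digit N z i) = N" by linarith
    have ne: "digit N z i \<noteq> N" using digit_less[OF R(3), of z i] by simp
    have digits: "digit N (Suc z) i = (if N ^ i dvd Suc z then if Suc (digit N z i) = N then 0 else Suc (digit N z i)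
        else digit N z i)"
      using digit_Suc(1)[OF R(3), of z i] digit_less[OF R(3), of z i] by auto
    have inv: "M' 5 j = real (if j < i then digit N (Suc z) j else digit N z j)" if "j < T" for j
      using 10(5) that by blast
    show ?case
    proof (cases "N ^ i dvd Suc z")
      case True
      show ?thesis
      proof (cases "Suc (digit N z i) = N")
        case c: True
        then have "N ^ Suc i dvd Suc z" using True digit_Suc(2)[OF R(3), of i z] by blast
        then show ?thesis using e d g' eq True c inv digits
          by (auto simp: wp_simps less_Suc_eq simp del: power_Suc)
      next
        case c: False
        then have "\<not> N ^ Suc i dvd Suc z" using digit_Suc(2)[OF R(3), of i z] by blast
        then show ?thesis using e d g' eq True c inv digits
          by (auto simp: wp_simps less_Suc_eq simp del: power_Suc)
      qed
    next
      case False
      then have "\<not> N ^ Suc i dvd Suc z" using digit_Suc(2)[OF R(3), of i z] by blast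
      then show ?thesis using e d g' ne False inv digits
        by (auto simp: wp_simps less_Suc_eq simp del: power_Suc)
    qed
  next
    case (11 l R' M')
    then show ?case by simp
  qed (use R M B in \<open>auto simp: const_regs_def intro: nat_G\<close>)
qed

lemma wp_build_tuple:
  assumes R: "const_regs R" and B: "N * w + w \<le> B" "T * w + w \<le> B" "T \<le> B"
    and M: "\<And>j. j < T \<Longrightarrow> M 5 j = real (f j)" "\<And>j. j < T \<Longrightarrow> f j < N"
    and val: "\<And>r. r < N \<Longrightarrow> over 0 (mrow w (M 2) r)" "over 0 (mrow w (M 4) 0)"
  shows "wp orc G build_tuple (\<lambda>k out R' M'. k \<le> T * (12 * w + 3) + 1 \<and> out = []
      \<and> (\<forall>j<T. mrow w (M' 6) j = mrow w (M 2) (f j) - mrow w (M 4) 0)) R M"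
  unfolding build_tuple_def
proof (rule wp_For_silent[where m = T and K = "12 * w + 1" and
      I = "\<lambda>i R' M'. \<forall>j<i. mrow w (M' 6) j = mrow w (M 2) (f j) - mrow w (M 4) 0"], goal_cases)
  case (10 i R' M')
  have m: "M' 5 = M 5" "M' 2 = M 2" "M' 4 = M 4" using 10(4) by simp_all
  have e: "R' 18 = real i" "R' 3 = 1" "R' 4 = 0" "R' 6 = real w"
    using 10(2) 10(3)[of 3] 10(3)[of 4] 10(3)[of 6] R by (simp_all add: const_regs_def)
  have rowB: "r * w + w \<le> B" if "r < N" for r
    using mult_le_mono1[of "r + 1" N w] that B(1) by simp
  have iB: "i * w + w \<le> B" using mult_le_mono1[of i T w] 10(1) B(2) by linarith
  have fG: "real (f i) \<in> G"
  proof -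
    have "f i \<le> f i * w + w" using p_pos p_w by (cases w) auto
    then show ?thesis using rowB[OF M(2)[OF 10(1)]] by (intro nat_G) linarith
  qed
  have "wp orc G (comb 6 18 3 2 19 3 4 4) (\<lambda>k out R'' M''. k \<le> 12 * w + 1 \<and> out = []
      \<and> (\<forall>j<Suc i. mrow w (M'' 6) j = mrow w (M 2) (f j) - mrow w (M 4) 0)) (R'(19 := real (f i))) M'"
    by (rule wp_comb_over[where tn = i and an = "f i" and bn = 0 and i = 0])
      (use e m iB rowB[OF M(2)[OF 10(1)]] M(2)[OF 10(1)] val B D_consts 10(5) in \<open>auto simp: less_Suc_eq\<close>)
  then show ?case
    unfolding wp_Seq using e m fG M(1)[OF 10(1)] by (simp add: wp_basic)
next
  case (11 l R' M')
  have "l \<le> T * (12 * w + 3) + 1" using 11(1) by (simp add: algebra_simps)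
  then show ?case using 11(4) by simp
qed (use R M B in \<open>auto simp: const_regs_def intro: nat_G\<close>)

definition "cost_tuple = T * (12 * w + 3) + 1 + cost_elim (T ^ 2 ^ w) + 1 + (T * 4 + 1)"

lemma T_pos: "0 < T"
  by (simp add: T_def)

lemma wp_tuple_step:
  assumes R: "const_regs R" "R 9 = real N" "0 < N" "R 15 = of_bool b"
    and B: "N * w + w \<le> B" "T ^ 2 ^ w * w + w \<le> B"
    and M: "\<And>j. j < T \<Longrightarrow> M 5 j = real (digit N z j)"
    and val: "\<And>r. r < N \<Longrightarrow> over 0 (mrow w (M 2) r)" "over 0 (mrow w (M 4) 0)"
  shows "wp orc G tuple_step (\<lambda>k out R' M'. k \<le> cost_tuple \<and> out = []
      \<and> R' 15 = of_bool (b \<or> elimination p w ((\<lambda>j. mrow w (M 2) (digit N z j) - mrow w (M 4) 0) ` {..<T}) \<noteq> {})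
      \<and> (\<forall>j<T. M' 5 j = real (digit N (Suc z) j))) R M"
proof -
  let ?X = "(\<lambda>j. mrow w (M 2) (digit N z j) - mrow w (M 4) 0) ` {..<T}"
  have w1: "1 \<le> w" using p_pos p_w by simp
  have "T ^ 1 \<le> T ^ 2 ^ w" using T_pos by (intro power_increasing) auto
  then have "T * w \<le> T ^ 2 ^ w * w" by (intro mult_le_mono1) simp
  then have TB: "T * w + w \<le> B" using B(2) by linarith
  have "T \<le> T * w" "N \<le> N * w" using w1 by auto
  then have TN: "T \<le> B" "N \<le> B" using TB B(1) by linarith+
  have build: "wp orc G build_tuple (\<lambda>k out R' M'. k \<le> T * (12 * w + 3) + 1 \<and> out = []
      \<and> (\<forall>j<T. mrow w (M' 6) j = mrow w (M 2) (digit N z j) - mrow w (M 4) 0)) R M"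
    by (rule wp_build_tuple[where N = N]) (use R(1) B(1) TB TN(1) M val digit_less[OF R(3)] in auto)
  show ?thesis
    unfolding tuple_step_def
  proof (subst wp_Seq, rule wp_frame[OF build], goal_cases)
    case (1 k1 out R1 M1)
    note A = 1
    have X: "mrow w (M1 6) ` {..<T} = ?X" using A(1) by (intro image_cong) auto
    have c1: "const_regs R1" by (rule const_regs_frame[OF R(1)]) (use A(2) in auto)
    have e1: "R1 9 = real N" "R1 15 = of_bool b" "M1 5 = M 5" using A(2)[of 9] A(2)[of 15] A(3)[of 5] R by simp_all
    have ov: "over 1 x" if "x \<in> mrow w (M1 6) ` {..<T}" for x
    proof -
      obtain j where "x = mrow w (M 2) (digit N z j) - mrow w (M 4) 0" using \<open>x \<in> _\<close> unfolding X by blast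
      then show ?thesis using val(1)[OF digit_less[OF R(3), of z j]] val(2) D_comb[of _ 0 1 _ 1] D_consts
        by (auto simp: over_def)
    qed
    have elim: "wp orc G elim_all (\<lambda>k out R' M'. k \<le> cost_elim (T ^ 2 ^ w) \<and> out = [] \<and>
      (\<exists>N'. R' 20 = real N' \<and> (0 < N' \<longleftrightarrow> elimination p w ?X \<noteq> {}))) (R1(20 := real T)) M1"
      unfolding X[symmetric] by (rule wp_elim_all[OF _ _ _ _ _ T_pos B(2) ov]) (use c1 in \<open>auto simp: const_regs_def\<close>)
    have "wp orc G (elim_all ;; If (Less 4 20) (Const 15 1) Skip ;; odometer) (\<lambda>l out R' M'.
       k1 + l \<le> cost_tuple \<and> out = [] \<and> R' 15 = of_bool (b \<or> elimination p w ?X \<noteq> {})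
      \<and> (\<forall>j<T. M' 5 j = real (digit N (Suc z) j))) (R1(20 := real T)) M1"
    proof (subst wp_Seq, rule wp_frame[OF elim], goal_cases)
      case (1 k2 out R2 M2)
      obtain N' where N': "R2 20 = real N'" "0 < N' \<longleftrightarrow> elimination p w ?X \<noteq> {}" using 1(1) by blast
      have c2: "const_regs R2" by (rule const_regs_frame[OF c1]) (use 1(2) in auto)
      have e2: "R2 9 = real N" "R2 15 = of_bool b" "M2 5 = M 5"
        using 1(2)[of 9] 1(2)[of 15] 1(3)[of 5] e1 by simp_all
      let ?R3 = "if 0 < N' then R2(15 := 1) else R2"
      have c3: "const_regs ?R3" "?R3 9 = real N" using c2 e2 by (auto simp: const_regs_def)
      have r15: "?R3 15 = of_bool (b \<or> elimination p w ?X \<noteq> {})" using N'(2) e2(2) by auto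
      have "wp orc G odometer (\<lambda>k out R' M'. k \<le> T * 4 + 1 \<and> out = []
        \<and> (\<forall>j<T. M' 5 j = real (digit N (Suc z) j))) ?R3 M2"
        by (rule wp_odometer[OF c3 R(3) TN]) (use M e2(3) in simp)
      then have od: "wp orc G odometer (\<lambda>k out R' M'. k1 + (k2 + (1 + k)) \<le> cost_tuple \<and> out = []
        \<and> R' 15 = of_bool (b \<or> elimination p w ?X \<noteq> {})
        \<and> (\<forall>j<T. M' 5 j = real (digit N (Suc z) j))) ?R3 M2"
      proof (rule wp_frame, goal_cases)
        case (1 k3 out R4 M4)
        have "k1 + (k2 + (1 + k3)) \<le> cost_tuple"
          using A(1) \<open>k2 \<le> cost_elim _ \<and> _\<close> 1(1) unfolding cost_tuple_def by linarith
        moreover have "R4 15 = ?R3 15" using 1(2) by simp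
        ultimately show ?case using 1(1) r15 by simp
      qed
      have lt: "R2 4 < R2 20 \<longleftrightarrow> 0 < N'" using N'(1) c2 by (simp add: const_regs_def)
      have "(1::real) \<in> G" using nat_G[of 1] TN T_pos by simp
      moreover have "out = []" using 1(1) by blast
      ultimately show ?case using od
        unfolding wp_Seq wp_If holds.simps lt by (cases "0 < N'") (simp_all add: wp_basic)
    qed
    moreover have "real T \<in> G" using TN(1) by (rule nat_G)
    moreover have "R1 7 = real T" using c1 by (simp add: const_regs_def)
    ultimately show ?case using A(1) unfolding wp_Seq[of _ _ "Copy 20 7"] wp_basic by simp
  qed
qed

definition "cost_test N = 2 * T + 1 + (N ^ T * (cost_tuple + 2) + 1)" for N :: nat

lemma wp_test_row:
  fixes x :: "nat \<Rightarrow> real"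
  assumes R: "const_regs R" "R 9 = real N" "0 < N" "R 11 = real (N ^ T)"
    and B: "N * w + w \<le> B" "T ^ 2 ^ w * w + w \<le> B" "N ^ T \<le> B"
    and val: "\<And>r. r < N \<Longrightarrow> over 0 (mrow w (M 2) r)" "over 0 x" and x: "mrow w (M 4) 0 = x"
    and bal: "balanced p k X" "x \<in> X" "\<And>r. r < N \<Longrightarrow> same_shape p (mrow w (M 2) r) x \<Longrightarrow> mrow w (M 2) r \<in> X"
  shows "wp orc G test_row (\<lambda>l out R' M'. l \<le> cost_test N \<and> out = []
      \<and> R' 15 = of_bool (\<not> separable w {mrow w (M 2) r - x |r. r < N \<and> same_shape p (mrow w (M 2) r) x})) R M"
proof -
  let ?red = "\<lambda>z. elimination p w ((\<lambda>j. mrow w (M 2) (digit N z j) - mrow w (M 4) 0) ` {..<T}) \<noteq> {}"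
  have "(\<exists>z<N ^ T. ?red z) \<longleftrightarrow>
      (\<exists>f. (\<forall>j<T. f j < N) \<and> elimination p w ((\<lambda>j. mrow w (M 2) (f j) - x) ` {..<T}) \<noteq> {})" (is "_ \<longleftrightarrow> ?R")
  proof
    assume ?R
    then obtain f where f: "\<forall>j<T. f j < N" "elimination p w ((\<lambda>j. mrow w (M 2) (f j) - x) ` {..<T}) \<noteq> {}" by blast
    obtain z where z: "z < N ^ T" "\<forall>j<T. digit N z j = f j" using tuple_digits[OF f(1)] by blast
    have "(\<lambda>j. mrow w (M 2) (digit N z j) - mrow w (M 4) 0) ` {..<T} = (\<lambda>j. mrow w (M 2) (f j) - x) ` {..<T}"
      using z(2) x by (intro image_cong) auto
    then have "?red z" using f(2) by simp
    then show "\<exists>z<N ^ T. ?red z" using z(1) by blast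
  next
    assume "\<exists>z<N ^ T. ?red z"
    then obtain z where "?red z" by blast
    then show ?R unfolding x using digit_less[OF R(3)] by (intro exI[of _ "digit N z"]) blast
  qed
  also have "\<dots> \<longleftrightarrow> \<not> separable w {mrow w (M 2) r - x |r. r < N \<and> same_shape p (mrow w (M 2) r) x}"
    unfolding w_eq T_def by (rule redundancy_test[OF p_pos bal(1,2)]) (use bal(3) w_eq in auto)
  finally have red: "(\<exists>z<N ^ T. ?red z) \<longleftrightarrow>
      \<not> separable w {mrow w (M 2) r - x |r. r < N \<and> same_shape p (mrow w (M 2) r) x}" .
  have w1: "1 \<le> w" using p_pos p_w by simp
  have "T \<le> T ^ 2 ^ w" by (rule self_le_power) (use T_pos in auto)
  moreover have "T ^ 2 ^ w \<le> T ^ 2 ^ w * w" using w1 by simp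
  ultimately have TB: "T \<le> B" using B(2) by linarith
  have g: "(0::real) \<in> G" using nat_G[of 0] by simp
  have init: "wp orc G (For 16 7 (Store 5 16 4)) (\<lambda>l out R' M'. l \<le> 2 * T + 1 \<and> out = []
      \<and> (\<forall>j<T. M' 5 j = 0)) (R(15 := 0)) M"
  proof (rule wp_For_silent[where m = T and K = 0 and I = "\<lambda>i R' M'. \<forall>j<i. M' 5 j = 0"], goal_cases)
    case (10 i R' M')
    have "R' 4 = 0" using 10(3)[of 4] R by (simp add: const_regs_def)
    then show ?case using 10 g by (auto simp: wp_basic less_Suc_eq)
  qed (use R TB in \<open>auto simp: const_regs_def intro: nat_G\<close>)
  show ?thesis
    unfolding test_row_def wp_Seq[of _ _ "Const 15 0"] wp_basic
  proof (intro conjI, goal_cases)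
    case 1
    then show ?case using g by simp
  next
    case 2
    show ?case
      unfolding of_int_0 wp_Seq[of _ _ "For 16 7 (Store 5 16 4)"]
    proof (rule wp_frame[OF init], goal_cases)
      case (1 k1 out R1 M1)
      have c1: "const_regs R1" by (rule const_regs_frame[OF R(1)]) (use 1(2) in auto)
      have e1: "R1 9 = real N" "R1 15 = 0" "R1 11 = real (N ^ T)" using 1(2)[of 9] 1(2)[of 15] 1(2)[of 11] R by simp_all
      have m1: "M1 2 = M 2" "M1 4 = M 4" using 1(3) by simp_all
      show ?case
      proof (rule wp_For_silent[where m = "N ^ T" and K = cost_tuple and
          I = "\<lambda>z R' M'. R' 15 = of_bool (\<exists>z'<z. ?red z') \<and> (\<forall>j<T. M' 5 j = real (digit N z j))"], goal_cases)
        case (10 z R2 M2)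
        have c2: "const_regs R2" by (rule const_regs_frame[OF c1]) (use 10(3) in auto)
        have e2: "R2 9 = real N" using 10(3)[of 9] e1 by simp
        have m2: "M2 2 = M 2" "M2 4 = M 4" using 10(4) m1 by simp_all
        have "wp orc G tuple_step (\<lambda>l out R' M'. l \<le> cost_tuple \<and> out = []
          \<and> R' 15 = of_bool ((\<exists>z'<z. ?red z') \<or> elimination p w ((\<lambda>j. mrow w (M2 2) (digit N z j) - mrow w (M2 4) 0) ` {..<T}) \<noteq> {})
          \<and> (\<forall>j<T. M' 5 j = real (digit N (Suc z) j))) R2 M2"
          by (rule wp_tuple_step[OF c2 e2 R(3) conjunct1[OF 10(5)] B(1,2)]) (use 10(5) val x m2 in auto)
        then show ?case
        proof (rule wp_mono, goal_cases)
          case (1 l out R3 M3)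
          moreover have "(\<exists>z'<Suc z. ?red z') \<longleftrightarrow> (\<exists>z'<z. ?red z') \<or> ?red z" by (auto simp only: less_Suc_eq)
          ultimately show ?case unfolding m2 by simp
        qed
      next
        case (11 l R2 M2)
        then show ?case using 1(1) red unfolding cost_test_def by simp
      qed (use c1 e1 B 1(1) in \<open>auto simp: const_regs_def digit_def intro: nat_G\<close>)
    qed
  qed
qed

definition "cost_mark N = 12 * w + 1 + (1 + (cost_test N + 1))" for N :: nat

text \<open>The contents of array 2 while the rows outside \<open>L\<close> are marked as discarded.\<close>

definition alive :: "nat set \<Rightarrow> (nat \<Rightarrow> nat \<Rightarrow> real) \<Rightarrow> nat \<Rightarrow> nat \<Rightarrow> real" where
  "alive L y r = (if r \<in> L then y r else (y r)(0 := - 1))"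

lemma wp_mark_step:
  assumes R: "const_regs R" "R 9 = real N" "R 11 = real (N ^ T)" "R 13 = real q" "q < N"
    and B: "N * w + w \<le> B" "T ^ 2 ^ w * w + w \<le> B" "N ^ T \<le> B"
    and y: "\<And>r. r < N \<Longrightarrow> over 0 (y r)" "\<And>r. r < N \<Longrightarrow> y r 0 \<noteq> - 1" "balanced p k (y ` {..<N})"
    and inv: "filter_inv p w N y q L" and M: "\<And>r. r < N \<Longrightarrow> mrow w (M 2) r = alive L y r"
  shows "wp orc G mark_step (\<lambda>l out R' M'. l \<le> cost_mark N \<and> out = []
      \<and> (\<exists>L'. filter_inv p w N y (Suc q) L' \<and> (\<forall>r<N. mrow w (M' 2) r = alive L' y r))) R M"
proof -
  let ?U = "{y s - y q |s. s \<in> L \<and> s \<noteq> q \<and> same_shape p (y s) (y q)}"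
  have w1: "0 < w" using p_pos p_w by simp
  have L: "L \<subseteq> {..<N}" "q \<in> L" using inv R(5) unfolding filter_inv_def by auto
  have Mq: "mrow w (M 2) q = y q" using M[OF R(5)] L by (simp add: alive_def)
  have ov_alive: "over 0 (alive X y r)" if "r < N" for X r
    using y(1)[OF that] D_consts by (auto simp: alive_def over_def)
  have supp: "y r c = 0" if "r < N" "w \<le> c" for r c
    using y(3) that w_eq unfolding balanced_def by auto
  have qB: "q * w + w \<le> B" using mult_le_mono1[of "q + 1" N w] R(5) B(1) by simp
  have qG: "real q * real w \<in> G"
  proof -
    have "real (q * w) \<in> G" by (rule nat_G) (use qB in linarith)
    then show ?thesis by simp
  qed
  have m1: "- 1 \<in> G" by (rule in_G[OF D_consts(3), of 0]) simp
  show ?thesis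
    unfolding mark_step_def
  proof (subst wp_Seq, rule wp_comb_over[where tn = 0 and an = q and bn = q and i = 0], goal_cases)
    case (17 k1 R1 M1)
    have c1: "const_regs R1" by (rule const_regs_frame[OF R(1)]) (use 17(2) in auto)
    have e1: "R1 9 = real N" "R1 11 = real (N ^ T)" "R1 13 = real q" using 17(2)[of 9] 17(2)[of 11] 17(2)[of 13] R by simp_all
    have v: "mrow w (M1 4) 0 = y q" using 17(4)[of 0] R(1) Mq by (simp add: const_regs_def)
    have M12: "M1 2 = M 2" using 17(3) by simp
    let ?R2 = "R1(14 := real q * real w)"
    let ?M2 = "M1(2 := (M1 2)(q * w + 0 := - 1))"
    have rows: "mrow w (?M2 2) r = alive (L - {q}) y r" if "r < N" for r
      using M[OF that] L unfolding fun_upd_same mrow_store[OF w1] M12 by (auto simp: alive_def Mq)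
    \<comment> \<open>The copy in array 4 has a first coordinate different from \<open>- 1\<close>, so a marked row cannot have its shape.\<close>
    have dead: "r \<in> L - {q}" if "same_shape p (alive (L - {q}) y r) (y q)" "r < N" for r
      using that y(2)[OF R(5)] p_pos by (auto simp: alive_def same_shape_def split: if_splits)
    have U: "{mrow w (?M2 2) r - y q |r. r < N \<and> same_shape p (mrow w (?M2 2) r) (y q)} = ?U" (is "?U' = ?U")
    proof
      show "?U' \<subseteq> ?U"
      proof
        fix u assume "u \<in> ?U'"
        then obtain r where r: "u = alive (L - {q}) y r - y q" "r < N" "same_shape p (alive (L - {q}) y r) (y q)"
          using rows by auto
        then have "r \<in> L - {q}" using dead by blast
        then show "u \<in> ?U" using r by (auto simp: alive_def)
      qed
      show "?U \<subseteq> ?U'"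
      proof
        fix u assume "u \<in> ?U"
        then obtain r where r: "u = y r - y q" "r \<in> L" "r \<noteq> q" "same_shape p (y r) (y q)" by blast
        then have "r < N" "mrow w (?M2 2) r = y r" using L rows[of r] by (auto simp: alive_def)
        then show "u \<in> ?U'"
          using r(1,4) by (intro CollectI exI[of _ r] conjI) (simp_all only: simp_thms)
      qed
    qed
    have c2: "const_regs ?R2" using c1 by (simp add: const_regs_def)
    have test: "wp orc G test_row (\<lambda>l out R' M'. l \<le> cost_test N \<and> out = []
      \<and> R' 15 = of_bool (\<not> separable w ?U)) ?R2 ?M2"
      unfolding U[symmetric]
    proof (rule wp_test_row[OF c2 _ _ _ B _ _ _ y(3)], goal_cases)
      case (4 r)
      then show ?case unfolding rows[OF 4] by (rule ov_alive)
    next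
      case 5
      then show ?case using y(1) R(5) by blast
    next
      case 6
      then show ?case using v by simp
    next
      case 7
      then show ?case using R(5) by blast
    next
      case (8 r)
      have "r \<in> L - {q}" using dead[OF 8(2)[unfolded rows[OF 8(1)]] 8(1)] .
      then show ?case unfolding rows[OF 8(1)] using 8(1) by (simp add: alive_def)
    qed (use e1 R(5) in auto)
    define L' where "L' = (if separable w ?U then L else L - {q})"
    have inv': "filter_inv p w N y (Suc q) L'"
      by (rule filter_inv_step[OF inv R(5) supp]) (auto simp: L'_def)
    have rest: "wp orc G (test_row ;; If (Equal 15 4) (Load 32 4 4 ;; Store 2 14 32) Skip)
      (\<lambda>l out R' M'. l \<le> cost_test N + 1 \<and> out = [] \<and> (\<forall>r<N. mrow w (M' 2) r = alive L' y r)) ?R2 ?M2"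
    proof (subst wp_Seq, rule wp_frame[OF test], goal_cases)
      case (1 l out R3 M3)
      have c3: "const_regs R3" by (rule const_regs_frame[OF c2]) (use 1(2) in auto)
      have e3: "R3 14 = real q * real w" "R3 4 = 0" "M3 2 = ?M2 2" "M3 4 = M1 4"
        using 1(2)[of 14] 1(3) c3 by (simp_all add: const_regs_def)
      have yq: "M1 4 0 = y q 0" using v w1 by (metis mrow_apply mult_0 add_0)
      have yG: "y q 0 \<in> G" using y(1)[OF R(5)] w1 in_G[of "y q 0" 0] by (simp add: over_def)
      have ix: "real q * real w = real j \<longleftrightarrow> j = q * w + 0" for j
        by (metis of_nat_mult of_nat_eq_iff add_0_right)
      have restore: "mrow w ((M3 2)(q * w + 0 := y q 0)) r = alive L y r" if "r < N" for r
        using rows[OF that] L unfolding mrow_store[OF w1] e3(3) by (auto simp: alive_def)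
      show ?case
      proof (cases "separable w ?U")
        case True
        then have "R3 15 = 0" "L' = L" using 1(1) by (simp_all add: L'_def)
        then show ?thesis using 1(1) e3 yq yG restore
          by (simp add: wp_simps ix del: add_0_right)
      next
        case False
        then have "R3 15 = 1" "L' = L - {q}" using 1(1) by (simp_all add: L'_def)
        then show ?thesis using 1(1) e3 rows by (simp add: wp_simps)
      qed
    qed
    have k1: "k1 \<le> 12 * w + 1" by (rule 17(1))
    have ix: "real q * real w = real j \<longleftrightarrow> j = q * w + 0" for j
      by (metis of_nat_mult of_nat_eq_iff add_0_right)
    have c15: "R1 13 * R1 6 = real q * real w" "R1 5 = - 1" using c1 e1 by (simp_all add: const_regs_def)
    have "wp orc G (test_row ;; If (Equal 15 4) (Load 32 4 4 ;; Store 2 14 32) Skip)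
      (\<lambda>l out R' M'. k1 + (1 + (0 + l)) \<le> cost_mark N \<and> [] @ [] @ [] @ out = []
        \<and> (\<exists>L'. filter_inv p w N y (Suc q) L' \<and> (\<forall>r<N. mrow w (M' 2) r = alive L' y r))) ?R2 ?M2"
      by (rule wp_mono[OF rest]) (use k1 inv' in \<open>auto simp: cost_mark_def\<close>)
    then show ?case
      unfolding wp_Seq[of _ _ "Arith Times 14 13 6"] wp_Seq[of _ _ "Store 2 14 5"] wp_basic wp_Arith arith_val.simps
      using c15 qG m1 ix by auto
  qed (use R qB B y(1) Mq D_consts in \<open>auto simp: const_regs_def\<close>)
qed

lemma wp_compress_step:
  assumes R: "const_regs R" "R 8 = real N'" "R 33 = real r" "r < N" "N' < N"
    and B: "N * w + w \<le> B"
    and y: "\<And>r. r < N \<Longrightarrow> over 0 (y r)" "\<And>r. r < N \<Longrightarrow> y r 0 \<noteq> - 1"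
    and M: "mrow w (M 2) r = alive L y r"
  shows "wp orc G compress_step (\<lambda>l out R' M'. l \<le> 12 * w + 4 \<and> out = []
      \<and> R' 8 = real (if r \<in> L then Suc N' else N')
      \<and> (\<forall>s. mrow w (M' 1) s = (if r \<in> L \<and> s = N' then y r else mrow w (M 1) s))) R M"
proof -
  have w1: "0 < w" using p_pos p_w by simp
  have rowB: "s * w + w \<le> B" if "s < N" for s using mult_le_mono1[of "s + 1" N w] that B by simp
  have rG: "real r * real w \<in> G"
  proof -
    have "real (r * w) \<in> G" by (rule nat_G) (use rowB[OF R(4)] in linarith)
    then show ?thesis by simp
  qed
  have "Suc N' \<le> N * w + w" using R(5) w1 by (cases w) auto
  then have NG: "real N' + 1 \<in> G" using nat_G[of "Suc N'"] B by (simp add: add.commute)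
  have ix: "real r * real w = real j \<longleftrightarrow> j = r * w + 0" for j
    by (metis of_nat_mult of_nat_eq_iff add_0_right)
  have cell: "M 2 (r * w + 0) = alive L y r 0" using M w1 by (metis mrow_apply)
  have cG: "alive L y r 0 \<in> G"
    using y(1)[OF R(4)] w1 in_G[of _ 0] D_consts by (auto simp: over_def alive_def)
  have dead: "alive L y r 0 = - 1 \<longleftrightarrow> r \<notin> L" using y(2)[OF R(4)] by (simp add: alive_def)
  have copy: "wp orc G (comb 1 8 3 2 33 4 2 33) (\<lambda>l out R' M'. l \<le> 12 * w + 1 \<and> out = [] \<and> R' 8 = real N' \<and> R' 3 = 1
      \<and> (\<forall>s. mrow w (M' 1) s = (if s = N' then y r else mrow w (M 1) s))) (R(34 := a, 35 := b)) M" if "r \<in> L" for a b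
    by (rule wp_comb_over[where tn = N' and an = r and bn = r and i = 0])
      (use R that M rowB[OF R(4)] rowB[OF R(5)] y(1)[OF R(4)] D_consts in \<open>auto simp: const_regs_def alive_def\<close>)
  show ?thesis
  proof (cases "r \<in> L")
    case True
    have "wp orc G (comb 1 8 3 2 33 4 2 33 ;; Arith Plus 8 8 3) (\<lambda>l out R' M'. l \<le> 12 * w + 2 \<and> out = []
      \<and> R' 8 = real (Suc N') \<and> (\<forall>s. mrow w (M' 1) s = (if s = N' then y r else mrow w (M 1) s)))
      (R(34 := real r * real w, 35 := alive L y r 0)) M"
      unfolding wp_Seq by (rule wp_mono[OF copy[OF True]]) (use NG in \<open>auto simp: wp_Arith\<close>)
    then have "wp orc G (comb 1 8 3 2 33 4 2 33 ;; Arith Plus 8 8 3) (\<lambda>l out R' M'. 1 + (0 + Suc l) \<le> 12 * w + 4 \<and> [] @ [] @ out = []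
      \<and> R' 8 = real (Suc N') \<and> (\<forall>s. mrow w (M' 1) s = (if s = N' then y r else mrow w (M 1) s)))
      (R(34 := real r * real w, 35 := alive L y r 0)) M"
      by (rule wp_mono) auto
    then show ?thesis
      unfolding compress_step_def wp_Seq[of _ _ "Arith Times 34 33 6"] wp_Seq[of _ _ "Load 35 2 34"] wp_basic wp_Arith
        arith_val.simps wp_If holds.simps
      using True dead rG cG cell ix R by (auto simp: const_regs_def)
  next
    case False
    then show ?thesis
      unfolding compress_step_def using dead rG cG cell ix R by (auto simp: const_regs_def wp_simps)
  qed
qed

definition "cost_filter N = T * 3 + 1 + (N * (cost_mark N + 2) + 1 + (N * (12 * w + 6) + 1))" for N :: nat

theorem wp_filter_rows:
  assumes R: "const_regs R" "R 9 = real N"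
    and B: "N * w + w \<le> B" "T ^ 2 ^ w * w + w \<le> B" "N ^ T \<le> B"
    and y: "\<And>r. r < N \<Longrightarrow> over 0 (mrow w (M 2) r)" "\<And>r. r < N \<Longrightarrow> mrow w (M 2) r 0 \<noteq> - 1"
      "balanced p k (mrow w (M 2) ` {..<N})"
  shows "wp orc G filter_rows (\<lambda>l out R' M'. l \<le> cost_filter N \<and> out = [] \<and> (\<exists>N'. R' 8 = real N'
      \<and> inj_on (mrow w (M' 1)) {..<N'} \<and> irredundant p w (mrow w (M' 1) ` {..<N'})
      \<and> generates p (mrow w (M' 1) ` {..<N'}) (mrow w (M 2) ` {..<N}))) R M"
proof -
  let ?y = "mrow w (M 2)"
  have w1: "1 \<le> w" using p_pos p_w by simp
  have g: "(0::real) \<in> G" "(1::real) \<in> G" by (rule in_G[OF D_consts(1), of 0] in_G[OF D_consts(2), of 0], simp)+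
  have "T \<le> T ^ 2 ^ w" by (rule self_le_power) (use T_pos in auto)
  moreover have "T ^ 2 ^ w \<le> T ^ 2 ^ w * w" using w1 by simp
  ultimately have TB: "T \<le> B" using B(2) by linarith
  have "N \<le> N * w" using w1 by simp
  then have NB: "N \<le> B" using B(1) by linarith
  have power: "wp orc G (For 12 7 (Arith Times 11 11 9)) (\<lambda>l out R' M'. l \<le> T * 3 + 1 \<and> out = []
      \<and> R' 11 = real (N ^ T)) (R(11 := 1)) M"
  proof (rule wp_For_silent[where m = T and K = 1 and I = "\<lambda>i R' M'. R' 11 = real (N ^ i)"], goal_cases)
    case (10 i R' M')
    have "R' 9 = real N" using 10(3)[of 9] R by simp
    then have eq: "R' 11 * R' 9 = real (N ^ Suc i)" using 10(5) by simp
    have "N ^ Suc i \<le> N ^ T"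
      by (cases "N = 0") (use 10(1) in \<open>auto intro: power_increasing simp del: power_Suc\<close>)
    then have "real (N ^ Suc i) \<in> G" using B(3) by (intro nat_G) linarith
    then show ?case unfolding wp_Arith arith_val.simps eq by simp
  qed (use R TB in \<open>auto simp: const_regs_def intro: nat_G\<close>)
  show ?thesis
    unfolding filter_rows_def wp_Seq[of _ _ "Const 11 1"] wp_basic of_int_1 wp_Seq[of _ _ "For 12 7 _"]
  proof (intro conjI g, rule wp_frame[OF power], goal_cases)
    case (1 k1 out1 R1 M1)
    have c1: "const_regs R1" by (rule const_regs_frame[OF R(1)]) (use 1(2) in auto)
    have e1: "R1 9 = real N" "R1 11 = real (N ^ T)" "M1 2 = M 2" using 1(1) 1(2)[of 9] 1(3)[of 2] R by simp_all
    have out1: "out1 = []" using 1(1) by blast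
    show ?case
    proof (subst wp_Seq, rule wp_For_silent[where m = N and K = "cost_mark N" and
        I = "\<lambda>q R' M'. \<exists>L. filter_inv p w N ?y q L \<and> (\<forall>r<N. mrow w (M' 2) r = alive L ?y r)"], goal_cases)
      case 9
      show ?case using filter_inv_start[of p w N ?y] e1(3) by (intro exI[of _ "{..<N}"]) (simp add: alive_def)
    next
      case (10 q R2 M2)
      then obtain L where L: "filter_inv p w N ?y q L" "\<And>r. r < N \<Longrightarrow> mrow w (M2 2) r = alive L ?y r" by blast
      have c2: "const_regs R2" by (rule const_regs_frame[OF c1]) (use 10(3) in auto)
      have e2: "R2 9 = real N" "R2 11 = real (N ^ T)" using 10(3)[of 9] 10(3)[of 11] e1 by simp_all
      show ?case by (rule wp_mark_step[where N = N and y = ?y and L = L and M = M2, OF c2 e2 10(2,1) B y L])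
    next
      case (11 k2 R2 M2)
      then obtain L where L: "filter_inv p w N ?y N L" "\<And>r. r < N \<Longrightarrow> mrow w (M2 2) r = alive L ?y r" by blast
      have c2: "const_regs R2" by (rule const_regs_frame[OF c1]) (use 11(2) in auto)
      have e2: "R2 9 = real N" using 11(2)[of 9] e1 by simp
      have LN: "L \<subseteq> {..<N}" using L(1) by (simp add: filter_inv_def)
      then have finL: "finite L" using finite_subset by blast
      have "wp orc G (For 33 9 compress_step) (\<lambda>l out R' M'. l \<le> N * (12 * w + 6) + 1 \<and> out = []
        \<and> R' 8 = real (card L) \<and> mrow w (M' 1) ` {..<card L} = ?y ` L) (R2(8 := 0)) M2"
      proof (rule wp_For_silent[where m = N and K = "12 * w + 4" and
          I = "\<lambda>r R' M'. R' 8 = real (card (L \<inter> {..<r})) \<and> mrow w (M' 1) ` {..<card (L \<inter> {..<r})} = ?y ` (L \<inter> {..<r})"], goal_cases)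
        case (10 r R3 M3)
        have c3: "const_regs R3" by (rule const_regs_frame[OF c2]) (use 10(3) in auto)
        have lt: "card (L \<inter> {..<r}) < N"
          using card_mono[of "{..<r}" "L \<inter> {..<r}"] 10(1) by simp
        have "M3 2 = M2 2" using 10(4) by simp
        then have "mrow w (M3 2) r = alive L ?y r" using L(2)[OF 10(1)] by simp
        then have "wp orc G compress_step (\<lambda>l out R' M'. l \<le> 12 * w + 4 \<and> out = []
          \<and> R' 8 = real (if r \<in> L then Suc (card (L \<inter> {..<r})) else card (L \<inter> {..<r}))
          \<and> (\<forall>s. mrow w (M' 1) s = (if r \<in> L \<and> s = card (L \<inter> {..<r}) then ?y r else mrow w (M3 1) s))) R3 M3"
          by (intro wp_compress_step[where y = ?y and L = L and N = N, OF c3 conjunct1[OF 10(5)] 10(2,1) lt B(1)] y)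
        then show ?case
        proof (rule wp_mono, goal_cases)
          case (1 l out R4 M4)
          show ?case
          proof (cases "r \<in> L")
            case True
            then have "L \<inter> {..<Suc r} = insert r (L \<inter> {..<r})" by (auto simp: less_Suc_eq)
            moreover have "r \<notin> L \<inter> {..<r}" by simp
            ultimately have S: "card (L \<inter> {..<Suc r}) = Suc (card (L \<inter> {..<r}))"
              "?y ` (L \<inter> {..<Suc r}) = insert (?y r) (?y ` (L \<inter> {..<r}))" using finL by auto
            have "mrow w (M4 1) ` {..<card (L \<inter> {..<r})} = mrow w (M3 1) ` {..<card (L \<inter> {..<r})}"
              using 1 by (intro image_cong) auto
            moreover have "mrow w (M4 1) (card (L \<inter> {..<r})) = ?y r" using 1 True by simp
            moreover have "mrow w (M4 1) ` {..<Suc c} = insert (mrow w (M4 1) c) (mrow w (M4 1) ` {..<c})" for c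
              by (simp only: lessThan_Suc image_insert)
            ultimately have "mrow w (M4 1) ` {..<card (L \<inter> {..<Suc r})} = ?y ` (L \<inter> {..<Suc r})"
              using 10(5) unfolding S by (simp only:)
            then show ?thesis using 1 True S(1) by simp
          next
            case False
            then have "L \<inter> {..<Suc r} = L \<inter> {..<r}" by (auto simp: less_Suc_eq)
            moreover have "mrow w (M4 1) s = mrow w (M3 1) s" for s using 1 False by simp
            ultimately show ?thesis using 1 False 10(5) by simp
          qed
        qed
      next
        case (11 l R3 M3)
        moreover have "L \<inter> {..<N} = L" using LN by blast
        moreover have "l \<le> N * (12 * w + 6) + 1" using 11(1) by (simp add: algebra_simps)
        ultimately show ?case by simp
      qed (use c2 e2 NB in \<open>auto simp: const_regs_def intro: nat_G\<close>)
      then have final: "wp orc G (For 33 9 compress_step) (\<lambda>l out R' M'.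
          0 + (k1 + (k2 + (0 + l))) \<le> cost_filter N \<and> [] @ out1 @ [] @ [] @ out = [] \<and> (\<exists>N'. R' 8 = real N'
        \<and> inj_on (mrow w (M' 1)) {..<N'} \<and> irredundant p w (mrow w (M' 1) ` {..<N'})
        \<and> generates p (mrow w (M' 1) ` {..<N'}) (mrow w (M 2) ` {..<N}))) (R2(8 := 0)) M2"
      proof (rule wp_mono, goal_cases)
        case (1 l out R' M')
        then have img: "mrow w (M' 1) ` {..<card L} = ?y ` L" by blast
        have inj: "inj_on (mrow w (M' 1)) {..<card L}"
          by (rule eq_card_imp_inj_on) (use card_image[OF filter_inv_end(1)[OF L(1)]] img in auto)
        have "irredundant p w (mrow w (M' 1) ` {..<card L})"
          "generates p (mrow w (M' 1) ` {..<card L}) (mrow w (M 2) ` {..<N})"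
          using filter_inv_end(2,3)[OF L(1)] img by simp_all
        moreover have "0 + (k1 + (k2 + (0 + l))) \<le> cost_filter N"
          using \<open>k1 \<le> T * 3 + 1 \<and> _\<close> \<open>k2 \<le> _\<close> 1 unfolding cost_filter_def by linarith
        ultimately show ?case using 1 inj out1 by (auto intro!: exI[of _ "card L"])
      qed
      then show ?case unfolding wp_Seq[of _ _ "Const 8 0"] wp_basic of_int_0 using g by blast
    qed (use c1 e1 NB in \<open>auto simp: const_regs_def intro: nat_G\<close>)
  qed
qed

end

section \<open>The vertex enumeration algorithm\<close>

definition init :: program where
  "init = Const 3 1 ;; Const 4 0 ;; Const 5 (- 1) ;; Arith Plus 6 1 3 ;; Arith Times 6 6 0 ;;
     Arith Minus 7 0 3 ;; Arith Times 7 7 1 ;; Arith Plus 7 7 3 ;; Const 8 1"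

text \<open>Row \<open>j\<close> of array 3 becomes the increment of the current column in class \<open>j\<close>. The written positions
  do not depend on the column, so the zeros in between remain from the initial memory.\<close>

definition increments :: program where
  "increments = For 50 0 (Arith Times 51 50 6 ;; Arith Plus 51 51 50 ;; Store 3 51 3 ;;
     For 52 1 (Arith Times 53 52 2 ;; Arith Plus 53 53 10 ;; Load 53 0 53 ;; Arith Plus 51 51 0 ;; Store 3 51 53))"

definition extend_rows :: program where
  "extend_rows = For 54 8 (For 50 0 (Arith Times 55 54 0 ;; Arith Plus 55 55 50 ;; comb 2 55 3 1 54 5 3 50)) ;;
     Arith Times 9 8 0"

definition load_shape :: program where
  "load_shape = For 56 0 (Arith Times 57 54 6 ;; Arith Plus 57 57 56 ;; Load 57 1 57 ;; Store 8 56 57)"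

definition keep_row :: program where
  "keep_row = comb 2 9 3 1 54 4 1 54 ;; Arith Times 57 9 6 ;;
     For 56 0 (Store 2 57 4 ;; Arith Plus 57 57 3) ;; Arith Plus 9 9 3"

definition select_rows :: program where
  "select_rows = Const 9 0 ;; For 54 8 (load_shape ;; Query 58 8 0 ;; If (Equal 58 3) keep_row Skip)"

definition print_rows :: program where
  "print_rows = For 54 8 (Arith Times 57 54 6 ;; Arith Plus 57 57 0 ;; Arith Minus 59 6 0 ;;
     For 56 59 (Load 58 1 57 ;; Output 58 ;; Arith Plus 57 57 3))"

definition enumerate_vertices :: program where
  "enumerate_vertices = init ;; For 10 2 (increments ;; extend_rows ;; filter_rows) ;; select_rows ;; filter_rows ;; print_rows"

lemma written_main [simp]:
  "written_regs increments = {50, 51, 52, 53}" "written_arrs increments = {3}"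
  "written_regs extend_rows = {9, 40, 41, 42, 43, 44, 50, 54, 55}" "written_arrs extend_rows = {2}"
  "written_regs load_shape = {56, 57}" "written_arrs load_shape = {8}"
  "written_regs keep_row = {9, 40, 41, 42, 43, 44, 56, 57}" "written_arrs keep_row = {2}"
  "written_regs select_rows = {9, 40, 41, 42, 43, 44, 54, 56, 57, 58}" "written_arrs select_rows = {2, 8}"
  by (auto simp: increments_def extend_rows_def load_shape_def keep_row_def select_rows_def)

lemma mod_div_unique: "j < p \<Longrightarrow> c mod p = j \<and> c div p = i \<longleftrightarrow> c = i * p + (j::nat)"
  by auto

lemma concat_grid: "concat (map (\<lambda>i. map (\<lambda>j. f (i * p + j)) [0..<p]) [0..<k]) = map f [0..<k * p]"
proof (induction k)
  case (Suc k)
  have "map (\<lambda>j. f (k * p + j)) [0..<p] = map f [k * p..<k * p + p]"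
    by (intro nth_equalityI) auto
  then show ?case using Suc upt_add_eq_append[of 0 "k * p" p] by (simp add: add.commute)
qed simp

locale run_machine = filter_machine +
  fixes n :: nat and A :: matrix and \<Lambda> :: "nat list set"
  assumes orc: "orc = shape_oracle p n \<Lambda>"
    and n_pos: "0 < n" and k_pos: "0 < k"
    and sum_D: "X \<subseteq> {..<n} \<Longrightarrow> i < k \<Longrightarrow> (\<Sum>l\<in>X. A i l) \<in> D 0"
    and nat_D: "i \<le> n \<Longrightarrow> real i \<in> D 0"
begin

text \<open>\<open>S_bound\<close> bounds the number of records that are kept, \<open>N_bound\<close> the number of candidates after their
  extension by a column.\<close>

definition "S_bound = ((n + 1) ^ (k + 1)) ^ (p * (p - 1) div 2)"

definition "N_bound = p * S_bound"

end

locale sized_run = run_machine +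
  assumes B1: "N_bound * w + w \<le> B" and B2: "T ^ 2 ^ w * w + w \<le> B" and B3: "N_bound ^ T \<le> B"
    and B4: "k * n \<le> B"
begin

lemma w1: "1 \<le> w" "0 < w"
  using p_pos p_w by simp_all

lemma g01: "(0::real) \<in> G" "(1::real) \<in> G" "(- 1::real) \<in> G"
  by (rule in_G[OF D_consts(1), of 0] in_G[OF D_consts(2), of 0] in_G[OF D_consts(3), of 0], simp)+

lemma S_bound_pos: "1 \<le> S_bound"
  unfolding S_bound_def by (intro one_le_power) simp

lemma p_N_bound: "p \<le> N_bound" "S_bound \<le> N_bound"
  using S_bound_pos p_pos by (simp_all add: N_bound_def)

lemma row_B: "r < N_bound \<Longrightarrow> r * w + w \<le> B"
  using mult_le_mono1[of "r + 1" N_bound w] B1 by simp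

lemma small_nat_G: "i \<le> N_bound * w + w \<Longrightarrow> real i \<in> G" "i \<le> N_bound \<Longrightarrow> real i \<in> G" "i \<le> w \<Longrightarrow> real i \<in> G"
proof -
  show "i \<le> N_bound * w + w \<Longrightarrow> real i \<in> G" using B1 by (intro nat_G) linarith
  have "N_bound \<le> N_bound * w" using w1 by simp
  then show "i \<le> N_bound \<Longrightarrow> real i \<in> G" using B1 by (intro nat_G) linarith
  show "i \<le> w \<Longrightarrow> real i \<in> G" using B1 by (intro nat_G) linarith
qed

lemma p_G: "i \<le> p \<Longrightarrow> real i \<in> G"
  using p_w by (intro small_nat_G(3)) simp

lemma n_G: "i \<le> n \<Longrightarrow> real i \<in> G"
proof -
  assume "i \<le> n"
  moreover have "n \<le> k * n" using k_pos by simp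
  ultimately show ?thesis using B4 by (intro nat_G) linarith
qed

lemma k_G: "i \<le> k \<Longrightarrow> real i \<in> G"
proof -
  assume "i \<le> k"
  moreover have "k \<le> k * n" using n_pos by simp
  ultimately show ?thesis using B4 by (intro nat_G) linarith
qed

lemma over_grid:
  assumes "\<And>r j. r < k + 1 \<Longrightarrow> j < p \<Longrightarrow> x (r * p + j) \<in> D i"
  shows "over i x"
  unfolding over_def
proof (intro allI impI)
  fix c assume "c < w"
  then obtain r j where "r < k + 1" "j < p" "c = r * p + j" unfolding w_eq by (rule grid_cases)
  then show "x c \<in> D i" using assms by blast
qed

lemma over_records: "x \<in> records p k A m \<Longrightarrow> m \<le> n \<Longrightarrow> over 0 x"
proof (rule over_grid)
  fix r j assume x: "x \<in> records p k A m" "m \<le> n" and rj: "r < k + 1" "j < p"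
  obtain \<sigma> where "x = record_of p k A m \<sigma>" using x(1) unfolding records_def by blast
  then have *: "x (r * p + j) = (\<Sum>l | l < m \<and> \<sigma> l = j. ahat A r l)" using record_of_grid[OF rj(2,1)] by simp
  show "x (r * p + j) \<in> D 0"
  proof (cases r)
    case 0
    have "card {l. l < m \<and> \<sigma> l = j} \<le> card {..<m}" by (intro card_mono) auto
    then have "card {l. l < m \<and> \<sigma> l = j} \<le> n" using x(2) by simp
    then show ?thesis using * 0 nat_D by (simp add: ahat_def)
  next
    case (Suc i)
    moreover have "{l. l < m \<and> \<sigma> l = j} \<subseteq> {..<n}" using x(2) by auto
    ultimately show ?thesis using * rj sum_D[of "{l. l < m \<and> \<sigma> l = j}" i] by (simp add: ahat_def)
  qed
qed

lemma over_inc: "m < n \<Longrightarrow> over 0 (inc p k A m j)"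
proof (rule over_grid)
  fix r j' assume "m < n" "r < k + 1" "j' < p"
  moreover have "A i m \<in> D 0" if "i < k" for i using sum_D[of "{m}" i] that \<open>m < n\<close> by simp
  ultimately show "inc p k A m j (r * p + j') \<in> D 0"
    using D_consts by (auto simp: inc_grid ahat_def)
qed

lemma record_shape_coord:
  assumes "x \<in> records p k A m"
  shows "x 0 \<noteq> - 1"
proof -
  obtain \<sigma> where "x = record_of p k A m \<sigma>" using assms unfolding records_def by blast
  then show ?thesis using record_shape[OF p_pos, of k A m \<sigma>] by simp
qed

lemma balanced_subset: "balanced p k R \<Longrightarrow> S \<subseteq> R \<Longrightarrow> balanced p k S"
  unfolding balanced_def by blast

definition "input_stored M \<longleftrightarrow> (\<forall>i<k. \<forall>m<n. M 0 (i * n + m) = A i m)" for M :: arrs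

definition "clean M \<longleftrightarrow> (\<forall>j<p. \<forall>c<w. c mod p \<noteq> j \<longrightarrow> mrow w (M 3) j c = 0)" for M :: arrs

definition "cost_increments = p * ((2 + (k * 5 + 1)) + 2) + 1"

lemma wp_increments:
  assumes R: "const_regs R" "R 1 = real k" "R 2 = real n" "R 10 = real m" "m < n"
    and M: "input_stored M" "clean M"
  shows "wp orc G increments (\<lambda>l out R' M'. l \<le> cost_increments \<and> out = []
      \<and> (\<forall>j<p. mrow w (M' 3) j = inc p k A m j)) R M"
proof -
  define part where "part = (\<lambda>q j c. if c < w \<and> c mod p = j then
      (if c div p < q then ahat A (c div p) m else mrow w (M 3) j c) else 0)"
  have part_0: "part 0 j = mrow w (M 3) j" if "j < p" for j
    using M(2) that by (auto simp: part_def clean_def mrow_def fun_eq_iff)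
  have cell: "r * p + j < w" if "r < k + 1" "j < p" for r j
    unfolding w_eq by (rule grid_less[OF that])
  have part_Suc: "(part r j)(r * p + j := ahat A r m) = part (Suc r) j" if "r < k + 1" "j < p" for r j
  proof
    fix c show "((part r j)(r * p + j := ahat A r m)) c = part (Suc r) j c"
      using cell[OF that] mod_div_unique[OF that(2), of c r] by (auto simp: part_def less_Suc_eq)
  qed
  have part_full: "part (k + 1) j = inc p k A m j" if "j < p" for j
    using w_eq by (auto simp: part_def inc_def fun_eq_iff less_mult_imp_div_less)
  have AG: "A i m \<in> G" if "i < k" for i using sum_D[of "{m}" i] that R(5) in_G[of "A i m" 0] by simp
  have rowB: "j * w + c \<le> N_bound * w + w" if "j < p" "c < w" for j c
    using mult_le_mono1[of j N_bound w] that p_N_bound(1) by linarith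
  show ?thesis
    unfolding increments_def
  proof (rule wp_For_silent[where m = p and K = "2 + (k * 5 + 1)" and
      I = "\<lambda>j R' M'. \<forall>j'<p. mrow w (M' 3) j' = (if j' < j then inc p k A m j' else mrow w (M 3) j')"], goal_cases)
    case (10 j R1 M1)
    have e: "R1 0 = real p" "R1 1 = real k" "R1 2 = real n" "R1 3 = 1" "R1 6 = real w" "R1 10 = real m" "R1 50 = real j"
      using 10(2) 10(3)[of 0] 10(3)[of 1] 10(3)[of 2] 10(3)[of 3] 10(3)[of 6] 10(3)[of 10] R
      by (simp_all add: const_regs_def)
    have m0: "M1 0 = M 0" using 10(4) by simp
    have jw: "j < w" using 10(1) p_w by simp
    let ?R2 = "R1(51 := real j * real w + real j)"
    let ?M2 = "M1(3 := (M1 3)(j * w + j := 1))"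
    have g: "real j * real w \<in> G" "real j * real w + real j \<in> G"
    proof -
      have "real (j * w) \<in> G" by (rule small_nat_G(1)) (use rowB[OF 10(1), of 0] w1 in simp)
      moreover have "real (j * w + j) \<in> G" by (rule small_nat_G(1)) (use rowB[OF 10(1) jw] in simp)
      ultimately show "real j * real w \<in> G" "real j * real w + real j \<in> G" by simp_all
    qed
    have rows2: "mrow w (?M2 3) j' = (if j' = j then part 1 j else if j' < j then inc p k A m j' else mrow w (M 3) j')"
      if "j' < p" for j'
      using 10(5) that part_Suc[of 0 j] part_0[OF 10(1)] 10(1)
      unfolding fun_upd_same mrow_store[OF jw] by (auto simp: ahat_def)
    have inner: "wp orc G (For 52 1 (Arith Times 53 52 2 ;; Arith Plus 53 53 10 ;; Load 53 0 53 ;; Arith Plus 51 51 0 ;; Store 3 51 53))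
      (\<lambda>l out R' M'. l \<le> k * 5 + 1 \<and> out = []
        \<and> (\<forall>j'<p. mrow w (M' 3) j' = (if j' = j then part (k + 1) j else if j' < j then inc p k A m j' else mrow w (M 3) j')))
      ?R2 ?M2"
    proof (rule wp_For_silent[where m = k and K = 3 and
      I = "\<lambda>i R' M'. R' 51 = real (j * w + (i * p + j)) \<and> (\<forall>j'<p. mrow w (M' 3) j' =
        (if j' = j then part (i + 1) j else if j' < j then inc p k A m j' else mrow w (M 3) j'))"], goal_cases)
      case 9
      show ?case using rows2 by (simp add: algebra_simps)
    next
      case (10 i R3 M3)
      have e3: "R3 0 = real p" "R3 2 = real n" "R3 10 = real m" "R3 52 = real i" "R3 51 = real (j * w + (i * p + j))"
        using 10(2) 10(3)[of 0] 10(3)[of 2] 10(3)[of 10] 10(5) e by simp_all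
      have m3: "M3 0 = M 0" using 10(4)[of 0] m0 by simp
      have Ai: "M 0 (i * n + m) = A i m" using M(1) 10(1) R(5) by (simp add: input_stored_def)
      have c: "Suc i * p + j < w" using cell[of "Suc i" j] 10(1) \<open>j < p\<close> by simp
      have ixA: "real i * real n + real m = real q \<longleftrightarrow> q = i * n + m" for q
        by (metis of_nat_add of_nat_mult of_nat_eq_iff)
      have "i * n + m < k * n" using mult_le_mono1[of "i + 1" k n] 10(1) R(5) by simp
      then have "real (i * n) \<in> G" "real (i * n + m) \<in> G" using B4 by (auto intro!: nat_G simp del: of_nat_add of_nat_mult)
      then have g3: "real i * real n \<in> G" "real i * real n + real m \<in> G" by simp_all
      have g51: "real (j * w + (Suc i * p + j)) \<in> G"
        by (rule small_nat_G(1)) (use rowB[OF \<open>j < p\<close> c] in simp)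
      have s51: "R3 51 + R3 0 = real (j * w + (Suc i * p + j))" using e3 by simp
      have rows: "mrow w ((M3 3)(j * w + (Suc i * p + j) := A i m)) j' =
        (if j' = j then part (Suc i + 1) j else if j' < j then inc p k A m j' else mrow w (M 3) j')" if "j' < p" for j'
        using 10(5) that part_Suc[of "Suc i" j] 10(1) \<open>j < p\<close> unfolding mrow_store[OF c] by (auto simp: ahat_def)
      show ?case
        unfolding wp_simps arith_val.simps using e3(2-4) s51 g3 g51 AG[OF 10(1)] m3 Ai rows
        by (simp add: ixA del: of_nat_add of_nat_mult mult_Suc)
    next
      case (11 l R3 M3)
      then show ?case by simp
    qed (use e k_G in auto)
    have "wp orc G (For 52 1 (Arith Times 53 52 2 ;; Arith Plus 53 53 10 ;; Load 53 0 53 ;; Arith Plus 51 51 0 ;; Store 3 51 53))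
      (\<lambda>l out R' M'. 1 + (1 + (0 + l)) \<le> 2 + (k * 5 + 1) \<and> [] @ [] @ [] @ out = []
        \<and> (\<forall>j'<p. mrow w (M' 3) j' = (if j' < Suc j then inc p k A m j' else mrow w (M 3) j'))) ?R2 ?M2"
      by (rule wp_mono[OF inner]) (use part_full[OF 10(1)] in \<open>auto simp: less_Suc_eq\<close>)
    moreover have "real j * real w + real j = real q \<longleftrightarrow> q = j * w + j" for q
      by (metis of_nat_add of_nat_mult of_nat_eq_iff)
    ultimately show ?case
      unfolding wp_Seq[of _ _ "Arith Times 51 50 6"] wp_Seq[of _ _ "Arith Plus 51 51 50"] wp_Seq[of _ _ "Store 3 51 3"]
        wp_basic wp_Arith arith_val.simps using e g g01 by simp
  next
    case (11 l R' M')
    then show ?case by (simp add: cost_increments_def)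
  qed (use R p_G in \<open>auto simp: const_regs_def\<close>)
qed

definition "cost_extend N = N * (p * (12 * w + 5) + 3) + 2" for N :: nat

lemma wp_extend_rows:
  assumes R: "const_regs R" "R 8 = real N" and N: "N * p \<le> N_bound"
    and H: "\<And>j. j < p \<Longrightarrow> mrow w (M 3) j = v j" "\<And>j. j < p \<Longrightarrow> over 0 (v j)"
    and X: "\<And>r. r < N \<Longrightarrow> over 0 (mrow w (M 1) r)"
  shows "wp orc G extend_rows (\<lambda>l out R' M'. l \<le> cost_extend N \<and> out = [] \<and> R' 9 = real (N * p)
      \<and> mrow w (M' 2) ` {..<N * p} = {x + v j |x j. x \<in> mrow w (M 1) ` {..<N} \<and> j < p}) R M"
proof -
  have NN: "N \<le> N_bound" using N p_pos by (metis dual_order.trans le_square mult.commute mult_le_mono2 nat_mult_1_right Suc_leI One_nat_def)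
  show ?thesis
    unfolding extend_rows_def
  proof (subst wp_Seq, rule wp_For_silent[where m = N and K = "p * (12 * w + 5) + 1" and
      I = "\<lambda>r R' M'. \<forall>r'<r. \<forall>j<p. mrow w (M' 2) (r' * p + j) = mrow w (M 1) r' + v j"], goal_cases)
    case (10 r R1 M1)
    have m1: "M1 1 = M 1" "M1 3 = M 3" using 10(4) by simp_all
    have c1: "const_regs R1" by (rule const_regs_frame[OF R(1)]) (use 10(3) in auto)
    have r1: "R1 54 = real r" by (rule 10(2))
    show ?case
    proof (rule wp_For_silent[where m = p and K = "12 * w + 3" and
        I = "\<lambda>j R' M'. (\<forall>r'<r. \<forall>j<p. mrow w (M' 2) (r' * p + j) = mrow w (M 1) r' + v j)
          \<and> (\<forall>j'<j. mrow w (M' 2) (r * p + j') = mrow w (M 1) r + v j')"], goal_cases)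
      case (10 j R2 M2)
      have c2: "const_regs R2" by (rule const_regs_frame[OF c1]) (use 10(3) in auto)
      have e2: "R2 54 = real r" "R2 50 = real j" using 10(2) 10(3)[of 54] r1 by simp_all
      have m2: "M2 1 = M 1" "M2 3 = M 3" using 10(4) m1 by simp_all
      have lt: "r * p + j < N_bound" using grid_less[OF \<open>r < N\<close> 10(1)] N by linarith
      have rN: "r < N_bound" "j < N_bound" using \<open>r < N\<close> NN 10(1) p_N_bound by linarith+
      have "real (r * p) \<in> G" "real (r * p + j) \<in> G" by (rule small_nat_G(2), use lt in simp)+
      then have g: "real r * real p \<in> G" "real r * real p + real j \<in> G" by simp_all
      have cmb: "wp orc G (comb 2 55 3 1 54 5 3 50) (\<lambda>l out R' M'. l \<le> 12 * w + 1 \<and> out = []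
        \<and> (\<forall>s. mrow w (M' 2) s = (if s = r * p + j then mrow w (M 1) r + v j else mrow w (M2 2) s)))
        (R2(55 := real r * real p + real j)) M2"
        by (rule wp_comb_over[where tn = "r * p + j" and an = r and bn = j and i = 0])
          (use c2 e2 m2 row_B lt rN X[OF \<open>r < N\<close>] H 10(1) D_consts in \<open>auto simp: const_regs_def\<close>)
      have "wp orc G (comb 2 55 3 1 54 5 3 50) (\<lambda>l out R' M'. 1 + (1 + l) \<le> 12 * w + 3 \<and> [] @ [] @ out = []
        \<and> (\<forall>r'<r. \<forall>j<p. mrow w (M' 2) (r' * p + j) = mrow w (M 1) r' + v j)
        \<and> (\<forall>j'<Suc j. mrow w (M' 2) (r * p + j') = mrow w (M 1) r + v j'))
        (R2(55 := real r * real p + real j)) M2"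
      proof (rule wp_mono[OF cmb], goal_cases)
        case (1 l out R3 M3)
        have "r' * p + j' \<noteq> r * p + j" if "r' < r" "j' < p" for r' j'
          using index_unique[OF that(2) \<open>j < p\<close>, of r' r] that(1) by simp
        then show ?case using 1 10(5) by (auto simp: less_Suc_eq)
      qed
      then show ?case
        unfolding wp_Seq wp_Arith arith_val.simps using c2 e2 g by (simp add: const_regs_def)
    next
      case (11 l R2 M2)
      have "l \<le> p * (12 * w + 5) + 1" using 11(1) by (simp add: algebra_simps)
      then show ?case using 11(4) by (auto simp: less_Suc_eq)
    qed (use c1 p_G 10(5) in \<open>auto simp: const_regs_def\<close>)
  next
    case (11 l R1 M1)
    have e: "R1 8 = real N" "R1 0 = real p" using 11(2)[of 8] 11(2)[of 0] R by (simp_all add: const_regs_def)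
    have "real (N * p) \<in> G" by (rule small_nat_G(2)) (rule N)
    then have g: "real N * real p \<in> G" by simp
    have "mrow w (M1 2) ` {..<N * p} = {x + v j |x j. x \<in> mrow w (M 1) ` {..<N} \<and> j < p}" (is "?L = ?Z")
    proof
      show "?L \<subseteq> ?Z"
      proof
        fix z assume "z \<in> ?L"
        then obtain s where s: "s < N * p" "z = mrow w (M1 2) s" by blast
        then obtain r j where rj: "r < N" "j < p" "s = r * p + j" by (elim grid_cases)
        then have "z = mrow w (M 1) r + v j" using 11(4) s by blast
        then show "z \<in> ?Z" using rj by blast
      qed
      show "?Z \<subseteq> ?L"
      proof
        fix z assume "z \<in> ?Z"
        then obtain r j where rj: "r < N" "j < p" "z = mrow w (M 1) r + v j" by blast
        then have "z = mrow w (M1 2) (r * p + j)" using 11(4) by simp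
        then show "z \<in> ?L" using grid_less[OF rj(1,2)] by blast
      qed
    qed
    moreover have "l + 1 \<le> cost_extend N" using 11(1) unfolding cost_extend_def by (simp add: algebra_simps)
    ultimately show ?case unfolding wp_Arith arith_val.simps using e g by simp
  qed (use R NN small_nat_G(2) in \<open>auto simp: const_regs_def\<close>)
qed

lemma wp_load_shape:
  assumes R: "const_regs R" "R 54 = real r" and r: "r < N_bound" and x: "over 0 (mrow w (M 1) r)"
  shows "wp orc G load_shape (\<lambda>l out R' M'. l \<le> p * 4 + 1 \<and> out = []
      \<and> (\<forall>j<p. M' 8 j = mrow w (M 1) r j)) R M"
  unfolding load_shape_def
proof (rule wp_For_silent[where m = p and K = 2 and I = "\<lambda>j R' M'. \<forall>j'<j. M' 8 j' = mrow w (M 1) r j'"], goal_cases)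
  case (10 j R1 M1)
  have e: "R1 54 = real r" "R1 6 = real w" "R1 56 = real j" "M1 1 = M 1"
    using 10(2) 10(3)[of 54] 10(3)[of 6] 10(4) R by (simp_all add: const_regs_def)
  have jw: "j < w" using 10(1) p_w by simp
  have "real (r * w) \<in> G" "real (r * w + j) \<in> G" by (rule nat_G, use row_B[OF r] jw in simp)+
  then have g: "real r * real w \<in> G" "real r * real w + real j \<in> G" by simp_all
  have ix: "real r * real w + real j = real q \<longleftrightarrow> q = r * w + j" for q
    by (metis of_nat_add of_nat_mult of_nat_eq_iff)
  have v: "M 1 (r * w + j) = mrow w (M 1) r j" "mrow w (M 1) r j \<in> G"
    using jw x in_G[of _ 0] by (auto simp: mrow_apply over_def)
  show ?case unfolding wp_simps arith_val.simps using e g v 10(5) by (simp add: ix less_Suc_eq)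
qed (use R p_G in \<open>auto simp: const_regs_def\<close>)

lemma wp_keep_row:
  assumes R: "const_regs R" "R 54 = real r" "R 9 = real N" and N: "r < N_bound" "N < N_bound"
    and x: "mrow w (M 1) r = x" "over 0 x"
  shows "wp orc G keep_row (\<lambda>l out R' M'. l \<le> 12 * w + 3 + (p * 3 + 1) \<and> out = [] \<and> R' 9 = real (Suc N)
      \<and> (\<forall>s. mrow w (M' 2) s = (if s = N then erase p x else mrow w (M 2) s))) R M"
  unfolding keep_row_def
proof (subst wp_Seq, rule wp_comb_over[where tn = N and an = r and bn = r and i = 0], goal_cases)
  case (17 k1 R1 M1)
  have c1: "const_regs R1" by (rule const_regs_frame[OF R(1)]) (use 17(2) in auto)
  have e1: "R1 9 = real N" "R1 6 = real w" "R1 3 = 1" "R1 0 = real p" using 17(2)[of 9] c1 R by (simp_all add: const_regs_def)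
  have rows: "mrow w (M1 2) s = (if s = N then x else mrow w (M 2) s)" for s
    using 17(4)[of s] R x by (simp add: const_regs_def)
  have x0: "x c = 0" if "w \<le> c" for c using x(1) that by (auto simp: mrow_def)
  have "real (N * w) \<in> G" by (rule nat_G) (use row_B[OF N(2)] in linarith)
  then have g: "real N * real w \<in> G" by simp
  have gN: "real N + 1 \<in> G" using small_nat_G(2)[of "Suc N"] N(2) by (simp add: add.commute)
  have loop: "wp orc G (For 56 0 (Store 2 57 4 ;; Arith Plus 57 57 3)) (\<lambda>l out R' M'. l \<le> p * 3 + 1 \<and> out = []
      \<and> (\<forall>s. mrow w (M' 2) s = (if s = N then erase p x else mrow w (M 2) s))) (R1(57 := real N * real w)) M1"
  proof (rule wp_For_silent[where m = p and K = 1 and I = "\<lambda>j R' M'. R' 57 = real (N * w + j)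
        \<and> (\<forall>s. mrow w (M' 2) s = (if s = N then (\<lambda>c. if c < j then 0 else x c) else mrow w (M 2) s))"], goal_cases)
    case 9
    show ?case using rows by simp
  next
    case (10 j R2 M2)
    have jw: "j < w" using 10(1) p_w by simp
    have e2: "R2 3 = 1" "R2 4 = 0" using 10(3)[of 3] 10(3)[of 4] c1 by (simp_all add: const_regs_def)
    have e57: "R2 57 = real (N * w + j)" using 10(5) by blast
    have "real (Suc (N * w + j)) \<in> G" by (rule nat_G) (use row_B[OF N(2)] jw in simp)
    then have g2: "real (N * w + j) + 1 \<in> G" by (simp add: add.commute)
    have rows2: "mrow w ((M2 2)(N * w + j := 0)) s = (if s = N then (\<lambda>c. if c < Suc j then 0 else x c) else mrow w (M 2) s)" for s
      using 10(5) unfolding mrow_store[OF jw] by (auto simp: less_Suc_eq fun_eq_iff)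
    show ?case unfolding wp_simps arith_val.simps e57 using e2 g2 g01 rows2
      by (simp del: of_nat_add of_nat_mult)
  next
    case (11 l R2 M2)
    then show ?case by (simp add: erase_def)
  qed (use e1 p_G in auto)
  have "wp orc G (For 56 0 (Store 2 57 4 ;; Arith Plus 57 57 3) ;; Arith Plus 9 9 3) (\<lambda>l out R' M'.
      k1 + (1 + l) \<le> 12 * w + 3 + (p * 3 + 1) \<and> [] @ [] @ out = [] \<and> R' 9 = real (Suc N)
      \<and> (\<forall>s. mrow w (M' 2) s = (if s = N then erase p x else mrow w (M 2) s))) (R1(57 := real N * real w)) M1"
  proof (subst wp_Seq, rule wp_frame[OF loop], goal_cases)
    case (1 l out R' M')
    have "R' 9 = real N" "R' 3 = 1" using 1(2)[of 9] 1(2)[of 3] e1 by simp_all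
    then show ?case using 1(1) 17(1) gN by (simp add: wp_Arith)
  qed
  then show ?case unfolding wp_Seq[of _ _ "Arith Times 57 9 6"] wp_Arith arith_val.simps using e1 g by simp
qed (use R N row_B x D_consts in \<open>auto simp: const_regs_def\<close>)

definition "cost_select N = N * ((p * 4 + 1 + 2 + (12 * w + 3 + (p * 3 + 1))) + 2) + 1" for N :: nat

lemma wp_select_rows:
  assumes R: "const_regs R" "R 8 = real N" and N: "N \<le> N_bound"
    and X: "\<And>r. r < N \<Longrightarrow> mrow w (M 1) r \<in> records p k A n"
  shows "wp orc G select_rows (\<lambda>l out R' M'. l \<le> cost_select N \<and> out = [] \<and> (\<exists>N'. R' 9 = real N' \<and> N' \<le> N
      \<and> mrow w (M' 2) ` {..<N'} = erase p ` {x \<in> mrow w (M 1) ` {..<N}. shape_of p x \<in> \<Lambda>})) R M"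
proof -
  have "wp orc G (For 54 8 (load_shape ;; Query 58 8 0 ;; If (Equal 58 3) keep_row Skip))
     (\<lambda>l out R' M'. l \<le> cost_select N \<and> out = [] \<and> (\<exists>N'. R' 9 = real N' \<and> N' \<le> N
      \<and> mrow w (M' 2) ` {..<N'} = erase p ` {x \<in> mrow w (M 1) ` {..<N}. shape_of p x \<in> \<Lambda>})) (R(9 := 0)) M"
  proof (rule wp_For_silent[where m = N and K = "p * 4 + 1 + 2 + (12 * w + 3 + (p * 3 + 1))" and
      I = "\<lambda>r R' M'. \<exists>N'. R' 9 = real N' \<and> N' \<le> r
        \<and> mrow w (M' 2) ` {..<N'} = erase p ` {x \<in> mrow w (M 1) ` {..<r}. shape_of p x \<in> \<Lambda>}"], goal_cases)
    case (10 r R1 M1)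
    then obtain N' where N': "R1 9 = real N'" "N' \<le> r"
      "mrow w (M1 2) ` {..<N'} = erase p ` {x \<in> mrow w (M 1) ` {..<r}. shape_of p x \<in> \<Lambda>}" by blast
    let ?x = "mrow w (M 1) r"
    have m1: "M1 1 = M 1" using 10(4) by simp
    have c1: "const_regs R1" by (rule const_regs_frame[OF R(1)]) (use 10(3) in auto)
    have rN: "r < N_bound" "N' < N_bound" using 10(1) N N'(2) by linarith+
    have rec: "?x \<in> records p k A n" by (rule X[OF 10(1)])
    have ov: "over 0 ?x" by (rule over_records[OF rec]) simp
    have shp: "wp orc G load_shape (\<lambda>l out R' M'. l \<le> p * 4 + 1 \<and> out = [] \<and> (\<forall>j<p. M' 8 j = ?x j)) R1 M1"
      by (rule wp_mono[OF wp_load_shape[OF c1 10(2) rN(1)]]) (use ov m1 in auto)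
    show ?case
    proof (subst wp_Seq, rule wp_frame[OF shp], goal_cases)
      case (1 k2 out2 R2 M2)
      have c2: "const_regs R2" by (rule const_regs_frame[OF c1]) (use 1(2) in auto)
      have e2: "R2 9 = real N'" "R2 54 = real r" "M2 1 = M 1" "M2 2 = M1 2"
        using 1(2)[of 9] 1(2)[of 54] 1(3) N'(1) 10(2) m1 by simp_all
      have "map (M2 8) [0..<p] = map ?x [0..<p]" using 1(1) by (intro map_cong) auto
      then have mq: "map (M2 8) [0..<p] = map real (shape_of p ?x)"
        using shape_of_record(1)[OF rec] by (rule trans)
      have q: "R2 0 = real p" "map (M2 8) [0..<p] = map real (shape_of p ?x)"
        "orc (shape_of p ?x) = Some (shape_of p ?x \<in> \<Lambda>)"
        using c2 shape_of_record(2)[OF rec] mq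
        by (simp_all only: const_regs_def orc shape_oracle_def if_True)
      let ?b = "shape_of p ?x \<in> \<Lambda>"
      let ?R3 = "R2(58 := of_bool ?b)"
      have c3: "const_regs ?R3" using c2 by (simp add: const_regs_def)
      have img: "{x \<in> mrow w (M 1) ` {..<Suc r}. shape_of p x \<in> \<Lambda>} =
        (if ?b then insert ?x {x \<in> mrow w (M 1) ` {..<r}. shape_of p x \<in> \<Lambda>} else {x \<in> mrow w (M 1) ` {..<r}. shape_of p x \<in> \<Lambda>})"
        by (auto simp: less_Suc_eq)
      let ?P = "\<lambda>R' M'. \<exists>N'. R' 9 = real N' \<and> N' \<le> Suc r
        \<and> mrow w (M' 2) ` {..<N'} = erase p ` {x \<in> mrow w (M 1) ` {..<Suc r}. shape_of p x \<in> \<Lambda>}"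
      have step: "wp orc G (If (Equal 58 3) keep_row Skip)
        (\<lambda>l out R' M'. l \<le> 1 + (12 * w + 3 + (p * 3 + 1)) \<and> out = [] \<and> ?P R' M') ?R3 M2"
      proof (cases ?b)
        case True
        have "wp orc G keep_row (\<lambda>l out R' M'. l \<le> 12 * w + 3 + (p * 3 + 1) \<and> out = [] \<and> R' 9 = real (Suc N')
          \<and> (\<forall>s. mrow w (M' 2) s = (if s = N' then erase p ?x else mrow w (M2 2) s))) ?R3 M2"
          by (rule wp_keep_row[OF c3 _ _ rN]) (use e2 ov in auto)
        then have "wp orc G keep_row (\<lambda>l out R' M'. Suc l \<le> 1 + (12 * w + 3 + (p * 3 + 1)) \<and> out = [] \<and> ?P R' M') ?R3 M2"
        proof (rule wp_mono, goal_cases)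
          case (1 l out R' M')
          have "mrow w (M' 2) ` {..<N'} = mrow w (M1 2) ` {..<N'}" using 1 e2 by (intro image_cong) auto
          moreover have "mrow w (M' 2) N' = erase p ?x" using 1 by simp
          moreover have "mrow w (M' 2) ` {..<Suc N'} = insert (mrow w (M' 2) N') (mrow w (M' 2) ` {..<N'})"
            by (simp only: lessThan_Suc image_insert)
          ultimately have "mrow w (M' 2) ` {..<Suc N'} = erase p ` {x \<in> mrow w (M 1) ` {..<Suc r}. shape_of p x \<in> \<Lambda>}"
            unfolding img using N'(3) True by (simp only: if_True image_insert)
          then show ?case using 1 N'(2) by (intro conjI exI[of _ "Suc N'"]) auto
        qed
        then show ?thesis unfolding wp_If using True c2 by (simp add: const_regs_def)
      next
        case False
        have same: "{x \<in> mrow w (M 1) ` {..<Suc r}. shape_of p x \<in> \<Lambda>} = {x \<in> mrow w (M 1) ` {..<r}. shape_of p x \<in> \<Lambda>}"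
          using img False by (simp only: if_False)
        have "?P ?R3 M2" unfolding same e2(4) using e2(1) N' by (intro exI[of _ N'] conjI) (simp_all only: fun_upd_apply, simp_all)
        then show ?thesis unfolding wp_If wp_basic using False c2 by (simp add: const_regs_def)
      qed
      have G58: "of_bool ?b \<in> G" using g01 by (cases ?b) auto
      have "wp orc G (If (Equal 58 3) keep_row Skip)
        (\<lambda>l out R' M'. k2 + (1 + l) \<le> p * 4 + 1 + 2 + (12 * w + 3 + (p * 3 + 1)) \<and> out2 @ [] @ out = [] \<and> ?P (R'(54 := real (Suc r))) M') ?R3 M2"
        by (rule wp_mono[OF step]) (use 1(1) in auto)
      then show ?case unfolding wp_Seq by (intro wp_Query[where R = R2 and M = M2 and a = 8 and y = 0 and x = 58 and orc = orc and G = G and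
          m = p and l = "shape_of p ?x" and b = ?b, OF q G58])
    qed
  next
    case (11 l R' M')
    then show ?case unfolding cost_select_def by simp
  qed (use R N small_nat_G(2) in \<open>auto simp: const_regs_def\<close>)
  then show ?thesis unfolding select_rows_def wp_Seq wp_basic using g01 by simp
qed

definition "cost_print N = N * ((3 + (k * p * 3 + 1)) + 2) + 1" for N :: nat

lemma wp_print_rows:
  assumes R: "const_regs R" "R 8 = real N" and N: "N \<le> N_bound"
    and X: "\<And>r. r < N \<Longrightarrow> over 0 (mrow w (M 1) r)"
  shows "wp orc G print_rows (\<lambda>l out R' M'. l \<le> cost_print N
      \<and> out = concat (map (\<lambda>r. entries k p (to_matrix k p (mrow w (M 1) r))) [0..<N])) R M"
proof -
  have ent: "entries k p (to_matrix k p x) = map (\<lambda>i. x (p + i)) [0..<k * p]" for x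
  proof -
    have "entries k p (to_matrix k p x) = concat (map (\<lambda>i. map (\<lambda>j. x (p + (i * p + j))) [0..<p]) [0..<k])"
      unfolding entries_def to_matrix_def
      by (intro arg_cong[of _ _ concat] map_cong) (auto simp: add.assoc)
    then show ?thesis using concat_grid[of "\<lambda>i. x (p + i)" p k] by simp
  qed
  have w_kp: "w = k * p + p" unfolding w_eq by simp
  have gkp: "real i \<in> G" if "i \<le> k * p" for i using that w_kp by (intro small_nat_G(3)) simp
  show ?thesis
    unfolding print_rows_def
  proof (rule wp_For[where m = N and K = "3 + (k * p * 3 + 1)" and I = "\<lambda>_ _ _. True" and
      f = "\<lambda>r. entries k p (to_matrix k p (mrow w (M 1) r))"], goal_cases)
    case (10 r R1 M1)
    let ?x = "mrow w (M 1) r"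
    have c1: "const_regs R1" by (rule const_regs_frame[OF R(1)]) (use 10(3) in auto)
    have e1: "R1 54 = real r" "R1 6 = real w" "R1 0 = real p" "M1 1 = M 1" using 10(2,4) c1 by (simp_all add: const_regs_def)
    have rB: "r * w + w \<le> B" using row_B 10(1) N by simp
    have "real (r * w) \<in> G" "real (r * w + p) \<in> G" by (rule nat_G, use rB p_w in simp)+
    then have g: "real r * real w \<in> G" "real r * real w + real p \<in> G" by simp_all
    have kp: "real w - real p = real (k * p)" unfolding w_kp by simp
    let ?R2 = "R1(57 := real r * real w + real p, 59 := real (k * p))"
    have loop: "wp orc G (For 56 59 (Load 58 1 57 ;; Output 58 ;; Arith Plus 57 57 3))
      (\<lambda>l out R' M'. l \<le> k * p * 3 + 1 \<and> out = entries k p (to_matrix k p ?x)) ?R2 M1"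
    proof (rule wp_For[where m = "k * p" and K = 1 and f = "\<lambda>i. [?x (p + i)]" and
        I = "\<lambda>i R' M'. R' 57 = real (r * w + (p + i))"], goal_cases)
      case (10 i R2 M2)
      have c: "p + i < w" using 10(1) w_kp by simp
      have v: "M2 1 (r * w + (p + i)) = ?x (p + i)" "?x (p + i) \<in> G"
        using 10(4) e1 c X[OF \<open>r < N\<close>] in_G[of _ 0] by (auto simp: mrow_apply over_def)
      have "real (Suc (r * w + (p + i))) \<in> G" by (rule nat_G) (use rB c in simp)
      then have g2: "real (r * w + (p + i)) + 1 \<in> G" by (simp add: add.commute)
      have e2: "R2 3 = 1" using 10(3)[of 3] c1 by (simp add: const_regs_def)
      show ?case unfolding wp_simps arith_val.simps using v g2 e2 10(5)
        by (simp del: of_nat_add of_nat_mult)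
    next
      case (11 l out R2 M2)
      have "concat (map (\<lambda>i. [?x (p + i)]) xs) = map (\<lambda>i. ?x (p + i)) xs" for xs by (induction xs) auto
      then show ?case using 11(1,2) unfolding ent by simp
    qed (use c1 gkp in \<open>auto simp: const_regs_def\<close>)
    have "wp orc G (For 56 59 (Load 58 1 57 ;; Output 58 ;; Arith Plus 57 57 3))
      (\<lambda>l out R' M'. 1 + (1 + (1 + l)) \<le> 3 + (k * p * 3 + 1) \<and> [] @ [] @ [] @ out = entries k p (to_matrix k p ?x) \<and> True) ?R2 M1"
      by (rule wp_mono[OF loop]) auto
    then show ?case
      unfolding wp_Seq[of _ _ "Arith Times 57 54 6"] wp_Seq[of _ _ "Arith Plus 57 57 0"] wp_Seq[of _ _ "Arith Minus 59 6 0"]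
        wp_Arith arith_val.simps using e1 g gkp[of "k * p"] kp by simp
  next
    case (11 l out R' M')
    then show ?case unfolding cost_print_def by simp
  qed (use R N small_nat_G(2) in \<open>auto simp: const_regs_def\<close>)
qed

lemma wp_init:
  assumes "R 0 = real p" "R 1 = real k"
    and Q: "\<And>R'. const_regs R' \<Longrightarrow> R' 8 = 1 \<Longrightarrow> (\<And>x. x < 3 \<Longrightarrow> R' x = R x) \<Longrightarrow> Q 5 [] R' M"
  shows "wp orc G init Q R M"
proof -
  have "k + 1 \<le> (k + 1) * p" using mult_le_mono2[of 1 p "k + 1"] p_pos by simp
  then have "k + 1 \<le> w" unfolding w_eq .
  then have "real (k + 1) \<in> G" "real w \<in> G" using small_nat_G(3)[of "k + 1"] small_nat_G(3)[of w] by blast+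
  moreover have "real (k + 1) = real k + 1" "real w = (real k + 1) * real p" by (simp_all add: w_eq algebra_simps)
  ultimately have g: "real k + 1 \<in> G" "(real k + 1) * real p \<in> G" by (simp_all only:)
  have le: "(p - 1) * k \<le> p * k" by (intro mult_le_mono1) simp
  have "w = p * k + p" unfolding w_eq by (simp add: algebra_simps)
  then have "(p - 1) * k + 1 \<le> w" using le p_pos by linarith
  then have "(p - 1) * k \<le> w" "(p - 1) * k + 1 \<le> w" by linarith+
  then have "real ((p - 1) * k) \<in> G" "real ((p - 1) * k + 1) \<in> G" using small_nat_G(3) by blast+
  moreover have pm: "real (p - 1) = real p - 1" using p_pos by (simp add: of_nat_diff)
  moreover have "real (p - 1) \<in> G" by (rule p_G) simp
  ultimately have g2: "real p - 1 \<in> G" "(real p - 1) * real k \<in> G" "(real p - 1) * real k + 1 \<in> G" by (simp_all add: add.commute)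
  have T: "(real p - 1) * real k + 1 = real T" unfolding T_def using pm by (simp add: mult.commute)
  have W: "(real k + 1) * real p = real w" unfolding w_eq by (simp add: algebra_simps)
  have "Q 5 [] (R(3 := 1, 4 := 0, 5 := - 1, 6 := (real k + 1) * real p, 7 := (real p - 1) * real k + 1, 8 := 1)) M"
    by (rule Q) (auto simp: assms T W const_regs_def)
  moreover have "(5::nat) = Suc (Suc (Suc (Suc (Suc 0))))" by simp
  ultimately show ?thesis
    unfolding init_def wp_simps arith_val.simps
    by (simp only:) (simp add: assms(1) assms(2)[unfolded One_nat_def] g g2 g01)
qed

lemma cost_test_mono: "N \<le> N' \<Longrightarrow> cost_test N \<le> cost_test N'"
  unfolding cost_test_def by (intro add_mono mult_le_mono power_mono order_refl) auto

lemma cost_filter_mono: "N \<le> N' \<Longrightarrow> cost_filter N \<le> cost_filter N'"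
  using cost_test_mono[of N N'] unfolding cost_filter_def cost_mark_def
  by (intro add_mono mult_le_mono order_refl) auto

lemma cost_monos:
  "N \<le> N' \<Longrightarrow> cost_extend N \<le> cost_extend N'"
  "N \<le> N' \<Longrightarrow> cost_select N \<le> cost_select N'"
  "N \<le> N' \<Longrightarrow> cost_print N \<le> cost_print N'"
  unfolding cost_extend_def cost_select_def cost_print_def by (intro add_mono mult_le_mono order_refl; assumption)+

text \<open>Records are kept without repetition, so their number is the cardinality of an irredundant set.\<close>

lemma bounded_count:
  assumes "m \<le> n" "inj_on f {..<N}" "generates p (f ` {..<N}) (records p k A m)" "irredundant p w (f ` {..<N})"
  shows "N \<le> S_bound"
proof -
  have "N = card (f ` {..<N})" using card_image[OF assms(2)] by simp
  also have "\<dots> \<le> ((m + 1) ^ (k + 1)) ^ (p * (p - 1) div 2)"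
    using card_irredundant[OF assms(3)] assms(4) unfolding w_eq by blast
  also have "\<dots> \<le> S_bound" unfolding S_bound_def using assms(1) by (intro power_mono) auto
  finally show ?thesis .
qed

lemma filter_bounds:
  assumes "N \<le> N_bound"
  shows "N * w + w \<le> B" "N ^ T \<le> B"
proof -
  show "N * w + w \<le> B" using mult_le_mono1[OF assms, of w] B1 by linarith
  show "N ^ T \<le> B" using power_mono[OF assms, of T] B3 by linarith
qed

definition "stage m R M \<longleftrightarrow> (\<exists>N. R 8 = real N \<and> inj_on (mrow w (M 1)) {..<N}
   \<and> irredundant p w (mrow w (M 1) ` {..<N}) \<and> generates p (mrow w (M 1) ` {..<N}) (records p k A m))"
  for R :: regs and M :: arrs

definition "cost_stage = cost_increments + cost_extend S_bound + cost_filter N_bound"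

text \<open>The candidates generate the records of \<open>m + 1\<close> columns because the kept ones generate those of \<open>m\<close>
  columns, and the filter preserves what they generate.\<close>

lemma wp_stage:
  assumes R: "const_regs R" "R 1 = real k" "R 2 = real n" "R 10 = real m" "m < n"
    and M: "input_stored M" "clean M" "stage m R M"
  shows "wp orc G (increments ;; extend_rows ;; filter_rows)
    (\<lambda>l out R' M'. l \<le> cost_stage \<and> out = [] \<and> clean M' \<and> stage (Suc m) R' M') R M"
proof -
  obtain N where N: "R 8 = real N" "inj_on (mrow w (M 1)) {..<N}"
    "irredundant p w (mrow w (M 1) ` {..<N})" "generates p (mrow w (M 1) ` {..<N}) (records p k A m)"
    using M(3) unfolding stage_def by blast
  have NS: "N \<le> S_bound" by (rule bounded_count[OF _ N(2,4,3)]) (use R(5) in simp)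
  then have Np: "N * p \<le> N_bound" unfolding N_bound_def using mult_le_mono1[of N S_bound p] by (simp add: mult.commute)
  have rec: "mrow w (M 1) r \<in> records p k A m" if "r < N" for r
    using N(4) that unfolding generates_def by blast
  let ?Z = "{x + inc p k A m j |x j. x \<in> mrow w (M 1) ` {..<N} \<and> j < p}"
  have Z: "generates p ?Z (records p k A (Suc m))" by (rule generates_extend[OF N(4)])
  show ?thesis
  proof (subst wp_Seq, rule wp_frame[OF wp_increments[OF R M(1,2)]], goal_cases)
    case (1 k1 out1 R1 M1)
    have c1: "const_regs R1" by (rule const_regs_frame[OF R(1)]) (use 1(2) in auto)
    have e1: "R1 8 = real N" "M1 1 = M 1" using 1(2)[of 8] 1(3)[of 1] N(1) by simp_all
    have inc1: "mrow w (M1 3) j = inc p k A m j" if "j < p" for j using 1(1) that by blast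
    have ext: "wp orc G extend_rows (\<lambda>l out R' M'. l \<le> cost_extend N \<and> out = [] \<and> R' 9 = real (N * p)
      \<and> mrow w (M' 2) ` {..<N * p} = {x + inc p k A m j |x j. x \<in> mrow w (M1 1) ` {..<N} \<and> j < p}) R1 M1"
      by (rule wp_extend_rows[where v = "inc p k A m", OF c1 e1(1) Np])
        (use inc1 over_inc[OF R(5)] over_records[OF rec] R(5) e1 in auto)
    show ?case
    proof (subst wp_Seq, rule wp_frame[OF ext], goal_cases)
      case (1 k2 out2 R2 M2)
      have c2: "const_regs R2" by (rule const_regs_frame[OF c1]) (use 1(2) in auto)
      have rows2: "mrow w (M2 2) ` {..<N * p} = ?Z" using 1(1) unfolding e1(2) by blast
      have recs2: "mrow w (M2 2) r \<in> records p k A (Suc m)" if "r < N * p" for r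
        using Z rows2 that unfolding generates_def by blast
      have m3: "M2 3 = M1 3" using 1(3) by simp
      have fil: "wp orc G filter_rows (\<lambda>l out R' M'. l \<le> cost_filter (N * p) \<and> out = [] \<and> (\<exists>N'. R' 8 = real N'
        \<and> inj_on (mrow w (M' 1)) {..<N'} \<and> irredundant p w (mrow w (M' 1) ` {..<N'})
        \<and> generates p (mrow w (M' 1) ` {..<N'}) (mrow w (M2 2) ` {..<N * p}))) R2 M2"
      proof (rule wp_filter_rows[OF c2 _ filter_bounds(1)[OF Np] B2 filter_bounds(2)[OF Np]], goal_cases)
        case 1
        show ?case using \<open>k2 \<le> _ \<and> _\<close> by blast
      next
        case (2 r)
        then show ?case using over_records[OF recs2] R(5) by simp
      next
        case (3 r)
        then show ?case using record_shape_coord[OF recs2] by simp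
      next
        case 4
        show ?case by (rule balanced_subset[OF balanced_records[of p k A "Suc m"]]) (use recs2 in auto)
      qed
      show ?case
      proof (rule wp_frame[OF fil], goal_cases)
        case (1 k3 out3 R3 M3)
        have "k1 + (k2 + k3) \<le> cost_stage"
          using \<open>k1 \<le> _ \<and> _\<close> \<open>k2 \<le> _ \<and> _\<close> 1(1) cost_monos(1)[OF NS] cost_filter_mono[OF Np]
          unfolding cost_stage_def by linarith
        moreover have "mrow w (M3 3) j = inc p k A m j" if "j < p" for j using 1(3)[of 3] m3 inc1[OF that] by simp
        then have "clean M3" unfolding clean_def by (auto simp: inc_def)
        moreover have "stage (Suc m) R3 M3"
          unfolding stage_def using 1(1) generates_trans[OF _ Z] unfolding rows2 by blast
        ultimately show ?case using \<open>k1 \<le> _ \<and> _\<close> \<open>k2 \<le> _ \<and> _\<close> 1(1) by blast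
      qed
    qed
  qed
qed

definition "cost_main = 5 + (n * (cost_stage + 2) + 1)
  + (cost_select S_bound + (cost_filter N_bound + cost_print N_bound))"

theorem wp_main:
  assumes R: "R 0 = real p" "R 1 = real k" "R 2 = real n" and M: "input_stored M" "\<And>a i. a \<noteq> 0 \<Longrightarrow> M a i = 0"
  shows "wp orc G enumerate_vertices (\<lambda>l out R' M'. l \<le> cost_main
    \<and> enumerates k p out (vertices (shaped_partition_polytope p k n A \<Lambda>))) R M"
  unfolding enumerate_vertices_def
proof (subst wp_Seq, rule wp_init[OF R(1,2)], goal_cases)
  case (1 R0)
  have r0: "R0 1 = real k" "R0 2 = real n" using 1(3) R by simp_all
  have zero: "mrow w (M a) r = 0" if "a \<noteq> 0" for a r using M(2)[OF that] by (auto simp: mrow_def fun_eq_iff)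
  show ?case
  proof (subst wp_Seq, rule wp_For_silent[where m = n and K = cost_stage and I = "\<lambda>m R' M'. clean M' \<and> stage m R' M'"], goal_cases)
    case 9
    have "stage 0 R0 M"
      unfolding stage_def
    proof (intro exI[of _ 1] conjI)
      have S: "mrow w (M 1) ` {..<1} = {0}" using zero[of 1 0] by auto
      show "R0 8 = real 1" using 1(2) by simp
      show "inj_on (mrow w (M 1)) {..<1}" by (auto simp: inj_on_def)
      show "irredundant p w (mrow w (M 1) ` {..<1})"
        unfolding S irredundant_def separable_def by auto
      show "generates p (mrow w (M 1) ` {..<1}) (records p k A 0)"
        unfolding S records_0 generates_def by (auto intro!: hull_inc simp: same_shape_def)
    qed
    moreover have "clean M" unfolding clean_def using zero[of 3] by simp
    ultimately show ?case by (simp add: stage_def)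
  next
    case (10 m R1 M1)
    have "const_regs R1" by (rule const_regs_frame[OF 1(1)]) (use 10(3) in auto)
    moreover have "R1 1 = real k" "R1 2 = real n" using 10(3)[of 1] 10(3)[of 2] r0 by simp_all
    moreover have "input_stored M1" using M(1) 10(4)[of 0] by (simp add: input_stored_def)
    ultimately have "wp orc G (increments ;; extend_rows ;; filter_rows)
      (\<lambda>l out R' M'. l \<le> cost_stage \<and> out = [] \<and> clean M' \<and> stage (Suc m) R' M') R1 M1"
      using 10 by (intro wp_stage) auto
    then show ?case by (rule wp_mono) (auto simp: stage_def)
  next
    case (11 k1 R1 M1)
    have c1: "const_regs R1" by (rule const_regs_frame[OF 1(1)]) (use 11(2) in auto)
    obtain N where N: "R1 8 = real N" "inj_on (mrow w (M1 1)) {..<N}"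
      "irredundant p w (mrow w (M1 1) ` {..<N})" "generates p (mrow w (M1 1) ` {..<N}) (records p k A n)"
      using 11(4) unfolding stage_def by blast
    have NS: "N \<le> S_bound" by (rule bounded_count[OF _ N(2,4,3)]) simp
    then have NB: "N \<le> N_bound" using p_N_bound by linarith
    have rec: "mrow w (M1 1) r \<in> records p k A n" if "r < N" for r
      using N(4) that unfolding generates_def by blast
    let ?Z = "erase p ` {x \<in> mrow w (M1 1) ` {..<N}. shape_of p x \<in> \<Lambda>}"
    let ?R = "erase p ` {x \<in> records p k A n. shape_of p x \<in> \<Lambda>}"
    have Z: "generates p ?Z ?R" by (rule generates_selected[OF N(4)])
    have R_over: "over 0 x" "x 0 = 0" if "x \<in> ?R" for x
      using that over_records[of _ n] D_consts p_pos by (auto simp: over_def erase_def)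
    have sel: "wp orc G select_rows (\<lambda>l out R' M'. l \<le> cost_select N \<and> out = [] \<and> (\<exists>N'. R' 9 = real N' \<and> N' \<le> N
      \<and> mrow w (M' 2) ` {..<N'} = ?Z)) R1 M1"
      by (intro wp_select_rows c1 N(1) NB rec)
    show ?case
    proof (subst wp_Seq, rule wp_frame[OF sel], goal_cases)
      case (1 k2 out2 R2 M2)
      note A = 1
      obtain N2 where N2: "R2 9 = real N2" "N2 \<le> N" "mrow w (M2 2) ` {..<N2} = ?Z" using A(1) by blast
      have c2: "const_regs R2" by (rule const_regs_frame[OF c1]) (use A(2) in auto)
      have N2B: "N2 \<le> N_bound" using N2(2) NB by linarith
      have rows: "mrow w (M2 2) r \<in> ?R" if "r < N2" for r
        using Z that unfolding N2(3)[symmetric] generates_def by blast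
      have fil: "wp orc G filter_rows (\<lambda>l out R' M'. l \<le> cost_filter N2 \<and> out = [] \<and> (\<exists>N'. R' 8 = real N'
        \<and> inj_on (mrow w (M' 1)) {..<N'} \<and> irredundant p w (mrow w (M' 1) ` {..<N'})
        \<and> generates p (mrow w (M' 1) ` {..<N'}) (mrow w (M2 2) ` {..<N2}))) R2 M2"
      proof (rule wp_filter_rows[OF c2 N2(1) filter_bounds(1)[OF N2B] B2 filter_bounds(2)[OF N2B]], goal_cases)
        case (1 r)
        then show ?case by (rule R_over(1)[OF rows])
      next
        case (2 r)
        then show ?case using R_over(2)[OF rows] by simp
      next
        case 3
        have "balanced p k {x \<in> records p k A n. shape_of p x \<in> \<Lambda>}"
          by (rule balanced_subset[OF balanced_records]) blast
        then show ?case by (rule balanced_subset[OF balanced_erased]) (use rows in blast)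
      qed
      show ?case
      proof (subst wp_Seq, rule wp_frame[OF fil], goal_cases)
        case (1 k3 out3 R3 M3)
        obtain N3 where N3: "R3 8 = real N3" "inj_on (mrow w (M3 1)) {..<N3}" "irredundant p w (mrow w (M3 1) ` {..<N3})"
          "generates p (mrow w (M3 1) ` {..<N3}) ?Z" using 1(1) unfolding N2(3) by blast
        have c3: "const_regs R3" by (rule const_regs_frame[OF c2]) (use 1(2) in auto)
        let ?S = "mrow w (M3 1) ` {..<N3}"
        have gen: "generates p ?S ?R" by (rule generates_trans[OF N3(4) Z])
        have "irredundant p ((k + 1) * p) ?S" using N3(3) by (simp only: w_eq[symmetric])
        note vert = vertices_of_polytope[OF p_pos gen this]
        have "?S \<subseteq> mrow w (M2 2) ` {..<N2}" using N3(4) unfolding generates_def N2(3) by blast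
        then have "card ?S \<le> N2" using card_mono[of "mrow w (M2 2) ` {..<N2}" ?S] card_image_le[of "{..<N2}" "mrow w (M2 2)"] by simp
        then have N3B: "N3 \<le> N_bound" using card_image[OF N3(2)] N2B by simp
        have ov3: "over 0 (mrow w (M3 1) r)" if "r < N3" for r
          using R_over(1) gen that unfolding generates_def by blast
        have "wp orc G print_rows (\<lambda>l out R' M'. l \<le> cost_print N3
          \<and> out = concat (map (\<lambda>r. entries k p (to_matrix k p (mrow w (M3 1) r))) [0..<N3])) R3 M3"
          by (intro wp_print_rows c3 N3(1) N3B ov3)
        then show ?case
        proof (rule wp_mono, goal_cases)
          case (1 k4 out4 R4 M4)
          let ?Vs = "map (\<lambda>r. to_matrix k p (mrow w (M3 1) r)) [0..<N3]"
          have "distinct ?Vs"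
            using N3(2) vert(2) by (auto simp: distinct_map inj_on_def lessThan_atLeast0)
          moreover have "set ?Vs = vertices (shaped_partition_polytope p k n A \<Lambda>)"
            unfolding vert(1) by (auto simp: lessThan_atLeast0)
          moreover have "out4 = concat (map (entries k p) ?Vs)" using 1 by (simp add: comp_def)
          ultimately have "enumerates k p out4 (vertices (shaped_partition_polytope p k n A \<Lambda>))"
            unfolding enumerates_def by blast
          moreover have "5 + (k1 + (k2 + (k3 + k4))) \<le> cost_main"
            using 11(1) \<open>k2 \<le> _ \<and> _\<close> \<open>k3 \<le> _ \<and> _\<close> 1 cost_monos(2)[OF NS] cost_filter_mono[OF N2B] cost_monos(3)[OF N3B]
            unfolding cost_main_def by linarith
          ultimately show ?case using \<open>k2 \<le> _ \<and> _\<close> \<open>k3 \<le> _ \<and> _\<close> by simp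
        qed
      qed
    qed
  qed (use 1(1) r0 n_G in \<open>auto simp: const_regs_def\<close>)
qed

end

section \<open>The number of operations\<close>

text \<open>The exponents of the number of kept records and of the number of tests on them: there are
  \<open>k * (p - 1) + 2\<close> candidates in a test, the tested one included, and the factor for the \<open>n\<close> columns adds
  one.\<close>

lemma exponent_bound:
  fixes k p :: nat
  assumes "0 < k" "0 < p"
  shows "(k + 1) * (p * (p - 1) div 2) * (k * (p - 1) + 2) + 1 \<le> k\<^sup>2 * p ^ 3"
proof -
  obtain q where q: "p = q + 1" using assms(2) by (cases p) auto
  define h where "h = p * (p - 1) div 2"
  have "2 * h \<le> p * (p - 1)" by (simp add: h_def)
  moreover have "k + 1 \<le> 2 * k" using assms(1) by simp
  ultimately have "(k + 1) * (2 * h) \<le> (2 * k) * (p * (p - 1))"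
    by (intro mult_le_mono[of "k + 1" "2 * k" "2 * h" "p * (p - 1)"])
  moreover have "(k + 1) * (2 * h) = 2 * ((k + 1) * h)" "(2 * k) * (p * (p - 1)) = 2 * (k * (q * (q + 1)))"
    by (simp_all add: q algebra_simps)
  ultimately have e: "(k + 1) * h \<le> k * (q * (q + 1))" by linarith
  have "1 * (2 * q + 1) \<le> k * (2 * q + 1)" using assms(1) by (intro mult_le_mono1) simp
  then have "k * (q + 1) * (2 * q + 1) \<le> k * (q + 1) * (k * (2 * q + 1))" by (intro mult_le_mono2) simp
  moreover have "1 \<le> k * (q + 1)" using assms(1) by simp
  ultimately have "k * (q * (q + 1)) * (k * q + 2) + 1 \<le> k\<^sup>2 * (q + 1) ^ 3"
    by (simp add: power2_eq_square power3_eq_cube algebra_simps)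
  moreover have "(k + 1) * h * (k * q + 2) \<le> k * (q * (q + 1)) * (k * q + 2)"
    using e by (rule mult_le_mono1)
  ultimately have "(k + 1) * h * (k * q + 2) + 1 \<le> k\<^sup>2 * (q + 1) ^ 3" by linarith
  then show ?thesis unfolding h_def q by simp
qed

text \<open>The constant of the time bound, composed in the same way as the program.\<close>

definition elim_factor :: "nat \<Rightarrow> nat \<Rightarrow> nat" where
  "elim_factor w U = w * (24 * w * (U * U) + 19 * (U * U) + 2 + 2) + 1"

definition filter_factor :: "nat \<Rightarrow> nat \<Rightarrow> nat" where
  "filter_factor w T = 3 * T + 3 + (12 * w + 5 + (2 * T + 4 + (T * (12 * w + 3) + 1 + elim_factor w (T ^ 2 ^ w) + 1 + (T * 4 + 1))))
     + (12 * w + 6)"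

definition cost_factor :: "nat \<Rightarrow> nat \<Rightarrow> nat" where
  "cost_factor k p = (let w = (k + 1) * p; T = k * (p - 1) + 1 in
     (5 + ((p * ((2 + (k * 5 + 1)) + 2) + 1 + (p * (12 * w + 5) + 5) + filter_factor w T + 2) + 1)
       + ((p * 4 + 1 + 2 + (12 * w + 3 + (p * 3 + 1))) + 3 + (filter_factor w T + ((3 + (k * p * 3 + 1)) + 3))))
     * (p ^ (T + 1) * 2 ^ ((k + 1) * (p * (p - 1) div 2) * (T + 1))))"

context sized_run
begin

text \<open>As \<open>n\<close> is positive, \<open>n + 1 \<le> 2 * n\<close>; this costs a factor that depends on \<open>k\<close> and \<open>p\<close> only.\<close>

lemma N_bound_power: "N_bound ^ (T + 1) * n
    \<le> p ^ (T + 1) * 2 ^ ((k + 1) * (p * (p - 1) div 2) * (T + 1)) * n ^ (k\<^sup>2 * p ^ 3)"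
proof -
  let ?e = "(k + 1) * (p * (p - 1) div 2) * (T + 1)"
  have "N_bound ^ (T + 1) = p ^ (T + 1) * (n + 1) ^ ?e"
    unfolding N_bound_def S_bound_def by (simp only: power_mult_distrib power_mult[symmetric] mult.assoc)
  moreover have "(n + 1) ^ ?e \<le> (2 * n) ^ ?e" using n_pos by (intro power_mono) auto
  moreover have "(2 * n) ^ ?e = 2 ^ ?e * n ^ ?e" by (rule power_mult_distrib)
  ultimately have "N_bound ^ (T + 1) * n \<le> p ^ (T + 1) * (2 ^ ?e * n ^ ?e) * n"
    by (intro mult_le_mono1) (simp only:, intro mult_le_mono2, simp only:)
  also have "\<dots> = p ^ (T + 1) * 2 ^ ?e * n ^ (?e + 1)" by simp
  also have "\<dots> \<le> p ^ (T + 1) * 2 ^ ?e * n ^ (k\<^sup>2 * p ^ 3)"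
  proof (intro mult_le_mono2 power_increasing)
    show "?e + 1 \<le> k\<^sup>2 * p ^ 3"
      using exponent_bound[OF k_pos p_pos] unfolding T_def by (simp only: add.assoc one_add_one)
  qed (use n_pos in simp)
  finally show ?thesis .
qed

lemma cost_filter_bound:
  assumes "1 \<le> N"
  shows "cost_filter N \<le> filter_factor w T * N ^ (T + 1)"
proof -
  let ?Y = "N ^ T"
  have Y: "1 \<le> ?Y" using assms by simp
  then have NY: "1 \<le> N * ?Y" "N \<le> N * ?Y" using assms by auto
  have tup: "cost_tuple = T * (12 * w + 3) + 1 + elim_factor w (T ^ 2 ^ w) + 1 + (T * 4 + 1)"
    unfolding cost_tuple_def cost_elim_def cost_elim_step_def elim_factor_def by simp
  define b where "b = 2 * T + 4 + cost_tuple"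
  have "cost_test N = (2 * T + 2) * 1 + (cost_tuple + 2) * ?Y" unfolding cost_test_def by simp
  also have "\<dots> \<le> (2 * T + 2) * ?Y + (cost_tuple + 2) * ?Y" using Y by (intro add_mono mult_le_mono2) auto
  also have "\<dots> = b * ?Y" unfolding b_def by (simp add: algebra_simps)
  finally have "cost_mark N + 2 \<le> (12 * w + 5) * 1 + b * ?Y" unfolding cost_mark_def by simp
  also have "\<dots> \<le> (12 * w + 5) * ?Y + b * ?Y" using Y by (intro add_mono mult_le_mono2) auto
  finally have m: "cost_mark N + 2 \<le> (12 * w + 5 + b) * ?Y" by (simp add: algebra_simps)
  have "cost_filter N \<le> (3 * T + 3) * 1 + N * ((12 * w + 5 + b) * ?Y) + (12 * w + 6) * N"
    unfolding cost_filter_def using mult_le_mono2[OF m, of N] by (simp add: algebra_simps)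
  also have "\<dots> \<le> (3 * T + 3) * (N * ?Y) + N * ((12 * w + 5 + b) * ?Y) + (12 * w + 6) * (N * ?Y)"
    using NY by (intro add_mono mult_le_mono2 order_refl) auto
  also have "\<dots> = (3 * T + 3 + (12 * w + 5 + b) + (12 * w + 6)) * (N * ?Y)" by (simp add: algebra_simps)
  also have "\<dots> = filter_factor w T * N ^ (T + 1)" unfolding filter_factor_def b_def tup by simp
  finally show ?thesis .
qed

lemma cost_main_bound: "cost_main \<le> cost_factor k p * n ^ (k\<^sup>2 * p ^ 3)"
proof -
  let ?X = "N_bound ^ (T + 1)"
  let ?F = "filter_factor w T"
  have N1: "1 \<le> N_bound" using S_bound_pos p_N_bound by linarith
  have X1: "1 \<le> ?X" using N1 by simp
  have "N_bound \<le> ?X" by (rule self_le_power) (use N1 in auto)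
  note NX = this
  then have SX: "S_bound \<le> ?X" using p_N_bound(2) by linarith
  have fil: "cost_filter N_bound \<le> ?F * ?X" by (rule cost_filter_bound[OF N1])
  have lin: "N * a + c \<le> (a + c) * ?X" if "N \<le> ?X" for N a c
  proof -
    have "N * a + c * 1 \<le> ?X * a + c * ?X" using that X1 by (intro add_mono mult_le_mono) auto
    then show ?thesis by (simp add: algebra_simps)
  qed
  have ext: "cost_extend S_bound \<le> (p * (12 * w + 5) + 5) * ?X"
    unfolding cost_extend_def using lin[OF SX, of "p * (12 * w + 5) + 3" 2] by (simp add: add.commute)
  have sel: "cost_select S_bound \<le> ((p * 4 + 1 + 2 + (12 * w + 3 + (p * 3 + 1))) + 3) * ?X"
    unfolding cost_select_def using lin[OF SX, of "(p * 4 + 1 + 2 + (12 * w + 3 + (p * 3 + 1))) + 2" 1] by simp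
  have pri: "cost_print N_bound \<le> ((3 + (k * p * 3 + 1)) + 3) * ?X"
    unfolding cost_print_def using lin[OF NX, of "(3 + (k * p * 3 + 1)) + 2" 1] by simp
  let ?i = "p * ((2 + (k * 5 + 1)) + 2) + 1"
  let ?st = "?i + (p * (12 * w + 5) + 5) + ?F + 2"
  let ?s = "(p * 4 + 1 + 2 + (12 * w + 3 + (p * 3 + 1))) + 3"
  let ?r = "(3 + (k * p * 3 + 1)) + 3"
  have const: "c \<le> c * ?X" for c :: nat using X1 mult_le_mono2[of 1 ?X c] by simp
  have "cost_stage + 2 \<le> ?i * ?X + (p * (12 * w + 5) + 5) * ?X + ?F * ?X + 2 * ?X"
    unfolding cost_stage_def cost_increments_def by (intro add_mono ext fil const)
  also have "\<dots> = ?st * ?X" by (simp only: add_mult_distrib)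
  finally have st: "cost_stage + 2 \<le> ?st * ?X" .
  have const_n: "c \<le> c * (?X * n)" for c :: nat
    using X1 n_pos mult_le_mono2[of 1 "?X * n" c] by simp
  have times_n: "c * ?X \<le> c * (?X * n)" for c :: nat using n_pos by simp
  have "n * (cost_stage + 2) \<le> ?st * (?X * n)"
    using mult_le_mono1[OF st, of n] by (simp only: mult.commute[of n] mult.assoc)
  then have "cost_main \<le> 5 * (?X * n) + (?st * (?X * n) + 1 * (?X * n)) + (?s * (?X * n) + (?F * (?X * n) + ?r * (?X * n)))"
    unfolding cost_main_def
    by (intro add_mono const_n order.trans[OF sel times_n] order.trans[OF fil times_n] order.trans[OF pri times_n])
  also have "\<dots> = (5 + (?st + 1) + (?s + (?F + ?r))) * (?X * n)" by (simp only: add_mult_distrib)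
  also have "\<dots> \<le> (5 + (?st + 1) + (?s + (?F + ?r)))
      * (p ^ (T + 1) * 2 ^ ((k + 1) * (p * (p - 1) div 2) * (T + 1)) * n ^ (k\<^sup>2 * p ^ 3))"
    by (intro mult_le_mono2 N_bound_power)
  also have "\<dots> = cost_factor k p * n ^ (k\<^sup>2 * p ^ 3)"
    unfolding cost_factor_def Let_def w_eq[symmetric] T_def[symmetric] by (simp only: mult.assoc)
  finally show ?thesis .
qed

end

definition index_bound :: "nat \<Rightarrow> nat \<Rightarrow> nat \<Rightarrow> nat" where
  "index_bound p k n = (let w = (k + 1) * p; T = k * (p - 1) + 1;
     N = p * ((n + 1) ^ (k + 1)) ^ (p * (p - 1) div 2) in N * w + w + (T ^ 2 ^ w * w + w) + N ^ T + k * n)"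

lemma main_run:
  fixes p k n :: nat and A :: matrix and D :: "nat \<Rightarrow> real set"
  defines "w \<equiv> (k + 1) * p"
  assumes inst: "problem_instance p k n A \<Lambda>"
    and nat_G: "\<And>i. i \<le> index_bound p k n \<Longrightarrow> real i \<in> D (w + 2)"
    and D_mono: "\<And>i. i \<le> w + 2 \<Longrightarrow> D i \<subseteq> D (w + 2)"
    and D_comb: "\<And>i a b c d. \<lbrakk>a \<in> D i; b \<in> D i; c \<in> D i; d \<in> D i\<rbrakk> \<Longrightarrow> a * b - c * d \<in> D (Suc i)"
    and D_consts: "\<And>i. 0 \<in> D i" "\<And>i. 1 \<in> D i" "\<And>i. - 1 \<in> D i"
    and sum_D: "\<And>X i. X \<subseteq> {..<n} \<Longrightarrow> i < k \<Longrightarrow> (\<Sum>l\<in>X. A i l) \<in> D 0"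
    and nat_D: "\<And>i. i \<le> n \<Longrightarrow> real i \<in> D 0"
  shows "\<exists>t. run enumerate_vertices p k n A \<Lambda> t
    \<and> enumerates k p (printed t) (vertices (shaped_partition_polytope p k n A \<Lambda>))
    \<and> operations t \<le> cost_factor k p * n ^ (k\<^sup>2 * p ^ 3) \<and> numbers t \<subseteq> D (w + 2)"
proof -
  have pos: "0 < p" "0 < k" "0 < n" using inst by (auto simp: problem_instance_def)
  interpret run_machine "shape_oracle p n \<Lambda>" "D (w + 2)" "index_bound p k n" D w p k n A \<Lambda>
    by unfold_locales (use pos nat_G D_mono D_comb D_consts sum_D nat_D in \<open>auto simp: w_def\<close>)
  interpret sized_run "shape_oracle p n \<Lambda>" "D (w + 2)" "index_bound p k n" D w p k n A \<Lambda>
    by unfold_locales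
      (simp_all add: index_bound_def Let_def N_bound_def S_bound_def T_def w_def del: mult_Suc add_mult_distrib power_Suc)
  obtain R M where RM: "input_state p k n A = (R, M)" by fastforce
  have M0: "M 0 (i * n + m) = A i m" if "i < k" "m < n" for i m
    using RM that grid_less[OF that] by (auto simp: input_state_def)
  have "wp (shape_oracle p n \<Lambda>) (D (w + 2)) enumerate_vertices (\<lambda>l out R' M'. l \<le> cost_main
    \<and> enumerates k p out (vertices (shaped_partition_polytope p k n A \<Lambda>))) R M"
    by (rule wp_main) (use RM M0 in \<open>auto simp: input_state_def input_stored_def\<close>)
  then obtain t s where "exec (shape_oracle p n \<Lambda>) enumerate_vertices (R, M) t s" "numbers t \<subseteq> D (w + 2)"
    "operations t \<le> cost_main" "enumerates k p (printed t) (vertices (shaped_partition_polytope p k n A \<Lambda>))"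
    unfolding wp_def by blast
  then show ?thesis using cost_main_bound unfolding run_def RM
    by (intro exI[of _ t] conjI exI[of _ s]) (assumption | linarith)+
qed


section \<open>Bit sizes\<close>

text \<open>Fractions with numerator and denominator of at most about \<open>s\<close> bits, not necessarily in lowest
  terms. They need no cancellation in the bounds for sums and products, and reduction to lowest terms
  only makes the numbers smaller.\<close>

definition fractions :: "nat \<Rightarrow> real set" where
  "fractions s = {x. \<exists>a b :: int. 0 < b \<and> b \<le> 2 ^ s \<and> \<bar>a\<bar> \<le> 2 ^ s \<and> x = of_int a / of_int b}"

lemma fractions_mono: "s \<le> t \<Longrightarrow> fractions s \<subseteq> fractions t"
proof -
  assume "s \<le> t"
  then have "(2::int) ^ s \<le> 2 ^ t" by (intro power_increasing) auto
  then have "b \<le> 2 ^ t" if "b \<le> 2 ^ s" for b :: int using that by linarith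
  then show ?thesis unfolding fractions_def by blast
qed

lemma int_in_fractions: "\<bar>a\<bar> \<le> 2 ^ s \<Longrightarrow> of_int a \<in> fractions s"
  unfolding fractions_def by (intro CollectI exI[of _ a] exI[of _ 1]) auto

lemma fractions_add:
  assumes "x \<in> fractions s" "y \<in> fractions t"
  shows "x + y \<in> fractions (s + t + 1)"
proof -
  obtain a b where x: "0 < b" "b \<le> 2 ^ s" "\<bar>a\<bar> \<le> 2 ^ s" "x = of_int a / of_int b"
    using assms(1) unfolding fractions_def by auto
  obtain c d where y: "0 < d" "d \<le> 2 ^ t" "\<bar>c\<bar> \<le> 2 ^ t" "y = of_int c / of_int d"
    using assms(2) unfolding fractions_def by auto
  have "b * d \<le> 2 ^ s * 2 ^ t" using x y by (intro mult_mono) auto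
  moreover have "(0::int) \<le> 2 ^ s * 2 ^ t" by simp
  moreover have "(2::int) ^ (s + t + 1) = 2 * (2 ^ s * 2 ^ t)" by (simp add: power_add)
  ultimately have bd: "b * d \<le> 2 ^ (s + t + 1)" by linarith
  have "\<bar>a * d\<bar> \<le> 2 ^ s * 2 ^ t" "\<bar>c * b\<bar> \<le> 2 ^ t * 2 ^ s"
    unfolding abs_mult using x y by (intro mult_mono; auto)+
  then have "\<bar>a * d + c * b\<bar> \<le> 2 ^ (s + t + 1)" by (simp add: power_add mult.commute)
  moreover have "x + y = of_int (a * d + c * b) / of_int (b * d)" using x y by (simp add: field_simps)
  ultimately show ?thesis unfolding fractions_def using bd x y
    by (intro CollectI exI[of _ "a * d + c * b"] exI[of _ "b * d"]) auto
qed

lemma fractions_mult: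
  assumes "x \<in> fractions s" "y \<in> fractions t"
  shows "x * y \<in> fractions (s + t)"
proof -
  obtain a b where x: "0 < b" "b \<le> 2 ^ s" "\<bar>a\<bar> \<le> 2 ^ s" "x = of_int a / of_int b"
    using assms(1) unfolding fractions_def by auto
  obtain c d where y: "0 < d" "d \<le> 2 ^ t" "\<bar>c\<bar> \<le> 2 ^ t" "y = of_int c / of_int d"
    using assms(2) unfolding fractions_def by auto
  have "b * d \<le> 2 ^ s * 2 ^ t" using x y by (intro mult_mono) auto
  moreover have "\<bar>a * c\<bar> \<le> 2 ^ s * 2 ^ t" unfolding abs_mult using x y by (intro mult_mono) auto
  moreover have "x * y = of_int (a * c) / of_int (b * d)" using x y by simp
  ultimately show ?thesis unfolding fractions_def using x y
    by (intro CollectI exI[of _ "a * c"] exI[of _ "b * d"]) (auto simp: power_add)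
qed

lemma fractions_uminus: "x \<in> fractions s \<Longrightarrow> - x \<in> fractions s"
proof -
  assume "x \<in> fractions s"
  then obtain a b where "0 < b" "b \<le> 2 ^ s" "\<bar>a\<bar> \<le> 2 ^ s" "x = of_int a / of_int b" unfolding fractions_def by auto
  then show ?thesis unfolding fractions_def by (intro CollectI exI[of _ "- a"] exI[of _ b]) auto
qed

lemma fractions_comb:
  assumes "a \<in> fractions s" "b \<in> fractions s" "c \<in> fractions s" "d \<in> fractions s" "1 \<le> s"
  shows "a * b - c * d \<in> fractions (5 * s)"
proof -
  have "a * b + - (c * d) \<in> fractions ((s + s) + (s + s) + 1)"
    by (intro fractions_add fractions_mult fractions_uminus assms)
  then show ?thesis using fractions_mono[of "(s + s) + (s + s) + 1" "5 * s"] assms(5) by auto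
qed

lemma fractions_sum:
  assumes "finite X" "\<And>l. l \<in> X \<Longrightarrow> f l \<in> fractions (s l)"
  shows "(\<Sum>l\<in>X. f l) \<in> fractions (\<Sum>l\<in>X. s l + 1)"
  using assms
proof (induction X)
  case empty
  show ?case using int_in_fractions[of 0 0] by simp
next
  case (insert l X)
  then have "f l + (\<Sum>l\<in>X. f l) \<in> fractions (s l + (\<Sum>l\<in>X. s l + 1) + 1)" by (intro fractions_add) auto
  then show ?case using insert by (simp add: algebra_simps)
qed

lemma bitlen_le: "0 \<le> a \<Longrightarrow> a \<le> 2 ^ s \<Longrightarrow> nat (bitlen a) \<le> s + 1"
proof -
  assume a: "0 \<le> a" "a \<le> 2 ^ s"
  have "bitlen a \<le> int s + 1"
  proof (cases "a = 0")
    case False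
    then have "2 ^ nat (bitlen a - 1) \<le> a" using a bitlen_bounds[of a] by simp
    then have "(2::int) ^ nat (bitlen a - 1) \<le> 2 ^ s" using a by linarith
    then have "nat (bitlen a - 1) \<le> s" by (rule power_le_imp_le_exp[rotated]) simp
    then show ?thesis by linarith
  qed (simp add: bitlen_def floorlog_def)
  then show ?thesis by linarith
qed

lemma le_bitlen: "0 \<le> a \<Longrightarrow> a \<le> 2 ^ nat (bitlen a)"
  using bitlen_bounds[of a] by (cases "a = 0") auto

lemma of_rat_the: "(THE r. real_of_rat q = of_rat r) = q"
  by auto

lemma bit_size_of_rat:
  "quotient_of q = (a, b) \<Longrightarrow> bit_size (of_rat q) = 1 + nat (bitlen \<bar>a\<bar>) + nat (bitlen b)"
  unfolding bit_size_def of_rat_the by simp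

lemma rational_in_fractions:
  assumes "x \<in> \<rat>"
  shows "x \<in> fractions (bit_size x)"
proof -
  obtain q where q: "x = of_rat q" using assms Rats_cases by blast
  obtain a b where ab: "quotient_of q = (a, b)" by fastforce
  have b: "0 < b" using quotient_of_denom_pos[OF ab] .
  have x: "x = of_int a / of_int b" unfolding q using quotient_of_div[OF ab] by (simp add: of_rat_divide)
  have size: "bit_size x = 1 + nat (bitlen \<bar>a\<bar>) + nat (bitlen b)" unfolding q by (rule bit_size_of_rat[OF ab])
  have "\<bar>a\<bar> \<le> 2 ^ bit_size x"
    using le_bitlen[of "\<bar>a\<bar>"] power_increasing[of "nat (bitlen \<bar>a\<bar>)" "bit_size x" "2::int"] size by simp
  moreover have "b \<le> 2 ^ bit_size x"
    using le_bitlen[of b] power_increasing[of "nat (bitlen b)" "bit_size x" "2::int"] size b by simp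
  ultimately show ?thesis unfolding fractions_def using b x by blast
qed

lemma bit_size_fraction:
  assumes "x \<in> fractions s"
  shows "x \<in> \<rat>" "bit_size x \<le> 2 * s + 3"
proof -
  obtain a b where x: "0 < b" "b \<le> 2 ^ s" "\<bar>a\<bar> \<le> 2 ^ s" "x = of_int a / of_int b"
    using assms unfolding fractions_def by auto
  let ?q = "Fract a b"
  have q: "x = of_rat ?q" using x by (simp add: of_rat_rat)
  then show "x \<in> \<rat>" by simp
  have qu: "quotient_of ?q = (a div gcd a b, b div gcd a b)"
    using x(1) by (simp add: quotient_of_Fract normalize_def Let_def)
  have g: "0 < gcd a b" using x(1) by simp
  have quot: "\<bar>c div gcd a b\<bar> \<le> \<bar>c\<bar>" if "gcd a b dvd c" for c
  proof -
    have "\<bar>c\<bar> = \<bar>c div gcd a b\<bar> * gcd a b" using that by (metis abs_mult abs_gcd_int dvd_div_mult_self)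
    moreover have "\<bar>c div gcd a b\<bar> * 1 \<le> \<bar>c div gcd a b\<bar> * gcd a b"
      by (intro mult_left_mono) (use g in linarith, simp)
    ultimately show ?thesis by simp
  qed
  have "nat (bitlen \<bar>a div gcd a b\<bar>) \<le> s + 1" using quot[of a] x(3) by (intro bitlen_le) auto
  moreover have "nat (bitlen (b div gcd a b)) \<le> s + 1"
  proof (rule bitlen_le)
    show "0 \<le> b div gcd a b" using x(1) g by (simp add: pos_imp_zdiv_nonneg_iff)
    show "b div gcd a b \<le> 2 ^ s" using quot[of b] x(1,2) by simp
  qed
  ultimately show "bit_size x \<le> 2 * s + 3" unfolding q bit_size_of_rat[OF qu] by linarith
qed

lemma bit_size_pos: "1 \<le> bit_size x"
  unfolding bit_size_def by (simp split: prod.split)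

section \<open>Runs on rational input\<close>

lemma index_bound_le_power:
  assumes "0 < p" "0 < k"
  obtains c e where "\<And>n. index_bound p k n \<le> 2 ^ (c + e * n)"
proof -
  let ?w = "(k + 1) * p" and ?T = "k * (p - 1) + 1" and ?a = "(k + 1) * (p * (p - 1) div 2)"
  let ?N = "\<lambda>n. p * ((n + 1) ^ (k + 1)) ^ (p * (p - 1) div 2)"
  let ?e = "?a + ?a * ?T + 1"
  let ?c = "p * ?w + ?w + (?T ^ 2 ^ ?w * ?w + ?w) + p ^ ?T + k"
  have "index_bound p k n \<le> 2 ^ (?c + ?e * n)" for n
  proof -
    let ?E = "(n + 1) ^ ?e"
    have N: "?N n = p * (n + 1) ^ ?a" by (simp only: power_mult)
    have pow: "(n + 1) ^ i \<le> ?E" if "i \<le> ?e" for i using that by (intro power_increasing) auto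
    have "?N n * ?w = p * ?w * (n + 1) ^ ?a" unfolding N by (simp only: mult.commute mult.left_commute)
    also have "\<dots> \<le> p * ?w * ?E" by (intro mult_le_mono2 pow) simp
    finally have 1: "?N n * ?w \<le> p * ?w * ?E" .
    have "?N n ^ ?T = p ^ ?T * (n + 1) ^ (?a * ?T)" unfolding N by (simp only: power_mult_distrib power_mult)
    also have "\<dots> \<le> p ^ ?T * ?E" by (intro mult_le_mono2 pow) simp
    finally have 2: "?N n ^ ?T \<le> p ^ ?T * ?E" .
    have "n \<le> (n + 1) ^ 1" by simp
    also have "\<dots> \<le> ?E" by (rule pow) simp
    finally have 3: "k * n \<le> k * ?E" by (rule mult_le_mono2)
    have "1 \<le> ?E" by (rule one_le_power) simp
    then have 4: "c \<le> c * ?E" for c :: nat using mult_le_mono2[of 1 ?E c] by (simp only: mult_1_right)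
    have "index_bound p k n \<le> p * ?w * ?E + ?w * ?E + (?T ^ 2 ^ ?w * ?w + ?w) * ?E + p ^ ?T * ?E + k * ?E"
      unfolding index_bound_def Let_def by (intro add_mono 1 2 3 4)
    also have "\<dots> = ?c * ?E" by (simp only: add_mult_distrib)
    also have "\<dots> \<le> 2 ^ ?c * (2 ^ n) ^ ?e"
      by (intro mult_le_mono power_mono) (auto simp: less_imp_le Suc_le_eq simp del: mult_Suc power_Suc)
    also have "\<dots> = 2 ^ (?c + ?e * n)"
    proof -
      have "2 ^ a * (2 ^ n) ^ b = (2::nat) ^ (a + b * n)" for a b
        by (simp add: power_add power_mult[symmetric] mult.commute)
      then show ?thesis .
    qed
    finally show ?thesis .
  qed
  then show ?thesis by (rule that)
qed

text \<open>The records contain subset sums of a row of \<open>A\<close>, whose sizes are bounded by the sum of the sizes of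
  the entries, so level \<open>0\<close> is linear in the input size. Each of the \<open>(k + 1) * p + 2\<close> levels above it
  multiplies the size by five. The indices are polynomial in \<open>n\<close>, so
  a linear term covers them as well.\<close>

lemma rational_run:
  assumes "0 < p" "0 < k"
  obtains g :: "nat poly" where "\<And>n A \<Lambda>. problem_instance p k n A \<Lambda> \<Longrightarrow> (\<forall>i<k. \<forall>j<n. A i j \<in> \<rat>) \<Longrightarrow>
    \<exists>t. run enumerate_vertices p k n A \<Lambda> t \<and> operations t \<le> cost_factor k p * n ^ (k\<^sup>2 * p ^ 3)
      \<and> (\<forall>x\<in>numbers t. x \<in> \<rat> \<and> bit_size x \<le> poly g (input_size p k n A))"
proof -
  let ?w = "(k + 1) * p"
  obtain c e where ce: "\<And>n. index_bound p k n \<le> 2 ^ (c + e * n)" using index_bound_le_power[OF assms] by blast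
  let ?g = "[: 2 * ((c + 1) * 5 ^ (?w + 2)) + 3, 2 * ((e + 2) * 5 ^ (?w + 2)) :] :: nat poly"
  have "\<exists>t. run enumerate_vertices p k n A \<Lambda> t \<and> operations t \<le> cost_factor k p * n ^ (k\<^sup>2 * p ^ 3)
      \<and> (\<forall>x\<in>numbers t. x \<in> \<rat> \<and> bit_size x \<le> poly ?g (input_size p k n A))"
    if inst: "problem_instance p k n A \<Lambda>" and rat: "\<forall>i<k. \<forall>j<n. A i j \<in> \<rat>" for n A \<Lambda>
  proof -
    define L where "L = input_size p k n A"
    \<comment> \<open>This covers the indices, by \<open>c + e * n\<close>, and the subset sums, by \<open>L + n\<close>, as \<open>n \<le> L\<close>.\<close>
    define s where "s = c + 1 + (e + 2) * L"
    define D where "D = (\<lambda>i. fractions (s * 5 ^ i))"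
    have k_pos: "0 < k" and n_pos: "0 < n" using inst by (auto simp: problem_instance_def)
    have row: "(\<Sum>l<n. bit_size (A i l)) \<le> L" if "i < k" for i
    proof -
      have "(\<Sum>l<n. bit_size (A i l)) \<le> (\<Sum>i<k. \<Sum>l<n. bit_size (A i l))"
        using that by (intro member_le_sum) auto
      then show ?thesis unfolding L_def input_size_def by linarith
    qed
    have "(\<Sum>l<n. 1) \<le> (\<Sum>l<n. bit_size (A 0 l))" by (intro sum_mono bit_size_pos)
    then have nL: "n \<le> L" using row[OF k_pos] by simp
    have "1 \<le> s" unfolding s_def by simp
    then have s1: "1 \<le> s * 5 ^ i" for i using mult_le_mono[of 1 s 1 "5 ^ i"] by simp
    have ss: "s \<le> s * 5 ^ i" for i by simp
    have nat: "real i \<in> fractions s" if "i \<le> index_bound p k n" for i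
    proof -
      have "e * n \<le> (e + 2) * L" using nL by (intro mult_le_mono) auto
      then have "(2::nat) ^ (c + e * n) \<le> 2 ^ s" unfolding s_def by (intro power_increasing) auto
      then have "i \<le> 2 ^ s" using that ce[of n] by linarith
      then have "\<bar>int i\<bar> \<le> 2 ^ s" by (metis abs_of_nat of_nat_le_iff of_nat_numeral of_nat_power)
      then show ?thesis using int_in_fractions[of "int i" s] by simp
    qed
    have const: "of_int a \<in> fractions t" if "\<bar>a\<bar> \<le> 1" for a t
      using that one_le_power[of "2::int" t] by (intro int_in_fractions) linarith
    have "\<exists>t. run enumerate_vertices p k n A \<Lambda> t
      \<and> enumerates k p (printed t) (vertices (shaped_partition_polytope p k n A \<Lambda>))
      \<and> operations t \<le> cost_factor k p * n ^ (k\<^sup>2 * p ^ 3) \<and> numbers t \<subseteq> D (?w + 2)"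
    proof (rule main_run[OF inst], goal_cases)
      case (1 i)
      then show ?case using nat fractions_mono[OF ss] unfolding D_def by blast
    next
      case (2 i)
      then show ?case unfolding D_def by (intro fractions_mono mult_le_mono2 power_increasing) auto
    next
      case (3 i a b c d)
      then have "a * b - c * d \<in> fractions (5 * (s * 5 ^ i))" unfolding D_def by (intro fractions_comb s1)
      then show ?case unfolding D_def by (simp add: mult.left_commute mult.commute)
    next
      case (4 i)
      show ?case using const[of 0] unfolding D_def by simp
    next
      case (5 i)
      show ?case using const[of 1] unfolding D_def by simp
    next
      case (6 i)
      show ?case using const[of "- 1"] unfolding D_def by simp
    next
      case (7 X i)
      then have "(\<Sum>l\<in>X. A i l) \<in> fractions (\<Sum>l\<in>X. bit_size (A i l) + 1)"
        using rat by (intro fractions_sum rational_in_fractions) (auto intro: finite_subset)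
      moreover have "(\<Sum>l\<in>X. bit_size (A i l) + 1) \<le> (\<Sum>l<n. bit_size (A i l) + 1)"
        using 7 by (intro sum_mono2) auto
      moreover have "(\<Sum>l<n. bit_size (A i l) + 1) = (\<Sum>l<n. bit_size (A i l)) + n"
        by (simp add: sum.distrib sum_Suc)
      moreover have "L + n \<le> s" using nL unfolding s_def by simp
      ultimately show ?case
        using row[OF 7(2)] fractions_mono[of "\<Sum>l\<in>X. bit_size (A i l) + 1" s] unfolding D_def by auto
    next
      case (8 i)
      have "n \<le> k * n" using k_pos by simp
      also have "\<dots> \<le> index_bound p k n" unfolding index_bound_def Let_def by simp
      finally show ?case using nat[of i] 8 unfolding D_def by simp
    qed
    then obtain t where t: "run enumerate_vertices p k n A \<Lambda> t" "operations t \<le> cost_factor k p * n ^ (k\<^sup>2 * p ^ 3)"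
      "numbers t \<subseteq> D (?w + 2)" by blast
    have "2 * (s * 5 ^ (?w + 2)) + 3 = poly ?g L" unfolding s_def by (simp add: algebra_simps)
    then have "x \<in> \<rat> \<and> bit_size x \<le> poly ?g L" if "x \<in> numbers t" for x
      using bit_size_fraction[of x "s * 5 ^ (?w + 2)"] t(3) that unfolding D_def by auto
    then show ?thesis using t unfolding L_def by blast
  qed
  then show ?thesis by (rule that)
qed

lemma real_run:
  assumes "problem_instance p k n A \<Lambda>"
  shows "\<exists>t. run enumerate_vertices p k n A \<Lambda> t
    \<and> enumerates k p (printed t) (vertices (shaped_partition_polytope p k n A \<Lambda>))
    \<and> operations t \<le> cost_factor k p * n ^ (k\<^sup>2 * p ^ 3)"
  using main_run[OF assms, of "\<lambda>_. UNIV"] by auto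

theorem theorem4p5:
  shows "\<exists>prog :: program.
    (\<exists>C :: nat \<Rightarrow> nat \<Rightarrow> nat. \<forall>p k n A \<Lambda>. problem_instance p k n A \<Lambda> \<longrightarrow>
       (\<exists>t. run prog p k n A \<Lambda> t
          \<and> enumerates k p (printed t) (vertices (shaped_partition_polytope p k n A \<Lambda>))
          \<and> operations t \<le> C k p * n ^ (k\<^sup>2 * p ^ 3)))
    \<and> (\<forall>p k. 0 < p \<longrightarrow> 0 < k \<longrightarrow> strongly_polynomial_time prog p k)"
proof -
  have bound: "\<forall>p k n A \<Lambda>. problem_instance p k n A \<Lambda> \<longrightarrow>
       (\<exists>t. run enumerate_vertices p k n A \<Lambda> t
          \<and> enumerates k p (printed t) (vertices (shaped_partition_polytope p k n A \<Lambda>))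
          \<and> operations t \<le> cost_factor k p * n ^ (k\<^sup>2 * p ^ 3))"
    using real_run by blast
  have "strongly_polynomial_time enumerate_vertices p k" if pk: "0 < p" "0 < k" for p k
  proof -
    obtain g :: "nat poly" where g: "\<And>n A \<Lambda>. problem_instance p k n A \<Lambda> \<Longrightarrow> (\<forall>i<k. \<forall>j<n. A i j \<in> \<rat>) \<Longrightarrow>
      \<exists>t. run enumerate_vertices p k n A \<Lambda> t \<and> operations t \<le> cost_factor k p * n ^ (k\<^sup>2 * p ^ 3)
        \<and> (\<forall>x\<in>numbers t. x \<in> \<rat> \<and> bit_size x \<le> poly g (input_size p k n A))"
      using rational_run[OF pk] by blast
    let ?f = "monom (cost_factor k p) (k\<^sup>2 * p ^ 3)"
    have f: "poly ?f n = cost_factor k p * n ^ (k\<^sup>2 * p ^ 3)" for n by (rule poly_monom)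
    show "strongly_polynomial_time enumerate_vertices p k"
      unfolding strongly_polynomial_time_def
    proof (rule exI[of _ ?f], rule exI[of _ g], intro allI impI)
      fix n A \<Lambda>
      assume inst: "problem_instance p k n A \<Lambda>"
      show "\<exists>t. run enumerate_vertices p k n A \<Lambda> t \<and> operations t \<le> poly ?f n
          \<and> ((\<forall>i<k. \<forall>j<n. A i j \<in> \<rat>) \<longrightarrow>
                (\<forall>x\<in>numbers t. x \<in> \<rat> \<and> bit_size x \<le> poly g (input_size p k n A)))"
      proof (cases "\<forall>i<k. \<forall>j<n. A i j \<in> \<rat>")
        case True
        then show ?thesis using g[OF inst] unfolding f by blast
      next
        case False
        then show ?thesis using real_run[OF inst] unfolding f by blast
      qed
    qed
  qed
  then have "\<forall>p k. 0 < p \<longrightarrow> 0 < k \<longrightarrow> strongly_polynomial_time enumerate_vertices p k" by blast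
  with bound show ?thesis by (intro exI[of _ enumerate_vertices] conjI exI[of _ cost_factor])
qed

end
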